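(* Let $d\in\mathbb{N}$ be either $d=3$ or even, let $m\in\{1,\dots,d-1\}$, let $(J_k)_{k\in\mathbb{N}}$ be a bounded sequence in $\mathbb{N}=\{1,2,\dots\}$, and let $N_k:=(d-m)J_k$. Let $S\in\mathbb{N}$ be fixed. Then there exists $\varepsilon_0\in(0,1)$ small enough such that, for any $\varepsilon\in(0,\varepsilon_0)$ and for any sequence of frequency vectors $\nu=(\nu_k)_{k\in\mathbb{N}}\in(\mathbb{R}^{N_k})_{k\in\mathbb{N}}\setminus\{0\}$ satisfying $$\sup_{k\in\mathbb{N}}\varepsilon^{-(S+1)(k-1)}|\nu_k|<\infty ,$$ there exist a non-symmetric $\mathcal{C}^1_b$ embedding $U:(\mathbb{T}^{N_k})_{k\in\mathbb{N}}\to\mathcal{C}^S_{\rm div}(\mathbb{T}^d,\mathbb{R}^d)$ and a family of initial data $u_\theta\in\mathcal{C}^S_{\rm div}(\mathbb{T}^d,\mathbb{R}^d)$, $\theta\in(\mathbb{T}^{N_k})_{k\in\mathbb{N}}$, such that, for every $\theta\in(\mathbb{T}^{N_k})_{k\in\mathbb{N}}$, the function $u(t,\cdot)=U(\theta+\nu t)$, with $u(0,\cdot)=u_\theta$, is a solution for all $t\in\mathbb{R}$ of the incompressible Euler equations $$\partial_t u+u\cdot\nabla u+\nabla p=0,\qquad \operatorname{div}u=0\qquad\text{on }\mathbb{R}\times\mathbb{T}^d,$$ with pressure $p(t,\cdot)=P(\theta+\nu t)$, where $$P(\vartheta):=(-\Delta)^{-1}\big[\operatorname{div}\big(U(\vartheta)\cdot\nabla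 U(\vartheta)\big)\big],\qquad P:(\mathbb{T}^{N_k})_{k\in\mathbb{N}}\to\mathcal{C}^S(\mathbb{T}^d).$$ As a consequence, if the sequence $\nu=(\nu_k)_{k\in\mathbb{N}}$ is non-resonant, then the solution $u(t,x)$ is time almost-periodic.
   Context: Notation. $\mathbb{N}=\{1,2,\dots\}$, $\mathbb{N}_0=\mathbb{N}\cup\{0\}$, $\mathbb{T}=\mathbb{R}/2\pi\mathbb{Z}$, and $|\cdot|$ is the Euclidean norm. For $f$ on $\mathbb{T}^d$ and $n\in\mathbb{N}_0$, $\|f\|_{n,\infty}:=\sup_{x\in\mathbb{T}^d}\max_{\alpha\in\mathbb{N}_0^d,\,|\alpha|=n}|\partial_x^\alpha f(x)|$. For $s\in\mathbb{N}\cup\{\infty\}$, $\mathcal{C}^s_{\rm div}(\mathbb{T}^d,\mathbb{R}^d)$ is the space of $\mathcal{C}^s$-smooth, divergence-free vector fields on $\mathbb{T}^d$, endowed with the seminorms $\|\cdot\|_{n,\infty}$, $0\le n\le s$ ($n$ finite); $\mathcal{C}^S(\mathbb{T}^d)$ is the space of real-valued $\mathcal{C}^S$ functions. $(-\Delta)^{-1}$ is the inverse of $-\Delta$ on zero-average functions on $\mathbb{T}^d$. Infinite dimensional torus. $(\mathbb{T}^{N_k})_{k\in\mathbb{N}}$ denotes the set of sequences $\theta=(\theta_k)_{k\in\mathbb{N}}$ with $\theta_k\in\mathbb{T}^{N_k}$ (all such sequences have finite sup-norm $|\theta|_\infty$, since $(N_k)$ is bounded), and its "tangent space" is $(\mathbb{R}^{N_k})_{k\in\mathbb{N}}:=\{\nu=(\nu_k)_{k\in\mathbb{N}}:\nu_k\in\mathbb{R}^{N_k},\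 |\nu|_\infty:=\sup_k|\nu_k|<\infty\}$. The torus is given the topology and smooth structure of the sup-norm. $\mathcal{C}^1_b$ maps. A map $U:(\mathbb{T}^{N_k})_{k\in\mathbb{N}}\to\mathcal{C}^s_{\rm div}(\mathbb{T}^d,\mathbb{R}^d)$ is $\mathcal{C}^1_b$ if it is Fréchet-differentiable with continuous Fréchet derivative and for every $n\in\{0,1,\dots,s\}$ there is $C_n>0$ such that $\sup_\vartheta\|U(\vartheta)\|_{n,\infty}\le C_n$ and $\sup_\vartheta\|\mathrm{d}_\vartheta U(\vartheta)[\widehat\vartheta]\|_{n,\infty}\le C_n|\widehat\vartheta|_\infty$ for all $\widehat\vartheta\in(\mathbb{R}^{N_k})_{k\in\mathbb{N}}$, where $\mathrm{d}_\vartheta U(\vartheta):(\mathbb{R}^{N_k})_{k\in\mathbb{N}}\to\mathcal{C}^s_{\rm div}(\mathbb{T}^d,\mathbb{R}^d)$ is the Fréchet differential at $\vartheta$. A $\mathcal{C}^1_b$ embedding is an injective $\mathcal{C}^1_b$ map. Non-symmetric. $U$ is non-symmetric (non-traveling) if for every $\vartheta\in(\mathbb{T}^{N_k})_{k\in\mathbb{N}}$ the vector field $U(\vartheta)$ is not invariant under any 1-parameter group of translations of $\mathbb{T}^d$, i.e. there is no $a\in\mathbb{R}^d\setminus\{0\}$ with $U(\vartheta)(x+sa)=U(\vartheta)(x)$ for all $s\in\mathbb{R}$, $x\in\mathbb{T}^d$. Non-resonant. Fix $\eta>0$ and put $|\ell|_\eta:=\sum_{k\in\mathbb{N}}k^\eta|\ell_k|$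 for $\ell=(\ell_k)_{k\in\mathbb{N}}$, $\ell_k\in\mathbb{Z}^{N_k}$. The sequence $\nu\in(\mathbb{R}^{N_k})_{k\in\mathbb{N}}$ is non-resonant if $\sum_{k\in\mathbb{N}}\nu_k\cdot\ell_k\ne0$ for every $\ell=(\ell_k)_{k\in\mathbb{N}}$ with $\ell_k\in\mathbb{Z}^{N_k}$ and $0<|\ell|_\eta<\infty$ (such $\ell$ has only finitely many non-zero components). Time almost-periodic. $u(t,x)$ is time almost-periodic (with regularity $s$; here $s=S$) if there exist a non-resonant sequence $\nu\in(\mathbb{R}^{N_k})_{k\in\mathbb{N}}$ and a $\mathcal{C}^1$-smooth embedding $U:(\mathbb{T}^{N_k})_{k\in\mathbb{N}}\to\mathcal{C}^s_{\rm div}(\mathbb{T}^d,\mathbb{R}^d)$ such that $u(t,\cdot)=U(\theta+\nu t)$ for some $\theta\in(\mathbb{T}^{N_k})_{k\in\mathbb{N}}$. Here too an embedding is understood as injective. *)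

theory Defs
  imports "HOL-Analysis.Analysis"
begin

(* A function on the torus T^d = R^d / (2 pi Z)^d is represented by its lift to R^d, where d = CARD('d). *)

definition torus_fun :: "(real^'d \<Rightarrow> 'b) \<Rightarrow> bool" where
  "torus_fun f \<longleftrightarrow> (\<forall>x i. f (x + (2 * pi) *\<^sub>R axis i 1) = f x)"

definition partial_deriv :: "'d \<Rightarrow> (real^'d \<Rightarrow> 'b::real_normed_vector) \<Rightarrow> real^'d \<Rightarrow> 'b" where
  "partial_deriv i f x = frechet_derivative f (at x) (axis i 1)"

primrec Ck :: "nat \<Rightarrow> (real^'d \<Rightarrow> 'b::real_normed_vector) \<Rightarrow> bool" where
  "Ck 0 f \<longleftrightarrow> continuous_on UNIV f"
| "Ck (Suc n) f \<longleftrightarrow> f differentiable_on UNIV \<and> (\<forall>i. Ck n (partial_deriv i f))"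

(* The order in which the coordinates are processed is an arbitrary fixed one; it is irrelevant
   for the functions of class C^n, n = |alpha|, to which this is applied. *)

definition multi_deriv :: "('d \<Rightarrow> nat) \<Rightarrow> (real^'d \<Rightarrow> 'b::real_normed_vector) \<Rightarrow> real^'d \<Rightarrow> 'b" where
  "multi_deriv \<alpha> f = foldr (\<lambda>i. partial_deriv i ^^ \<alpha> i) (SOME is. distinct is \<and> set is = UNIV) f"

definition seminorm_inf :: "nat \<Rightarrow> (real^'d \<Rightarrow> 'b::real_normed_vector) \<Rightarrow> real" where
  "seminorm_inf n f = (SUP x. MAX \<alpha>\<in>{\<alpha>. (\<Sum>i\<in>UNIV. \<alpha> i) = n}. norm (multi_deriv \<alpha> f x))"

definition divergence :: "(real^'d \<Rightarrow> real^'d) \<Rightarrow> real^'d \<Rightarrow> real" where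
  "divergence v x = (\<Sum>i\<in>UNIV. partial_deriv i v x $ i)"

definition gradient :: "(real^'d \<Rightarrow> real) \<Rightarrow> real^'d \<Rightarrow> real^'d" where
  "gradient p x = (\<chi> i. partial_deriv i p x)"

definition laplacian :: "(real^'d \<Rightarrow> real) \<Rightarrow> real^'d \<Rightarrow> real" where
  "laplacian p x = (\<Sum>i\<in>UNIV. partial_deriv i (partial_deriv i p) x)"

(* v . grad v *)

definition convection :: "(real^'d \<Rightarrow> real^'d) \<Rightarrow> real^'d \<Rightarrow> real^'d" where
  "convection v x = (\<Sum>j\<in>UNIV. v x $ j *\<^sub>R partial_deriv j v x)"

definition Cs_torus :: "nat \<Rightarrow> (real^'d \<Rightarrow> real) set" where
  "Cs_torus s = {f. torus_fun f \<and> Ck s f}"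

definition Cs_div :: "nat \<Rightarrow> (real^'d \<Rightarrow> real^'d) set" where
  "Cs_div s = {v. torus_fun v \<and> Ck s v \<and> (\<forall>x. divergence v x = 0)}"

(* The inverse of the negative Laplacian on zero-average periodic distributions. For v merely C^1
   the product v . grad v is only continuous, so its divergence has to be read distributionally; for
   v of class C^2 this agrees with the pointwise reading. A distribution is given by its action on
   test functions. The relation is_inv_neg_laplacian T p, meaning p = (-Laplacian)^(-1) T, determines
   the continuous function p uniquely. *)

definition test_functions :: "(real^'d \<Rightarrow> real) set" where
  "test_functions = {\<phi>. torus_fun \<phi> \<and> (\<forall>n. Ck n \<phi>)}"

definition torus_integral :: "(real^'d \<Rightarrow> real) \<Rightarrow> real" where
  "torus_integral f = integral (cbox 0 (\<chi> i. 2 * pi)) f"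

definition distr_divergence :: "(real^'d \<Rightarrow> real^'d) \<Rightarrow> (real^'d \<Rightarrow> real) \<Rightarrow> real" where
  "distr_divergence F \<phi> = - torus_integral (\<lambda>x. F x \<bullet> gradient \<phi> x)"

definition is_inv_neg_laplacian ::
    "((real^'d \<Rightarrow> real) \<Rightarrow> real) \<Rightarrow> (real^'d \<Rightarrow> real) \<Rightarrow> bool" where
  "is_inv_neg_laplacian T p \<longleftrightarrow>
     torus_fun p \<and> continuous_on UNIV p \<and> torus_integral p = 0 \<and>
     (\<forall>\<phi>\<in>test_functions. torus_integral (\<lambda>x. p x * (- laplacian \<phi> x)) = T \<phi>)"

definition euler_solution ::
    "(real \<Rightarrow> real^'d \<Rightarrow> real^'d) \<Rightarrow> (real \<Rightarrow> real^'d \<Rightarrow> real) \<Rightarrow> bool" where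
  "euler_solution u p \<longleftrightarrow>
     (\<forall>t. torus_fun (u t) \<and> u t differentiable_on UNIV \<and>
          torus_fun (p t) \<and> p t differentiable_on UNIV) \<and>
     (\<forall>t x. \<exists>ut. ((\<lambda>\<tau>. u \<tau> x) has_vector_derivative ut) (at t) \<and>
              ut + convection (u t) x + gradient (p t) x = 0 \<and>
              divergence (u t) x = 0)"

(* Sequences (nu_k), k >= 1, nu_k in R^(N k), are functions of k and of a coordinate index i < N k,
   extended by zero to the unused indices; in particular the entry k = 0 is unused. *)

definition seq_support :: "(nat \<Rightarrow> nat) \<Rightarrow> (nat \<Rightarrow> nat \<Rightarrow> 'a::zero) \<Rightarrow> bool" where
  "seq_support N \<nu> \<longleftrightarrow> (\<forall>k i. k = 0 \<or> N k \<le> i \<longrightarrow> \<nu> k i = 0)"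

definition block_norm :: "(nat \<Rightarrow> nat) \<Rightarrow> (nat \<Rightarrow> nat \<Rightarrow> real) \<Rightarrow> nat \<Rightarrow> real" where
  "block_norm N \<nu> k = L2_set (\<nu> k) {..<N k}"

definition bdd_seqs :: "(nat \<Rightarrow> nat) \<Rightarrow> (nat \<Rightarrow> nat \<Rightarrow> real) set" where
  "bdd_seqs N = {\<nu>. seq_support N \<nu> \<and> bdd_above (block_norm N \<nu> ` {1..})}"

definition seq_norm :: "(nat \<Rightarrow> nat) \<Rightarrow> (nat \<Rightarrow> nat \<Rightarrow> real) \<Rightarrow> real" where
  "seq_norm N \<nu> = (SUP k\<in>{1..}. block_norm N \<nu> k)"

definition seq_add :: "(nat \<Rightarrow> nat \<Rightarrow> real) \<Rightarrow> (nat \<Rightarrow> nat \<Rightarrow> real) \<Rightarrow> nat \<Rightarrow> nat \<Rightarrow> real" where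
  "seq_add \<theta> h = (\<lambda>k i. \<theta> k i + h k i)"

definition seq_scale :: "real \<Rightarrow> (nat \<Rightarrow> nat \<Rightarrow> real) \<Rightarrow> nat \<Rightarrow> nat \<Rightarrow> real" where
  "seq_scale a h = (\<lambda>k i. a * h k i)"

(* For bounded N, every point of the infinite dimensional torus has a bounded lift, so that the torus
   with its sup-norm structure is bdd_seqs N modulo torus_eq. Its points are represented by their
   lifts, and maps on it by maps on bdd_seqs N respecting torus_eq. *)

definition torus_eq :: "(nat \<Rightarrow> nat \<Rightarrow> real) \<Rightarrow> (nat \<Rightarrow> nat \<Rightarrow> real) \<Rightarrow> bool" where
  "torus_eq \<theta> \<phi> \<longleftrightarrow> (\<forall>k i. \<exists>z::int. \<theta> k i - \<phi> k i = 2 * pi * of_int z)"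

definition inf_torus_map :: "(nat \<Rightarrow> nat) \<Rightarrow> ((nat \<Rightarrow> nat \<Rightarrow> real) \<Rightarrow> 'b) \<Rightarrow> bool" where
  "inf_torus_map N F \<longleftrightarrow> (\<forall>\<theta>\<in>bdd_seqs N. \<forall>\<phi>\<in>bdd_seqs N. torus_eq \<theta> \<phi> \<longrightarrow> F \<theta> = F \<phi>)"

definition inf_torus_inj :: "(nat \<Rightarrow> nat) \<Rightarrow> ((nat \<Rightarrow> nat \<Rightarrow> real) \<Rightarrow> 'b) \<Rightarrow> bool" where
  "inf_torus_inj N F \<longleftrightarrow> (\<forall>\<theta>\<in>bdd_seqs N. \<forall>\<phi>\<in>bdd_seqs N. F \<theta> = F \<phi> \<longrightarrow> torus_eq \<theta> \<phi>)"

definition has_frechet_deriv ::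
    "(nat \<Rightarrow> nat) \<Rightarrow> nat \<Rightarrow> ((nat \<Rightarrow> nat \<Rightarrow> real) \<Rightarrow> real^'d \<Rightarrow> real^'d) \<Rightarrow>
     ((nat \<Rightarrow> nat \<Rightarrow> real) \<Rightarrow> real^'d \<Rightarrow> real^'d) \<Rightarrow> (nat \<Rightarrow> nat \<Rightarrow> real) \<Rightarrow> bool" where
  "has_frechet_deriv N s U L \<theta> \<longleftrightarrow>
     (\<forall>h\<in>bdd_seqs N. L h \<in> Cs_div s) \<and>
     (\<forall>g\<in>bdd_seqs N. \<forall>h\<in>bdd_seqs N. \<forall>x. L (seq_add g h) x = L g x + L h x) \<and>
     (\<forall>a. \<forall>h\<in>bdd_seqs N. \<forall>x. L (seq_scale a h) x = a *\<^sub>R L h x) \<and>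
     (\<forall>n\<le>s. \<exists>C. \<forall>h\<in>bdd_seqs N. seminorm_inf n (L h) \<le> C * seq_norm N h) \<and>
     (\<forall>n\<le>s. \<forall>e>0. \<exists>\<delta>>0. \<forall>h\<in>bdd_seqs N. seq_norm N h < \<delta> \<longrightarrow>
        seminorm_inf n (\<lambda>x. U (seq_add \<theta> h) x - U \<theta> x - L h x) \<le> e * seq_norm N h)"

(* U is a C^1 map from the infinite dimensional torus to Cs_div s with Frechet derivative D;
   continuity of D is with respect to the operator seminorms. *)

definition C1_with_deriv ::
    "(nat \<Rightarrow> nat) \<Rightarrow> nat \<Rightarrow> ((nat \<Rightarrow> nat \<Rightarrow> real) \<Rightarrow> real^'d \<Rightarrow> real^'d) \<Rightarrow>
     ((nat \<Rightarrow> nat \<Rightarrow> real) \<Rightarrow> (nat \<Rightarrow> nat \<Rightarrow> real) \<Rightarrow> real^'d \<Rightarrow> real^'d) \<Rightarrow> bool" where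
  "C1_with_deriv N s U D \<longleftrightarrow>
     inf_torus_map N U \<and>
     (\<forall>\<theta>\<in>bdd_seqs N. U \<theta> \<in> Cs_div s) \<and>
     (\<forall>\<theta>\<in>bdd_seqs N. has_frechet_deriv N s U (D \<theta>) \<theta>) \<and>
     (\<forall>\<theta>\<in>bdd_seqs N. \<forall>n\<le>s. \<forall>e>0. \<exists>\<delta>>0. \<forall>g\<in>bdd_seqs N. seq_norm N g < \<delta> \<longrightarrow>
        (\<forall>h\<in>bdd_seqs N.
           seminorm_inf n (\<lambda>x. D (seq_add \<theta> g) h x - D \<theta> h x) \<le> e * seq_norm N h))"

definition C1_embedding ::
    "(nat \<Rightarrow> nat) \<Rightarrow> nat \<Rightarrow> ((nat \<Rightarrow> nat \<Rightarrow> real) \<Rightarrow> real^'d \<Rightarrow> real^'d) \<Rightarrow> bool" where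
  "C1_embedding N s U \<longleftrightarrow> (\<exists>D. C1_with_deriv N s U D) \<and> inf_torus_inj N U"

definition C1b_map ::
    "(nat \<Rightarrow> nat) \<Rightarrow> nat \<Rightarrow> ((nat \<Rightarrow> nat \<Rightarrow> real) \<Rightarrow> real^'d \<Rightarrow> real^'d) \<Rightarrow> bool" where
  "C1b_map N s U \<longleftrightarrow> (\<exists>D. C1_with_deriv N s U D \<and>
     (\<forall>n\<le>s. \<exists>C>0. (\<forall>\<theta>\<in>bdd_seqs N. seminorm_inf n (U \<theta>) \<le> C) \<and>
        (\<forall>\<theta>\<in>bdd_seqs N. \<forall>h\<in>bdd_seqs N. seminorm_inf n (D \<theta> h) \<le> C * seq_norm N h)))"

definition C1b_embedding ::
    "(nat \<Rightarrow> nat) \<Rightarrow> nat \<Rightarrow> ((nat \<Rightarrow> nat \<Rightarrow> real) \<Rightarrow> real^'d \<Rightarrow> real^'d) \<Rightarrow> bool" where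
  "C1b_embedding N s U \<longleftrightarrow> C1b_map N s U \<and> inf_torus_inj N U"

definition non_symmetric ::
    "(nat \<Rightarrow> nat) \<Rightarrow> ((nat \<Rightarrow> nat \<Rightarrow> real) \<Rightarrow> real^'d \<Rightarrow> real^'d) \<Rightarrow> bool" where
  "non_symmetric N U \<longleftrightarrow>
     (\<forall>\<theta>\<in>bdd_seqs N. \<not> (\<exists>a. a \<noteq> 0 \<and> (\<forall>s x. U \<theta> (x + s *\<^sub>R a) = U \<theta> x)))"

definition non_resonant :: "real \<Rightarrow> (nat \<Rightarrow> nat) \<Rightarrow> (nat \<Rightarrow> nat \<Rightarrow> real) \<Rightarrow> bool" where
  "non_resonant \<eta> N \<nu> \<longleftrightarrow>
     (\<forall>l :: nat \<Rightarrow> nat \<Rightarrow> int.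
        let w = (\<lambda>k. real k powr \<eta> * block_norm N (\<lambda>k i. of_int (l k i)) k) in
        seq_support N l \<and> w summable_on {1..} \<and> 0 < (\<Sum>\<^sub>\<infinity>k\<in>{1..}. w k) \<longrightarrow>
        (\<Sum>\<^sub>\<infinity>k\<in>{1..}. \<Sum>i<N k. \<nu> k i * of_int (l k i)) \<noteq> 0)"

definition time_almost_periodic ::
    "real \<Rightarrow> (nat \<Rightarrow> nat) \<Rightarrow> nat \<Rightarrow> (real \<Rightarrow> real^'d \<Rightarrow> real^'d) \<Rightarrow> bool" where
  "time_almost_periodic \<eta> N s u \<longleftrightarrow>
     (\<exists>\<nu>\<in>bdd_seqs N. non_resonant \<eta> N \<nu> \<and>
        (\<exists>U. C1_embedding N s U \<and>
           (\<exists>\<theta>\<in>bdd_seqs N. \<forall>t. u t = U (seq_add \<theta> (seq_scale t \<nu>)))))"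

end

theory Submission
  imports Defs
begin

text \<open>
  Choose a coordinate \<open>y\<close> and disjoint strips accumulating at \<open>y = 0\<close>, the \<open>n\<close>-th one of width \<open>2^(-n)\<close>,
  one for each entry of the phase sequence. In the \<open>n\<close>-th strip put a shear flow in a direction
  orthogonal to \<open>y\<close> whose velocity equals the constant \<open>\<nu>\<^sub>n\<close> in the middle part of the strip, and add to
  it there a small compactly supported radial vortex, which is a stationary solution in the plane
  spanned by \<open>y\<close> and the shear direction. By Galilean invariance the vortex centred at \<open>\<theta>\<^sub>n\<close> is simply
  carried along with velocity \<open>\<nu>\<^sub>n\<close>, so that the sum over all strips, as a function of the positions
  \<open>\<theta>\<close> of the vortices, is the required embedding. The decay of \<open>\<nu>\<close> makes the shear part a
  \<open>C^S\<close> field; the vortices may be taken as small as one likes. The profiles are built from truncated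
  powers, which are smooth enough and give an explicit pressure. Letting the shear directions run
  through all directions other than \<open>y\<close> excludes invariance under translations.
\<close>

section \<open>Partial derivatives\<close>

text \<open>Disjointness of the strips removes every interaction between different vortices. The
  price is that the \<open>n\<close>-th profile is compressed by \<open>4 * 2 ^ n\<close>, which
  multiplies its \<open>C^S\<close> norm by the \<open>S\<close>-th power of this factor. The
  vortices pay with their amplitude; the shear flows cannot, because their speed is prescribed. This
  is the origin of \<open>\<epsilon>\<^sub>0\<close>: entry \<open>n\<close> lies in block
  \<open>n div M\<close>, so \<epsilon> < 2^(-M) turns the assumed rate into 2^(-(S+1)n) up to a
  constant, and the one factor 2^(-n) that the compression leaves over makes the series converge.
  Frechet differentiability costs derivatives: the quadratic Taylor remainder of a translated vortex
  takes two. Since the shear flows stand still, only the vortices are made smoother than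
  \<open>C^S\<close>.

  The Poisson equation for the pressure is not found by differentiating the convection, which for
  \<open>S = 1\<close> is only continuous. The phase derivative in direction \<nu> is divergence
  free, so the Euler equation tested against a gradient yields it in weak form.\<close>

lemma partial_deriv_eq:
  "(f has_derivative f') (at x) \<Longrightarrow> partial_deriv i f x = f' (axis i 1)"
  unfolding partial_deriv_def using frechet_derivative_at by metis

lemma has_derivative_partial_deriv:
  fixes f :: "real^'d \<Rightarrow> 'b::real_normed_vector"
  assumes "f differentiable (at x)"
  shows "(f has_derivative (\<lambda>v. \<Sum>i\<in>UNIV. v $ i *\<^sub>R partial_deriv i f x)) (at x)"
proof -
  define f' where "f' = frechet_derivative f (at x)"
  have d: "(f has_derivative f') (at x)"
    using assms frechet_derivative_works f'_def by blast
  have lin: "linear f'" using d has_derivative_linear by blast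
  have "f' v = (\<Sum>i\<in>UNIV. v $ i *\<^sub>R partial_deriv i f x)" for v
  proof -
    have "v = (\<Sum>i\<in>UNIV. v $ i *\<^sub>R axis i 1)"
      by (simp add: basis_expansion flip: scalar_mult_eq_scaleR)
    then have "f' v = f' (\<Sum>i\<in>UNIV. v $ i *\<^sub>R axis i 1)" by simp
    also have "\<dots> = (\<Sum>i\<in>UNIV. v $ i *\<^sub>R f' (axis i 1))"
      by (simp add: linear_sum[OF lin] linear_scale[OF lin])
    finally show ?thesis by (simp add: partial_deriv_def f'_def)
  qed
  then have "f' = (\<lambda>v. \<Sum>i\<in>UNIV. v $ i *\<^sub>R partial_deriv i f x)" by blast
  then show ?thesis using d by simp
qed

lemma differentiable_on_UNIV_iff: "f differentiable_on UNIV \<longleftrightarrow> (\<forall>x. f differentiable (at x))"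
  by (simp add: differentiable_on_def)

lemma has_vector_derivative_along_axis:
  fixes f :: "real^'d \<Rightarrow> 'b::real_normed_vector"
  assumes "f differentiable_on UNIV"
  shows "((\<lambda>s. f (x + s *\<^sub>R axis i 1)) has_vector_derivative partial_deriv i f (x + s *\<^sub>R axis i 1)) (at s)"
proof -
  have d: "(f has_derivative frechet_derivative f (at (x + s *\<^sub>R axis i 1))) (at (x + s *\<^sub>R axis i 1))"
    using assms frechet_derivative_works differentiable_on_UNIV_iff by blast
  have l: "((\<lambda>s. x + s *\<^sub>R axis i 1) has_derivative (\<lambda>h. h *\<^sub>R axis i 1)) (at s)"
    by (auto intro!: derivative_eq_intros)
  have "((\<lambda>s. f (x + s *\<^sub>R axis i 1)) has_derivative (\<lambda>h. frechet_derivative f (at (x + s *\<^sub>R axis i 1)) (h *\<^sub>R axis i 1))) (at s)"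
    using has_derivative_compose[OF l d] by simp
  moreover have "frechet_derivative f (at (x + s *\<^sub>R axis i 1)) (h *\<^sub>R axis i 1)
      = h *\<^sub>R partial_deriv i f (x + s *\<^sub>R axis i 1)" for h
    unfolding partial_deriv_def using d has_derivative_linear linear_scale by blast
  ultimately show ?thesis by (simp add: has_vector_derivative_def)
qed

lemma has_derivative_cong_eventually:
  assumes "\<forall>\<^sub>F y in nhds x. f y = g y"
  shows "(f has_derivative f') (at x) \<longleftrightarrow> (g has_derivative f') (at x)"
proof -
  have e: "\<forall>\<^sub>F y in at x. f y = g y" using assms eventually_nhds_conv_at by fast
  have e': "\<forall>\<^sub>F y in at x. g y = f y" using e by (simp add: eq_commute)
  have x: "f x = g x" using assms eventually_nhds_x_imp_x by blast
  show ?thesis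
    using has_derivative_transform_eventually[OF _ e x UNIV_I]
      has_derivative_transform_eventually[OF _ e' x[symmetric] UNIV_I] by blast
qed

text \<open>Holds at points of non-differentiability too: \<open>frechet_derivative\<close> chooses
  from the set of all derivatives at \<open>x\<close>, and functions that agree near
  \<open>x\<close> have the same set. Hence vanishing on an open set passes to partial derivatives
  unconditionally.\<close>

lemma partial_deriv_cong_eventually:
  assumes "\<forall>\<^sub>F y in nhds x. f y = g y"
  shows "partial_deriv i f x = partial_deriv i g x"
  unfolding partial_deriv_def frechet_derivative_def has_derivative_cong_eventually[OF assms] ..

lemma differentiable_cong_eventually:
  assumes "\<forall>\<^sub>F y in nhds x. f y = g y"
  shows "f differentiable (at x) \<longleftrightarrow> g differentiable (at x)"
  unfolding differentiable_def has_derivative_cong_eventually[OF assms] ..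

lemma has_derivative_affine:
  fixes f :: "real^'d \<Rightarrow> 'b::real_normed_vector"
  assumes "f differentiable (at (r *\<^sub>R x - c))"
  shows "((\<lambda>y. f (r *\<^sub>R y - c)) has_derivative (\<lambda>h. r *\<^sub>R frechet_derivative f (at (r *\<^sub>R x - c)) h)) (at x)"
proof -
  have d: "(f has_derivative frechet_derivative f (at (r *\<^sub>R x - c))) (at (r *\<^sub>R x - c))"
    using assms frechet_derivative_works by blast
  have l: "((\<lambda>y. r *\<^sub>R y - c) has_derivative (\<lambda>h. r *\<^sub>R h)) (at x)"
    by (auto intro!: derivative_eq_intros)
  have "((\<lambda>y. f (r *\<^sub>R y - c)) has_derivative (\<lambda>h. frechet_derivative f (at (r *\<^sub>R x - c)) (r *\<^sub>R h))) (at x)"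
    using has_derivative_compose[OF l d] by simp
  then show ?thesis
    by (simp add: linear_scale[OF has_derivative_linear[OF d]])
qed

lemma partial_deriv_affine:
  fixes f :: "real^'d \<Rightarrow> 'b::real_normed_vector"
  assumes "f differentiable_on UNIV"
  shows "partial_deriv i (\<lambda>y. f (r *\<^sub>R y - c)) = (\<lambda>x. r *\<^sub>R partial_deriv i f (r *\<^sub>R x - c))"
proof
  fix x
  have "f differentiable (at (r *\<^sub>R x - c))" using assms differentiable_on_UNIV_iff by blast
  from partial_deriv_eq[OF has_derivative_affine[OF this]]
  show "partial_deriv i (\<lambda>y. f (r *\<^sub>R y - c)) x = r *\<^sub>R partial_deriv i f (r *\<^sub>R x - c)"
    by (simp add: partial_deriv_def)
qed

lemma differentiable_on_affine:
  fixes f :: "real^'d \<Rightarrow> 'b::real_normed_vector"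
  assumes "f differentiable_on UNIV"
  shows "(\<lambda>y. f (r *\<^sub>R y - c)) differentiable_on UNIV"
  using has_derivative_affine assms unfolding differentiable_on_UNIV_iff differentiable_def by blast

text \<open>The derivatives of the translate at \<open>x\<close> and those of \<open>f\<close> at
  \<open>x - c\<close> form the same set, so the choice made by \<open>frechet_derivative\<close>
  agrees, differentiable or not.\<close>

lemma partial_deriv_shift:
  fixes f :: "real^'d \<Rightarrow> 'b::real_normed_vector"
  shows "partial_deriv i (\<lambda>y. f (y - c)) x = partial_deriv i f (x - c)"
proof -
  have sh: "((\<lambda>y. f (y - c)) has_derivative f') (at x) \<longleftrightarrow> (f has_derivative f') (at (x - c))" for f'
  proof
    assume "(f has_derivative f') (at (x - c))"
    moreover have "((\<lambda>y. y - c) has_derivative (\<lambda>h. h)) (at x)"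
      by (auto intro!: derivative_eq_intros)
    ultimately show "((\<lambda>y. f (y - c)) has_derivative f') (at x)"
      using has_derivative_compose by fastforce
  next
    assume a: "((\<lambda>y. f (y - c)) has_derivative f') (at x)"
    have "((\<lambda>y. f (y - c)) has_derivative f') (at ((x - c) + c))" using a by simp
    moreover have "((\<lambda>y. y + c) has_derivative (\<lambda>h. h)) (at (x - c))"
      by (auto intro!: derivative_eq_intros)
    ultimately show "(f has_derivative f') (at (x - c))"
      using has_derivative_compose[of "\<lambda>y. y + c" "\<lambda>h. h" "x - c" UNIV "\<lambda>y. f (y - c)" f'] by simp
  qed
  show ?thesis unfolding partial_deriv_def frechet_derivative_def sh ..
qed

lemma
  fixes f g :: "real^'d \<Rightarrow> 'b::real_normed_vector"
  assumes f: "f differentiable_on UNIV" and g: "g differentiable_on UNIV"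
  shows partial_deriv_add: "partial_deriv i (\<lambda>x. f x + g x) = (\<lambda>x. partial_deriv i f x + partial_deriv i g x)"
    and partial_deriv_diff: "partial_deriv i (\<lambda>x. f x - g x) = (\<lambda>x. partial_deriv i f x - partial_deriv i g x)"
proof -
  have d: "(f has_derivative frechet_derivative f (at x)) (at x)"
          "(g has_derivative frechet_derivative g (at x)) (at x)" for x
    using assms frechet_derivative_works differentiable_on_UNIV_iff by blast+
  show "partial_deriv i (\<lambda>x. f x + g x) = (\<lambda>x. partial_deriv i f x + partial_deriv i g x)"
    using partial_deriv_eq[OF has_derivative_add[OF d]] by (auto simp: partial_deriv_def)
  show "partial_deriv i (\<lambda>x. f x - g x) = (\<lambda>x. partial_deriv i f x - partial_deriv i g x)"
    using partial_deriv_eq[OF has_derivative_diff[OF d]] by (auto simp: partial_deriv_def)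
qed

lemma partial_deriv_bounded_linear:
  fixes f :: "real^'d \<Rightarrow> 'b::real_normed_vector"
  assumes f: "f differentiable_on UNIV" and T: "bounded_linear T"
  shows "partial_deriv i (\<lambda>x. T (f x)) = (\<lambda>x. T (partial_deriv i f x))"
proof
  fix x
  have d: "(f has_derivative frechet_derivative f (at x)) (at x)"
    using assms frechet_derivative_works differentiable_on_UNIV_iff by blast
  from partial_deriv_eq[OF bounded_linear.has_derivative[OF T d]]
  show "partial_deriv i (\<lambda>x. T (f x)) x = T (partial_deriv i f x)"
    by (simp add: partial_deriv_def)
qed

lemma partial_deriv_mult:
  fixes f g :: "real^'d \<Rightarrow> real"
  assumes f: "f differentiable_on UNIV" and g: "g differentiable_on UNIV"
  shows "partial_deriv i (\<lambda>x. f x * g x) = (\<lambda>x. f x * partial_deriv i g x + partial_deriv i f x * g x)"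
proof
  fix x
  have d: "(f has_derivative frechet_derivative f (at x)) (at x)"
          "(g has_derivative frechet_derivative g (at x)) (at x)"
    using assms frechet_derivative_works differentiable_on_UNIV_iff by blast+
  show "partial_deriv i (\<lambda>x. f x * g x) x = f x * partial_deriv i g x + partial_deriv i f x * g x"
    using partial_deriv_eq[OF has_derivative_mult[OF d]] by (simp add: partial_deriv_def)
qed

lemma partial_deriv_component:
  fixes f :: "real^'d \<Rightarrow> real^'e"
  assumes "f differentiable_on UNIV"
  shows "partial_deriv i (\<lambda>x. f x $ k) = (\<lambda>x. partial_deriv i f x $ k)"
  by (rule partial_deriv_bounded_linear[OF assms bounded_linear_vec_nth])

lemma partial_deriv_const [simp]: "partial_deriv i (\<lambda>x. c) = (\<lambda>x. 0)"
  by (simp add: partial_deriv_def fun_eq_iff)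

text \<open>The mean value theorem is applied in direction \<open>i\<close> to the increment in
  direction \<open>j\<close>, then in direction \<open>j\<close>. The second difference is symmetric
  in \<open>i\<close> and \<open>j\<close>; comparing the two orders as \<open>h\<close> tends to 0
  gives the symmetry of second derivatives.\<close>

lemma second_difference:
  fixes f :: "real^'d \<Rightarrow> real"
  assumes f: "f differentiable_on UNIV" and g: "partial_deriv i f differentiable_on UNIV" and h: "0 < h"
  obtains y where "norm (y - x) \<le> 2 * h"
    "f (x + h *\<^sub>R axis i 1 + h *\<^sub>R axis j 1) - f (x + h *\<^sub>R axis i 1) - f (x + h *\<^sub>R axis j 1) + f x
      = h\<^sup>2 * partial_deriv j (partial_deriv i f) y"
proof -
  let ?u = "axis i 1 :: real^'d" and ?v = "axis j 1 :: real^'d"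
  define G where "G s = f (x + h *\<^sub>R ?v + s *\<^sub>R ?u) - f (x + s *\<^sub>R ?u)" for s
  define G' where "G' s = partial_deriv i f (x + h *\<^sub>R ?v + s *\<^sub>R ?u) - partial_deriv i f (x + s *\<^sub>R ?u)" for s
  have dG: "(G has_real_derivative G' s) (at s)" for s
    unfolding has_real_derivative_iff_has_vector_derivative G_def G'_def
    by (intro has_vector_derivative_diff has_vector_derivative_along_axis f)
  from MVT2[OF h, of G G'] dG obtain s where s: "0 < s" "s < h" "G h - G 0 = h * G' s" by auto
  define H where "H t = partial_deriv i f (x + s *\<^sub>R ?u + t *\<^sub>R ?v)" for t
  have dH: "(H has_real_derivative partial_deriv j (partial_deriv i f) (x + s *\<^sub>R ?u + t *\<^sub>R ?v)) (at t)" for t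
    unfolding has_real_derivative_iff_has_vector_derivative H_def
    by (intro has_vector_derivative_along_axis g)
  from MVT2[OF h, of H "\<lambda>t. partial_deriv j (partial_deriv i f) (x + s *\<^sub>R ?u + t *\<^sub>R ?v)"] dH
  obtain t where t: "0 < t" "t < h"
    "H h - H 0 = h * partial_deriv j (partial_deriv i f) (x + s *\<^sub>R ?u + t *\<^sub>R ?v)" by auto
  have "G' s = H h - H 0" by (simp add: G'_def H_def algebra_simps)
  then have eq: "G h - G 0 = h\<^sup>2 * partial_deriv j (partial_deriv i f) (x + s *\<^sub>R ?u + t *\<^sub>R ?v)"
    using s(3) t(3) by (simp add: power2_eq_square)
  show ?thesis
  proof (rule that)
    have "norm (s *\<^sub>R ?u + t *\<^sub>R ?v) \<le> norm (s *\<^sub>R ?u) + norm (t *\<^sub>R ?v)" by (rule norm_triangle_ineq)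
    also have "\<dots> \<le> 2 * h" using s t by simp
    finally show "norm ((x + s *\<^sub>R ?u + t *\<^sub>R ?v) - x) \<le> 2 * h" by (simp add: algebra_simps)
    show "f (x + h *\<^sub>R ?u + h *\<^sub>R ?v) - f (x + h *\<^sub>R ?u) - f (x + h *\<^sub>R ?v) + f x
      = h\<^sup>2 * partial_deriv j (partial_deriv i f) (x + s *\<^sub>R ?u + t *\<^sub>R ?v)"
      using eq by (simp add: G_def algebra_simps)
  qed
qed

lemma partial_deriv_commute_real:
  fixes f :: "real^'d \<Rightarrow> real"
  assumes f: "f differentiable_on UNIV" and d: "\<And>i. partial_deriv i f differentiable_on UNIV"
    and c: "\<And>i j. continuous_on UNIV (partial_deriv j (partial_deriv i f))"
  shows "partial_deriv j (partial_deriv i f) x = partial_deriv i (partial_deriv j f) x"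
proof -
  define h where "h n = inverse (real (Suc n))" for n
  have h: "0 < h n" for n by (simp add: h_def)
  have "\<exists>y z. norm (y - x) \<le> 2 * h n \<and> norm (z - x) \<le> 2 * h n \<and>
      partial_deriv j (partial_deriv i f) y = partial_deriv i (partial_deriv j f) z" for n
  proof -
    obtain y where y: "norm (y - x) \<le> 2 * h n"
     "f (x + h n *\<^sub>R axis i 1 + h n *\<^sub>R axis j 1) - f (x + h n *\<^sub>R axis i 1) - f (x + h n *\<^sub>R axis j 1) + f x
      = (h n)\<^sup>2 * partial_deriv j (partial_deriv i f) y"
      using second_difference[OF f d h] by blast
    obtain z where z: "norm (z - x) \<le> 2 * h n"
     "f (x + h n *\<^sub>R axis j 1 + h n *\<^sub>R axis i 1) - f (x + h n *\<^sub>R axis j 1) - f (x + h n *\<^sub>R axis i 1) + f x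
      = (h n)\<^sup>2 * partial_deriv i (partial_deriv j f) z"
      using second_difference[OF f d h] by blast
    have "(h n)\<^sup>2 * partial_deriv j (partial_deriv i f) y = (h n)\<^sup>2 * partial_deriv i (partial_deriv j f) z"
      using y(2) z(2) by (simp add: algebra_simps)
    then show ?thesis using y(1) z(1) h[of n] by auto
  qed
  then obtain Y Z where YZ: "\<And>n. norm (Y n - x) \<le> 2 * h n" "\<And>n. norm (Z n - x) \<le> 2 * h n"
      "\<And>n. partial_deriv j (partial_deriv i f) (Y n) = partial_deriv i (partial_deriv j f) (Z n)"
    by metis
  have h0: "(\<lambda>n. 2 * h n) \<longlonglongrightarrow> 0"
    unfolding h_def using tendsto_mult_left[OF LIMSEQ_inverse_real_of_nat, of 2] by simp
  have lim: "W \<longlonglongrightarrow> x" if "\<And>n. norm (W n - x) \<le> 2 * h n" for W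
    by (rule LIM_zero_cancel, rule Lim_null_comparison[OF _ h0]) (simp add: that)
  have "(\<lambda>n. partial_deriv j (partial_deriv i f) (Y n)) \<longlonglongrightarrow> partial_deriv j (partial_deriv i f) x"
    by (rule continuous_on_tendsto_compose[OF c lim]) (simp_all add: YZ)
  moreover have "(\<lambda>n. partial_deriv i (partial_deriv j f) (Z n)) \<longlonglongrightarrow> partial_deriv i (partial_deriv j f) x"
    by (rule continuous_on_tendsto_compose[OF c lim]) (simp_all add: YZ)
  ultimately show ?thesis unfolding YZ(3) by (rule LIMSEQ_unique)
qed

lemma Ck_imp_continuous: "Ck n f \<Longrightarrow> continuous_on UNIV f"
  by (cases n) (auto intro: differentiable_imp_continuous_on)

lemma Ck_Suc_imp_Ck: "Ck (Suc n) f \<Longrightarrow> Ck n f"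
proof (induction n arbitrary: f)
  case 0 then show ?case using Ck_imp_continuous by fastforce
next
  case (Suc n)
  have "f differentiable_on UNIV" "Ck n (partial_deriv i f)" for i
    using Suc by (simp, metis Ck.simps(2))
  then show ?case by simp
qed

lemma Ck_mono: "Ck n f \<Longrightarrow> k \<le> n \<Longrightarrow> Ck k f"
  by (induction n) (use Ck_Suc_imp_Ck le_Suc_eq in blast)+

lemma Ck_bounded_linear:
  fixes f :: "real^'d \<Rightarrow> 'b::real_normed_vector"
  assumes T: "bounded_linear T"
  shows "Ck n f \<Longrightarrow> Ck n (\<lambda>x. T (f x))"
proof (induction n arbitrary: f)
  case 0 then show ?case using bounded_linear.continuous_on[OF T] by simp
next
  case (Suc n)
  then have f: "f differentiable_on UNIV" by simp
  have "(\<lambda>x. T (f x)) differentiable_on UNIV"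
    using f bounded_linear.has_derivative[OF T]
    unfolding differentiable_on_UNIV_iff differentiable_def by blast
  then show ?case using Suc by (simp add: partial_deriv_bounded_linear[OF f T])
qed

text \<open>Values in \<open>real^'e\<close> are treated by components, because the mean value
  equality behind the symmetry is one for real functions.\<close>

lemma partial_deriv_commute:
  fixes f :: "real^'d \<Rightarrow> real^'e"
  assumes f: "Ck (Suc (Suc n)) f"
  shows "partial_deriv j (partial_deriv i f) = partial_deriv i (partial_deriv j f)"
proof
  fix x
  have C2: "Ck 2 f" using Ck_mono[OF f] by simp
  have df: "f differentiable_on UNIV" and dd: "\<And>i. partial_deriv i f differentiable_on UNIV"
    using f by auto
  have "partial_deriv j (partial_deriv i f) x $ k = partial_deriv i (partial_deriv j f) x $ k" for k
  proof -
    have "Ck 2 (\<lambda>x. f x $ k)" by (rule Ck_bounded_linear[OF bounded_linear_vec_nth C2])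
    then have "partial_deriv j (partial_deriv i (\<lambda>x. f x $ k)) x = partial_deriv i (partial_deriv j (\<lambda>x. f x $ k)) x"
      by (intro partial_deriv_commute_real) (auto simp: numeral_2_eq_2)
    then show ?thesis by (simp add: partial_deriv_component df dd)
  qed
  then show "partial_deriv j (partial_deriv i f) x = partial_deriv i (partial_deriv j f) x"
    by (simp add: vec_eq_iff)
qed

section \<open>Fields with bounded derivatives\<close>

text \<open>One constant bounds all derivatives up to order \<open>n\<close> at once. Most estimates
  are made with this predicate and only at the end turned into seminorms: an explicit bound passes
  through sums, series, translations and dilations without any check that a supremum is
  finite.\<close>

primrec Ck_bounded :: "real \<Rightarrow> nat \<Rightarrow> (real^'d \<Rightarrow> 'b::real_normed_vector) \<Rightarrow> bool" where
  "Ck_bounded M 0 f \<longleftrightarrow> continuous_on UNIV f \<and> (\<forall>x. norm (f x) \<le> M)"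
| "Ck_bounded M (Suc n) f \<longleftrightarrow>
     f differentiable_on UNIV \<and> (\<forall>x. norm (f x) \<le> M) \<and> (\<forall>i. Ck_bounded M n (partial_deriv i f))"

lemma Ck_bounded_imp_Ck: "Ck_bounded M n f \<Longrightarrow> Ck n f"
  by (induction n arbitrary: f) auto

lemma Ck_bounded_norm: "Ck_bounded M n f \<Longrightarrow> norm (f x) \<le> M"
  by (cases n) auto

lemma Ck_bounded_nonneg: "Ck_bounded M n f \<Longrightarrow> 0 \<le> M"
  using Ck_bounded_norm norm_ge_zero order_trans by blast

lemma Ck_bounded_mono: "Ck_bounded M n f \<Longrightarrow> M \<le> M' \<Longrightarrow> Ck_bounded M' n f"
  by (induction n arbitrary: f) (auto intro: order_trans)

lemma Ck_bounded_Suc: "Ck_bounded M (Suc n) f \<Longrightarrow> Ck_bounded M n f"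
proof (induction n arbitrary: f)
  case 0 then show ?case using differentiable_imp_continuous_on by auto
next
  case (Suc n)
  have "f differentiable_on UNIV" "norm (f x) \<le> M" "Ck_bounded M n (partial_deriv i f)" for i x
    using Suc by (simp, simp, metis Ck_bounded.simps(2))
  then show ?case by simp
qed

lemma Ck_bounded_le: "Ck_bounded M n f \<Longrightarrow> k \<le> n \<Longrightarrow> Ck_bounded M k f"
  by (induction n) (use Ck_bounded_Suc le_Suc_eq in blast)+

lemma Ck_bounded_bounded_linear:
  fixes f :: "real^'d \<Rightarrow> 'b::real_normed_vector"
  assumes T: "bounded_linear T" and K: "\<And>y. norm (T y) \<le> K * norm y" "0 \<le> K"
  shows "Ck_bounded M n f \<Longrightarrow> Ck_bounded (K * M) n (\<lambda>x. T (f x))"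
proof (induction n arbitrary: f)
  case 0
  have "norm (T (f x)) \<le> K * M" for x
    using K(1)[of "f x"] mult_left_mono[OF _ K(2), of "norm (f x)" M] 0 by force
  then show ?case
    using bounded_linear.continuous_on[OF T] 0 by auto
next
  case (Suc n)
  then have f: "f differentiable_on UNIV" by simp
  have "(\<lambda>x. T (f x)) differentiable_on UNIV"
    using f bounded_linear.has_derivative[OF T]
    unfolding differentiable_on_UNIV_iff differentiable_def by blast
  moreover have "norm (T (f x)) \<le> K * M" for x
    using K(1)[of "f x"] mult_left_mono[OF _ K(2), of "norm (f x)" M] Suc.prems by force
  ultimately show ?case using Suc by (simp add: partial_deriv_bounded_linear[OF f T])
qed

lemma Ck_bounded_scaleR:
  "Ck_bounded M n f \<Longrightarrow> Ck_bounded (\<bar>a\<bar> * M) n (\<lambda>x. a *\<^sub>R f x)"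
  by (rule Ck_bounded_bounded_linear[OF bounded_linear_scaleR_right]) auto

lemma Ck_bounded_add:
  "Ck_bounded M n f \<Longrightarrow> Ck_bounded M' n g \<Longrightarrow> Ck_bounded (M + M') n (\<lambda>x. f x + g x)"
proof (induction n arbitrary: f g)
  case 0
  then show ?case by (auto intro!: continuous_on_add norm_triangle_le add_mono)
next
  case (Suc n)
  then show ?case
    by (auto simp: partial_deriv_add intro!: norm_triangle_le add_mono)
qed

text \<open>Each derivative brings a factor \<open>r\<close>, and as \<open>1 \<le> r\<close> the
  power \<open>r ^ n\<close> also serves the lower orders. This is the cost of squeezing a profile
  into a thin strip.\<close>

lemma Ck_bounded_affine:
  fixes f :: "real^'d \<Rightarrow> 'b::real_normed_vector"
  assumes r: "1 \<le> r"
  shows "Ck_bounded M n f \<Longrightarrow> Ck_bounded (r ^ n * M) n (\<lambda>x. f (r *\<^sub>R x - c))"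
proof (induction n arbitrary: f)
  case 0
  then show ?case by (auto intro!: continuous_intros continuous_on_compose2[of UNIV f])
next
  case (Suc n)
  then have f: "f differentiable_on UNIV" and b: "Ck_bounded M n (partial_deriv i f)" for i by simp_all
  have M: "0 \<le> M" using Suc.prems Ck_bounded_nonneg by blast
  have "norm (f (r *\<^sub>R x - c)) \<le> r ^ Suc n * M" for x
  proof -
    have "1 * M \<le> r ^ Suc n * M" using r M by (intro mult_right_mono one_le_power)
    then show ?thesis using Suc.prems Ck_bounded_norm order_trans by fastforce
  qed
  moreover have "Ck_bounded (r ^ Suc n * M) n (partial_deriv i (\<lambda>x. f (r *\<^sub>R x - c)))" for i
    using Ck_bounded_scaleR[OF Suc.IH[OF b], of r] r
    unfolding partial_deriv_affine[OF f] by (simp add: mult.assoc)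
  ultimately show ?case using differentiable_on_affine[OF f] by simp
qed

lemma Ck_bounded_shift:
  fixes f :: "real^'d \<Rightarrow> 'b::real_normed_vector"
  shows "Ck_bounded M n f \<Longrightarrow> Ck_bounded M n (\<lambda>x. f (x - c))"
  using Ck_bounded_affine[of 1 M n f c] by simp

section \<open>Series of fields and their termwise differentiation\<close>

lemma norm_suminf_le:
  fixes f :: "nat \<Rightarrow> 'b::banach"
  assumes "\<And>k. norm (f k) \<le> M k" "summable M"
  shows "summable f" "norm (\<Sum>k. f k) \<le> (\<Sum>k. M k)"
proof -
  have s: "summable (\<lambda>k. norm (f k))"
    by (rule summable_comparison_test'[OF assms(2), of 0]) (use assms(1) in simp)
  then show "summable f" by (rule summable_norm_cancel)
  show "norm (\<Sum>k. f k) \<le> (\<Sum>k. M k)"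
    by (rule order_trans[OF summable_norm[OF s] suminf_le[OF assms(1) s assms(2)]])
qed

text \<open>The tails of the majorant \<open>M\<close> bound the tails of the series of partial
  derivatives uniformly in \<open>x\<close>; the total derivative is then assembled from the partial
  ones.\<close>

lemma
  fixes f :: "nat \<Rightarrow> real^'d \<Rightarrow> 'b::banach"
  assumes f: "\<And>k. Ck_bounded (M k) (Suc n) (f k)" and M: "summable M"
  shows differentiable_on_series: "(\<lambda>x. \<Sum>k. f k x) differentiable_on UNIV"
    and partial_deriv_series: "partial_deriv i (\<lambda>x. \<Sum>k. f k x) = (\<lambda>x. \<Sum>k. partial_deriv i (f k) x)"
proof -
  define g where "g i x = (\<Sum>k. partial_deriv i (f k) x)" for i x
  have fb: "norm (f k x) \<le> M k" for k x using f Ck_bounded_norm by blast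
  have pb: "norm (partial_deriv i (f k) x) \<le> M k" for i k x
    using f Ck_bounded_norm by (metis Ck_bounded.simps(2))
  have sp: "summable (\<lambda>k. partial_deriv i (f k) x)" for i x
    by (rule norm_suminf_le(1)[OF pb M])
  have sf: "summable (\<lambda>k. f k x)" for x
    by (rule norm_suminf_le(1)[OF fb M])
  have tail: "norm ((\<Sum>k<N. partial_deriv i (f k) x) - g i x) \<le> (\<Sum>k. M (k + N))" for i N x
  proof -
    have s: "summable (\<lambda>k. norm (partial_deriv i (f (k + N)) x))"
      by (rule summable_comparison_test'[OF summable_ignore_initial_segment[OF M, of N], of 0]) (use pb in simp)
    have "g i x - (\<Sum>k<N. partial_deriv i (f k) x) = (\<Sum>k. partial_deriv i (f (k + N)) x)"
      unfolding g_def by (subst suminf_split_initial_segment[OF sp, of _ _ N]) simp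
    moreover have "norm \<dots> \<le> (\<Sum>k. norm (partial_deriv i (f (k + N)) x))"
      by (rule summable_norm[OF s])
    moreover have "\<dots> \<le> (\<Sum>k. M (k + N))"
      by (rule suminf_le[OF _ s summable_ignore_initial_segment[OF M]]) (rule pb)
    ultimately show ?thesis by (simp add: norm_minus_commute)
  qed
  have t0: "(\<lambda>N. (\<Sum>k. M (k + N))) \<longlonglongrightarrow> 0"
    using suminf_exist_split2[OF M] by simp
  define D where "D = real CARD('d)"
  have D: "0 < D" by (simp add: D_def)
  have "\<exists>G. \<forall>x\<in>UNIV. (\<lambda>k. f k x) sums (G x) \<and>
      (G has_derivative (\<lambda>v. \<Sum>i\<in>UNIV. v $ i *\<^sub>R g i x)) (at x within UNIV)"
  proof (rule has_derivative_series)
    show "(f k has_derivative (\<lambda>v. \<Sum>i\<in>UNIV. v $ i *\<^sub>R partial_deriv i (f k) x)) (at x within UNIV)" for k x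
      using f[of k] by (auto simp: differentiable_on_UNIV_iff intro: has_derivative_partial_deriv)
    show "(\<lambda>k. f k 0) sums (\<Sum>k. f k 0)" using sf by (rule summable_sums)
    show "\<forall>\<^sub>F N in sequentially. \<forall>x\<in>UNIV. \<forall>h. norm ((\<Sum>k<N. \<Sum>i\<in>UNIV. h $ i *\<^sub>R partial_deriv i (f k) x)
        - (\<Sum>i\<in>UNIV. h $ i *\<^sub>R g i x)) \<le> e * norm h" if e: "e > 0" for e
    proof -
      \<comment> \<open>The error in the total derivative is a sum of \<open>D\<close> errors in
        partial derivatives, one for each coordinate.\<close>
      have "\<forall>\<^sub>F N in sequentially. (\<Sum>k. M (k + N)) < e / D"
        by (rule order_tendstoD(2)[OF t0]) (use e D in simp)
      then show ?thesis
      proof (rule eventually_mono, intro ballI allI)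
        fix N x h assume N: "(\<Sum>k. M (k + N)) < e / D"
        have "(\<Sum>k<N. \<Sum>i\<in>UNIV. h $ i *\<^sub>R partial_deriv i (f k) x) - (\<Sum>i\<in>UNIV. h $ i *\<^sub>R g i x)
          = (\<Sum>i\<in>UNIV. h $ i *\<^sub>R ((\<Sum>k<N. partial_deriv i (f k) x) - g i x))"
          by (subst sum.swap) (simp add: scaleR_sum_right scaleR_diff_right sum_subtractf)
        also have "norm \<dots> \<le> (\<Sum>i\<in>(UNIV::'d set). norm h * (e / D))"
        proof (rule sum_norm_le)
          fix i :: 'd
          have "norm (h $ i *\<^sub>R ((\<Sum>k<N. partial_deriv i (f k) x) - g i x))
            = \<bar>h $ i\<bar> * norm ((\<Sum>k<N. partial_deriv i (f k) x) - g i x)" by simp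
          also have "\<dots> \<le> norm h * (e / D)"
            using tail[where i=i and N=N and x=x] N component_le_norm_cart[of h i] by (intro mult_mono) auto
          finally show "norm (h $ i *\<^sub>R ((\<Sum>k<N. partial_deriv i (f k) x) - g i x)) \<le> norm h * (e / D)" .
        qed
        also have "\<dots> = e * norm h" using D by (simp add: D_def)
        finally show "norm ((\<Sum>k<N. \<Sum>i\<in>UNIV. h $ i *\<^sub>R partial_deriv i (f k) x)
          - (\<Sum>i\<in>UNIV. h $ i *\<^sub>R g i x)) \<le> e * norm h" .
      qed
    qed
  qed simp_all
  then obtain G where G: "\<And>x. (\<lambda>k. f k x) sums (G x)"
      "\<And>x. (G has_derivative (\<lambda>v. \<Sum>i\<in>UNIV. v $ i *\<^sub>R g i x)) (at x)" by auto
  have "G = (\<lambda>x. \<Sum>k. f k x)" using G(1) sums_unique by blast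
  with G(2) have d: "((\<lambda>x. \<Sum>k. f k x) has_derivative (\<lambda>v. \<Sum>i\<in>UNIV. v $ i *\<^sub>R g i x)) (at x)" for x by simp
  then show "(\<lambda>x. \<Sum>k. f k x) differentiable_on UNIV"
    unfolding differentiable_on_UNIV_iff differentiable_def by blast
  show "partial_deriv i (\<lambda>x. \<Sum>k. f k x) = (\<lambda>x. \<Sum>k. partial_deriv i (f k) x)"
  proof
    fix x
    have "partial_deriv i (\<lambda>x. \<Sum>k. f k x) x = (\<Sum>j\<in>UNIV. axis i 1 $ j *\<^sub>R g j x)"
      by (rule partial_deriv_eq[OF d])
    also have "\<dots> = (\<Sum>j\<in>UNIV. if j = i then g j x else 0)"
      by (intro sum.cong) (auto simp: axis_def)
    also have "\<dots> = g i x" by simp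
    finally show "partial_deriv i (\<lambda>x. \<Sum>k. f k x) x = (\<Sum>k. partial_deriv i (f k) x)" by (simp add: g_def)
  qed
qed

lemma Ck_bounded_series:
  fixes f :: "nat \<Rightarrow> real^'d \<Rightarrow> 'b::banach"
  assumes "\<And>k. Ck_bounded (M k) n (f k)" and M: "summable M"
  shows "Ck_bounded (\<Sum>k. M k) n (\<lambda>x. \<Sum>k. f k x)"
  using assms(1)
proof (induction n arbitrary: f)
  case 0
  have "uniform_limit UNIV (\<lambda>N x. \<Sum>k<N. f k x) (\<lambda>x. \<Sum>k. f k x) sequentially"
    by (rule Weierstrass_m_test[OF _ M]) (use 0 in auto)
  then have "continuous_on UNIV (\<lambda>x. \<Sum>k. f k x)"
    by (rule uniform_limit_theorem[rotated]) (use 0 in \<open>auto intro!: always_eventually continuous_on_sum\<close>)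
  moreover have "norm (\<Sum>k. f k x) \<le> (\<Sum>k. M k)" for x
    by (rule norm_suminf_le(2)[OF _ M]) (use 0 in simp)
  ultimately show ?case by simp
next
  case (Suc n)
  have "Ck_bounded (\<Sum>k. M k) n (partial_deriv i (\<lambda>x. \<Sum>k. f k x))" for i
    unfolding partial_deriv_series[OF Suc.prems M] by (rule Suc.IH) (use Suc.prems in simp)
  moreover have "norm (\<Sum>k. f k x) \<le> (\<Sum>k. M k)" for x
    by (rule norm_suminf_le(2)[OF _ M]) (use Suc.prems Ck_bounded_norm in blast)
  ultimately show ?case using differentiable_on_series[OF Suc.prems M] by simp
qed

section \<open>Differences and Taylor remainders along a coordinate axis\<close>

lemma norm_difference_le:
  fixes f :: "real^'d \<Rightarrow> 'b::real_normed_vector"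
  assumes f: "Ck_bounded M (Suc 0) f"
  shows "norm (f (x - h *\<^sub>R axis j 1) - f x) \<le> M * \<bar>h\<bar>"
proof -
  have df: "f differentiable_on UNIV" and b: "norm (partial_deriv j f y) \<le> M" for y
    using f by auto
  let ?g = "\<lambda>s. f (x + s *\<^sub>R axis j 1)"
  have "norm (?g (- h) - ?g 0) \<le> M * norm (- h - 0)"
  proof (rule differentiable_bound[OF convex_UNIV])
    show "(?g has_derivative (\<lambda>v. v *\<^sub>R partial_deriv j f (x + s *\<^sub>R axis j 1))) (at s within UNIV)" for s
      using has_vector_derivative_along_axis[OF df, of x j s] by (simp add: has_vector_derivative_def)
    show "onorm (\<lambda>v. v *\<^sub>R partial_deriv j f (x + s *\<^sub>R axis j 1)) \<le> M" for s :: real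
      by (rule onorm_le) (simp add: b mult.commute[of M] mult_left_mono)
  qed auto
  then show ?thesis by simp
qed

lemma Ck_bounded_difference:
  fixes f :: "real^'d \<Rightarrow> 'b::real_normed_vector"
  assumes "Ck_bounded M (Suc n) f"
  shows "Ck_bounded (M * \<bar>h\<bar>) n (\<lambda>x. f (x - h *\<^sub>R axis j 1) - f x)"
  using assms
proof (induction n arbitrary: f)
  case 0
  then have "continuous_on UNIV f" using differentiable_imp_continuous_on by auto
  then have "continuous_on UNIV (\<lambda>x. f (x - h *\<^sub>R axis j 1))"
    by (rule continuous_on_compose2) (auto intro!: continuous_intros)
  then show ?case using norm_difference_le[OF 0] \<open>continuous_on UNIV f\<close> by (auto intro: continuous_on_diff)
next
  case (Suc n)
  then have df: "f differentiable_on UNIV" by simp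
  have d1: "(\<lambda>x. f (x - h *\<^sub>R axis j 1)) differentiable_on UNIV"
    using differentiable_on_affine[OF df, of 1] by simp
  have "Ck_bounded M (Suc 0) f" using Suc.prems Ck_bounded_le by (metis Suc_le_mono zero_le)
  moreover have "Ck_bounded (M * \<bar>h\<bar>) n (partial_deriv i (\<lambda>x. f (x - h *\<^sub>R axis j 1) - f x))" for i
    unfolding partial_deriv_diff[OF d1 df] partial_deriv_shift
    by (rule Suc.IH) (use Suc.prems in auto)
  ultimately show ?case using norm_difference_le[of M f] d1 df by simp
qed

text \<open>Along the segment the derivative deviates from its value at the starting point by at
  most \<open>M * \<bar>h\<bar>\<close>, which gives a quadratic remainder; the sharp factor 1/2 is
  given away.\<close>

lemma norm_taylor_le:
  fixes f :: "real^'d \<Rightarrow> 'b::real_normed_vector"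
  assumes f: "Ck_bounded M (Suc (Suc 0)) f"
  shows "norm (f (x - h *\<^sub>R axis j 1) - f x + h *\<^sub>R partial_deriv j f x) \<le> M * h\<^sup>2"
proof -
  have df: "f differentiable_on UNIV" and df2: "Ck_bounded M (Suc 0) (partial_deriv j f)"
    using f by auto
  have M: "0 \<le> M" using Ck_bounded_nonneg f by blast
  have "norm (f (x + (- h) *\<^sub>R axis j 1) - f (x + 0 *\<^sub>R axis j 1) - (- h - 0) *\<^sub>R partial_deriv j f (x + 0 *\<^sub>R axis j 1))
      \<le> norm (- h - 0) * (M * \<bar>h\<bar>)"
  proof (rule vector_differentiable_bound_linearization[where f="\<lambda>s. f (x + s *\<^sub>R axis j 1)" and S="closed_segment 0 (-h)"
        and f'="\<lambda>s. partial_deriv j f (x + s *\<^sub>R axis j 1)"])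
    show "((\<lambda>s. f (x + s *\<^sub>R axis j 1)) has_vector_derivative partial_deriv j f (x + s *\<^sub>R axis j 1))
      (at s within closed_segment 0 (-h))" for s
      using has_vector_derivative_along_axis[OF df] has_vector_derivative_at_within by blast
    show "norm (partial_deriv j f (x + s *\<^sub>R axis j 1) - partial_deriv j f (x + 0 *\<^sub>R axis j 1)) \<le> M * \<bar>h\<bar>"
      if "s \<in> closed_segment 0 (-h)" for s
    proof -
      have "\<bar>s\<bar> \<le> \<bar>h\<bar>" using that by (auto simp: closed_segment_eq_real_ivl split: if_splits)
      then have "M * \<bar>s\<bar> \<le> M * \<bar>h\<bar>" using M mult_left_mono by blast
      then show ?thesis using norm_difference_le[OF df2, of x "-s" j] by simp
    qed
  qed auto
  then show ?thesis by (simp add: power2_eq_square mult_ac)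
qed

text \<open>Partial derivatives commute with the translation and with
  \<open>partial_deriv j\<close>, so the derivative of the remainder is the remainder of the
  derivative, and induction applies. The two orders lost here are the reason for giving the vortices
  two derivatives more than \<open>S\<close>.\<close>

lemma Ck_bounded_taylor:
  fixes f :: "real^'d \<Rightarrow> real^'e"
  assumes "Ck_bounded M (Suc (Suc n)) f"
  shows "Ck_bounded (M * h\<^sup>2) n (\<lambda>x. f (x - h *\<^sub>R axis j 1) - f x + h *\<^sub>R partial_deriv j f x)"
  using assms
proof (induction n arbitrary: f)
  case 0
  have df: "f differentiable_on UNIV" and d: "partial_deriv j f differentiable_on UNIV" using 0 by auto
  have "continuous_on UNIV f" "continuous_on UNIV (partial_deriv j f)"
    using df d differentiable_imp_continuous_on by blast+
  moreover have "continuous_on UNIV (\<lambda>x. f (x - h *\<^sub>R axis j 1))"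
    using differentiable_on_affine[OF df, of 1] by (simp add: differentiable_imp_continuous_on)
  ultimately show ?case
    using norm_taylor_le[OF 0] by (auto intro!: continuous_intros)
next
  case (Suc n)
  have df: "f differentiable_on UNIV" and d: "partial_deriv j f differentiable_on UNIV" using Suc.prems by auto
  have d1: "(\<lambda>x. f (x - h *\<^sub>R axis j 1)) differentiable_on UNIV"
    using differentiable_on_affine[OF df, of 1] by simp
  have dh: "(\<lambda>x. h *\<^sub>R partial_deriv j f x) differentiable_on UNIV" using d by auto
  have d3: "(\<lambda>x. f (x - h *\<^sub>R axis j 1) - f x) differentiable_on UNIV"
    using d1 df by auto
  have comm: "partial_deriv i (partial_deriv j f) = partial_deriv j (partial_deriv i f)" for i
    by (rule partial_deriv_commute[OF Ck_bounded_imp_Ck[OF Suc.prems]])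
  have "partial_deriv i (\<lambda>x. f (x - h *\<^sub>R axis j 1) - f x + h *\<^sub>R partial_deriv j f x)
    = (\<lambda>x. partial_deriv i f (x - h *\<^sub>R axis j 1) - partial_deriv i f x + h *\<^sub>R partial_deriv j (partial_deriv i f) x)" for i
    unfolding partial_deriv_add[OF d3 dh] partial_deriv_diff[OF d1 df] partial_deriv_shift
      partial_deriv_bounded_linear[OF d bounded_linear_scaleR_right] comm ..
  then have "Ck_bounded (M * h\<^sup>2) n (partial_deriv i (\<lambda>x. f (x - h *\<^sub>R axis j 1) - f x + h *\<^sub>R partial_deriv j f x))" for i
    using Suc.IH Suc.prems by simp
  moreover have "norm (f (x - h *\<^sub>R axis j 1) - f x + h *\<^sub>R partial_deriv j f x) \<le> M * h\<^sup>2" for x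
    by (rule norm_taylor_le[OF Ck_bounded_le[OF Suc.prems]]) simp
  ultimately show ?case using d3 dh by auto
qed

section \<open>From iterated partial derivatives to the seminorms\<close>

lemma fold_partial_deriv_bounded:
  "Ck_bounded M n f \<Longrightarrow> length L \<le> n \<Longrightarrow> norm (fold partial_deriv L f x) \<le> M"
proof (induction L arbitrary: n f)
  case Nil then show ?case by (simp add: Ck_bounded_norm)
next
  case (Cons i L)
  then obtain n' where n: "n = Suc n'" by (cases n) auto
  show ?case using Cons.IH[of n' "partial_deriv i f"] Cons.prems n by simp
qed

text \<open>A multi-index derivative becomes a word of single derivatives. The bounds hold for all
  words of the given length, so the unspecified order of coordinates in \<open>multi_deriv\<close>
  does no harm.\<close>

lemma multi_deriv_eq_fold:
  fixes f :: "real^'d \<Rightarrow> 'b::real_normed_vector"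
  obtains L where "length L = (\<Sum>i\<in>UNIV. \<alpha> i)" "multi_deriv \<alpha> f = fold partial_deriv L f"
proof -
  have *: "\<exists>L. length L = sum_list (map \<alpha> is) \<and> foldr (\<lambda>i. partial_deriv i ^^ \<alpha> i) is f = fold partial_deriv L f"
    for "is" :: "'d list"
  proof (induction "is")
    case Nil then show ?case by (intro exI[of _ "[]"]) simp
  next
    case (Cons i "is")
    then obtain L where L: "length L = sum_list (map \<alpha> is)"
      "foldr (\<lambda>i. partial_deriv i ^^ \<alpha> i) is f = fold partial_deriv L f" by blast
    have "(partial_deriv i ^^ n) g = fold partial_deriv (replicate n i) g" for n and g :: "real^'d \<Rightarrow> 'b"
      by (induction n arbitrary: g) (simp_all add: funpow_swap1)
    then have "foldr (\<lambda>i. partial_deriv i ^^ \<alpha> i) (i # is) f = fold partial_deriv (L @ replicate (\<alpha> i) i) f"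
      using L by simp
    then show ?case using L(1) by (intro exI[of _ "L @ replicate (\<alpha> i) i"]) simp
  qed
  define js where "js = (SOME is :: 'd list. distinct is \<and> set is = UNIV)"
  have "distinct js \<and> set js = UNIV"
    unfolding js_def by (rule someI_ex) (use finite_distinct_list[of "UNIV :: 'd set"] in auto)
  then have "sum_list (map \<alpha> js) = (\<Sum>i\<in>UNIV. \<alpha> i)"
    using sum_list_distinct_conv_sum_set by metis
  then show ?thesis using *[of js] that unfolding multi_deriv_def js_def by metis
qed

lemma seminorm_inf_le:
  fixes f :: "real^'d \<Rightarrow> 'b::real_normed_vector"
  assumes f: "Ck_bounded M s f" and n: "n \<le> s"
  shows "seminorm_inf n f \<le> M"
  unfolding seminorm_inf_def
proof (rule cSUP_least)
  fix x :: "real^'d"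
  let ?A = "{\<alpha> :: 'd \<Rightarrow> nat. (\<Sum>i\<in>UNIV. \<alpha> i) = n}"
  have "?A \<subseteq> UNIV \<rightarrow>\<^sub>E {..n}"
  proof
    fix \<alpha> assume "\<alpha> \<in> ?A"
    moreover have "\<alpha> i \<le> (\<Sum>i\<in>UNIV. \<alpha> i)" for i by (rule member_le_sum) auto
    ultimately show "\<alpha> \<in> UNIV \<rightarrow>\<^sub>E {..n}" by auto
  qed
  then have fin: "finite ?A" by (rule finite_subset) (auto intro: finite_PiE)
  \<comment> \<open>\<open>Max\<close> needs a nonempty index set; the witness puts the whole order
    \<open>n\<close> on one arbitrary coordinate.\<close>
  have "(\<lambda>j. if j = undefined then n else 0) \<in> ?A" by simp
  then have ne: "?A \<noteq> {}" by blast
  show "(MAX \<alpha>\<in>?A. norm (multi_deriv \<alpha> f x)) \<le> M"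
  proof (subst Max_le_iff)
    show "\<forall>a\<in>(\<lambda>\<alpha>. norm (multi_deriv \<alpha> f x)) ` ?A. a \<le> M"
      using fold_partial_deriv_bounded[OF f] n by (auto intro: multi_deriv_eq_fold)
         (metis (no_types, lifting) multi_deriv_eq_fold)
  qed (use fin ne in auto)
qed simp

section \<open>Truncated powers and periodization\<close>

lemma Ck_const [simp]: "Ck n (\<lambda>x. c)"
proof (induction n arbitrary: c)
  case (Suc n)
  then show ?case by (simp add: partial_deriv_def)
qed simp

lemma Ck_add: "Ck n f \<Longrightarrow> Ck n g \<Longrightarrow> Ck n (\<lambda>x. f x + g x)"
  by (induction n arbitrary: f g) (auto simp: partial_deriv_add intro: continuous_on_add)

lemma Ck_diff: "Ck n f \<Longrightarrow> Ck n g \<Longrightarrow> Ck n (\<lambda>x. f x - g x)"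
  by (induction n arbitrary: f g) (auto simp: partial_deriv_diff intro: continuous_on_diff)

lemma Ck_mult:
  fixes f g :: "real^'d \<Rightarrow> real"
  shows "Ck n f \<Longrightarrow> Ck n g \<Longrightarrow> Ck n (\<lambda>x. f x * g x)"
proof (induction n arbitrary: f g)
  case 0 then show ?case by (auto intro: continuous_on_mult)
next
  case (Suc n)
  then have "Ck n f" "Ck n g" "f differentiable_on UNIV" "g differentiable_on UNIV"
    using Ck_Suc_imp_Ck by auto
  then show ?case using Suc by (auto simp: partial_deriv_mult intro!: Ck_add Suc.IH)
qed

lemma Ck_component [simp]: "Ck n (\<lambda>x :: real^'d. x $ i)"
proof (cases n)
  case (Suc n')
  have d: "((\<lambda>x :: real^'d. x $ i) has_derivative (\<lambda>h. h $ i)) (at x)" for x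
    by (rule bounded_linear_imp_has_derivative[OF bounded_linear_vec_nth])
  then have "partial_deriv j (\<lambda>x :: real^'d. x $ i) = (\<lambda>x. axis j 1 $ i)" for j
    using partial_deriv_eq by blast
  then show ?thesis
    using d Suc by (auto simp: differentiable_on_UNIV_iff differentiable_def)
qed (auto intro: continuous_on_component)

lemma Ck_scaleR_const:
  "Ck n f \<Longrightarrow> Ck n (\<lambda>x. f x *\<^sub>R (c :: 'b::real_normed_vector))"
  by (rule Ck_bounded_linear[OF bounded_linear_scaleR_left])

lemma Ck_cmult: "Ck n f \<Longrightarrow> Ck n (\<lambda>x. c * f x :: real)"
  by (rule Ck_bounded_linear[OF bounded_linear_mult_right])

text \<open>At the corner \<open>t = 0\<close> the difference quotient is at most
  \<open>\<bar>h\<bar> ^ Suc q\<close>, which tends to 0 because the exponent of the power is at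
  least 2.\<close>

lemma pospower_has_real_derivative:
  "((\<lambda>t. max 0 t ^ Suc (Suc q)) has_real_derivative real (Suc (Suc q)) * max 0 t ^ Suc q) (at t)"
proof -
  consider "t < 0" | "t = 0" | "0 < t" by linarith
  then show ?thesis
  proof cases
    case 1
    have "\<forall>\<^sub>F s in nhds t. max 0 s ^ Suc (Suc q) = 0"
      by (rule eventually_nhds_in_open[of "{..<0}", THEN eventually_mono]) (use 1 in auto)
    then have "((\<lambda>s. max 0 s ^ Suc (Suc q)) has_real_derivative 0) (at t)"
      by (subst DERIV_cong_ev[OF refl _ refl, where g="\<lambda>_. 0"]) auto
    then show ?thesis using 1 by simp
  next
    case 3
    have "\<forall>\<^sub>F s in nhds t. max 0 s ^ Suc (Suc q) = s ^ Suc (Suc q)"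
      by (rule eventually_nhds_in_open[of "{0<..}", THEN eventually_mono]) (use 3 in auto)
    moreover have "((\<lambda>s. s ^ Suc (Suc q)) has_real_derivative real (Suc (Suc q)) * t ^ Suc q) (at t)"
      using DERIV_pow[of "Suc (Suc q)" t UNIV] by simp
    ultimately have "((\<lambda>s. max 0 s ^ Suc (Suc q)) has_real_derivative real (Suc (Suc q)) * t ^ Suc q) (at t)"
      by (subst DERIV_cong_ev[OF refl _ refl, where g="\<lambda>s. s ^ Suc (Suc q)"]) auto
    then show ?thesis using 3 by simp
  next
    case 2
    have "((\<lambda>h. (max 0 (t + h) ^ Suc (Suc q) - max 0 t ^ Suc (Suc q)) / h) \<longlongrightarrow> 0) (at 0)"
    proof (rule Lim_null_comparison)
      show "((\<lambda>h::real. \<bar>h\<bar> ^ Suc q) \<longlongrightarrow> 0) (at 0)"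
      proof -
        have "((\<lambda>h::real. \<bar>h\<bar> ^ Suc q) \<longlongrightarrow> \<bar>0::real\<bar> ^ Suc q) (at 0)" by (intro tendsto_intros)
        then show ?thesis by simp
      qed
      show "\<forall>\<^sub>F h in at 0. norm ((max 0 (t + h) ^ Suc (Suc q) - max 0 t ^ Suc (Suc q)) / h) \<le> \<bar>h\<bar> ^ Suc q"
      proof (rule always_eventually, rule allI)
        fix h :: real
        have "max 0 h ^ Suc (Suc q) \<le> \<bar>h\<bar> ^ Suc (Suc q)" by (rule power_mono) auto
        then show "norm ((max 0 (t + h) ^ Suc (Suc q) - max 0 t ^ Suc (Suc q)) / h) \<le> \<bar>h\<bar> ^ Suc q"
          using 2 by (cases "h = 0") (auto simp: field_simps)
      qed
    qed
    then show ?thesis using 2 by (simp add: DERIV_def)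
  qed
qed

lemma partial_deriv_pospower:
  fixes f :: "real^'d \<Rightarrow> real"
  assumes f: "f differentiable_on UNIV"
  shows "(\<lambda>x. max 0 (f x) ^ Suc (Suc q)) differentiable_on UNIV"
    and "partial_deriv i (\<lambda>x. max 0 (f x) ^ Suc (Suc q)) =
      (\<lambda>x. real (Suc (Suc q)) * max 0 (f x) ^ Suc q * partial_deriv i f x)"
proof -
  have "((\<lambda>x. max 0 (f x) ^ Suc (Suc q)) has_derivative
     (\<lambda>h. real (Suc (Suc q)) * max 0 (f x) ^ Suc q * frechet_derivative f (at x) h)) (at x)" for x
  proof -
    have d: "(f has_derivative frechet_derivative f (at x)) (at x)"
      using f frechet_derivative_works differentiable_on_UNIV_iff by blast
    show ?thesis
      by (rule has_derivative_compose[OF d pospower_has_real_derivative[unfolded has_field_derivative_def]])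
  qed note d = this
  show "(\<lambda>x. max 0 (f x) ^ Suc (Suc q)) differentiable_on UNIV"
    unfolding differentiable_on_UNIV_iff differentiable_def using d by blast
  show "partial_deriv i (\<lambda>x. max 0 (f x) ^ Suc (Suc q)) =
      (\<lambda>x. real (Suc (Suc q)) * max 0 (f x) ^ Suc q * partial_deriv i f x)"
    using partial_deriv_eq[OF d] unfolding partial_deriv_def by blast
qed

text \<open>Each differentiation lowers the exponent by one, and \<open>n < q\<close> leaves a
  positive exponent, hence a continuous function, after \<open>n\<close> of them.\<close>

lemma Ck_pospower:
  fixes f :: "real^'d \<Rightarrow> real"
  shows "Ck n f \<Longrightarrow> n < q \<Longrightarrow> Ck n (\<lambda>x. max 0 (f x) ^ q)"
proof (induction n arbitrary: q)
  case 0 then show ?case by (auto intro!: continuous_intros)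
next
  case (Suc n)
  define p where "p = q - 2"
  have q: "q = Suc (Suc p)" "n < Suc p" using Suc.prems(2) by (auto simp: p_def)
  have df: "f differentiable_on UNIV" and "Ck n (partial_deriv i f)" for i using Suc.prems by auto
  moreover have "Ck n (\<lambda>x. max 0 (f x) ^ Suc p)"
    by (rule Suc.IH[OF Ck_Suc_imp_Ck[OF Suc.prems(1)] q(2)])
  ultimately show ?case
    unfolding q Ck.simps partial_deriv_pospower(2)[OF df]
    using partial_deriv_pospower(1)[OF df] by (intro conjI allI Ck_mult Ck_cmult)
qed

lemma partial_deriv_vanish:
  fixes f :: "real^'d \<Rightarrow> 'b::real_normed_vector"
  assumes "open S" "\<And>y. y \<in> S \<Longrightarrow> f y = 0" "x \<in> S"
  shows "partial_deriv i f x = 0"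
proof -
  have "\<forall>\<^sub>F y in nhds x. f y = 0"
    using assms by (auto intro: eventually_mono[OF eventually_nhds_in_open])
  from partial_deriv_cong_eventually[OF this] show ?thesis by simp
qed

definition depends_on :: "'d set \<Rightarrow> (real^'d \<Rightarrow> 'b) \<Rightarrow> bool" where
  "depends_on K f \<longleftrightarrow> (\<forall>x y. (\<forall>k\<in>K. x $ k = y $ k) \<longrightarrow> f x = f y)"

text \<open>The bound \<open>2\<close> is well below \<open>pi\<close>, so the translates of such a
  function by multiples of \<open>2 * pi\<close> in a direction of \<open>K\<close> have disjoint
  supports.\<close>

definition slab_supported :: "'d set \<Rightarrow> (real^'d \<Rightarrow> 'b::zero) \<Rightarrow> bool" where
  "slab_supported K f \<longleftrightarrow> (\<forall>x. \<forall>k\<in>K. 2 < \<bar>x $ k\<bar> \<longrightarrow> f x = 0)"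

lemma depends_on_partial_deriv:
  fixes f :: "real^'d \<Rightarrow> 'b::real_normed_vector"
  assumes "depends_on K f"
  shows "depends_on K (partial_deriv i f)"
  unfolding depends_on_def
proof (intro allI impI)
  fix x y :: "real^'d" assume xy: "\<forall>k\<in>K. x $ k = y $ k"
  have "(\<lambda>z. f (z - (y - x))) = f"
    using assms xy unfolding depends_on_def by (intro ext) force
  then show "partial_deriv i f x = partial_deriv i f y"
    using partial_deriv_shift[of i f "y - x" y] by simp
qed

lemma slab_supported_partial_deriv:
  fixes f :: "real^'d \<Rightarrow> 'b::real_normed_vector"
  assumes "slab_supported K f"
  shows "slab_supported K (partial_deriv i f)"
  unfolding slab_supported_def
proof (intro allI ballI impI)
  fix x :: "real^'d" and k assume k: "k \<in> K" "2 < \<bar>x $ k\<bar>"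
  show "partial_deriv i f x = 0"
  proof (rule partial_deriv_vanish)
    show "open {y :: real^'d. 2 < \<bar>y $ k\<bar>}"
      by (intro open_Collect_less continuous_intros)
    show "f y = 0" if "y \<in> {y. 2 < \<bar>y $ k\<bar>}" for y
      using assms k that unfolding slab_supported_def by blast
  qed (use k in simp)
qed

text \<open>Setting the coordinates outside \<open>K\<close> to 0 does not change the value and
  moves every point of the support into a fixed compact cube.\<close>

lemma depends_on_slab_supported_bounded:
  fixes f :: "real^'d \<Rightarrow> 'b::real_normed_vector"
  assumes c: "continuous_on UNIV f" and d: "depends_on K f" and s: "slab_supported K f"
  shows "\<exists>M. \<forall>x. norm (f x) \<le> M"
proof -
  let ?Q = "cbox (\<chi> i. -2) (\<chi> i. 2) :: (real^'d) set"
  have "compact (f ` ?Q)"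
    by (intro compact_continuous_image continuous_on_subset[OF c]) auto
  then obtain M where M: "\<And>y. y \<in> ?Q \<Longrightarrow> norm (f y) \<le> M"
    using compact_imp_bounded bounded_iff by (metis imageI)
  have "norm (f x) \<le> max 0 M" for x
  proof (cases "\<exists>k\<in>K. 2 < \<bar>x $ k\<bar>")
    case True
    then have "f x = 0" using s slab_supported_def by blast
    then show ?thesis by simp
  next
    case False
    let ?y = "\<chi> i. if i \<in> K then x $ i else 0"
    have "?y \<in> ?Q" using False by (auto simp: mem_box_cart abs_le_iff not_less)
    moreover have "f x = f ?y" using d by (simp add: depends_on_def)
    ultimately show ?thesis using M by fastforce
  qed
  then show ?thesis by blast
qed

lemma Ck_bounded_exists:
  fixes f :: "real^'d \<Rightarrow> 'b::real_normed_vector"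
  shows "Ck n f \<Longrightarrow> depends_on K f \<Longrightarrow> slab_supported K f \<Longrightarrow> \<exists>M. Ck_bounded M n f"
proof (induction n arbitrary: f)
  case 0
  then show ?case using depends_on_slab_supported_bounded by auto
next
  case (Suc n)
  obtain M0 where M0: "\<And>x. norm (f x) \<le> M0"
    using depends_on_slab_supported_bounded[OF Ck_imp_continuous[OF Suc.prems(1)] Suc.prems(2,3)] by blast
  have "\<exists>M. Ck_bounded M n (partial_deriv i f)" for i
    using Suc by (auto intro: depends_on_partial_deriv slab_supported_partial_deriv)
  then obtain M where M: "\<And>i. Ck_bounded (M i) n (partial_deriv i f)" by metis
  have M_pos: "0 \<le> M i" for i using M Ck_bounded_nonneg by blast
  have M0_pos: "0 \<le> M0" using M0 norm_ge_zero order_trans by blast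
  define B where "B = M0 + (\<Sum>i\<in>UNIV. M i)"
  have "M0 \<le> B" unfolding B_def by (simp add: sum_nonneg M_pos)
  then have "norm (f x) \<le> B" for x using M0 order_trans by blast
  moreover have "Ck_bounded B n (partial_deriv i f)" for i
  proof (rule Ck_bounded_mono[OF M])
    have "M i \<le> (\<Sum>i\<in>UNIV. M i)" by (rule member_le_sum) (auto simp: M_pos)
    then show "M i \<le> B" using M0_pos by (simp add: B_def)
  qed
  ultimately show ?case using Suc.prems(1) by auto
qed

text \<open>This is the periodic extension only for functions that vanish unless the coordinate lies in
  \<open>]-\<pi>, \<pi>[\<close>; otherwise the values outside that interval are cut off.\<close>

definition periodize :: "'d \<Rightarrow> (real^'d \<Rightarrow> 'b) \<Rightarrow> real^'d \<Rightarrow> 'b" where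
  "periodize j f x = f (x - (2 * pi * of_int (round (x $ j / (2 * pi)))) *\<^sub>R axis j 1)"

lemma round_period: "\<bar>t - 2 * pi * of_int (round (t / (2 * pi)))\<bar> \<le> pi"
proof -
  have "\<bar>of_int (round (t / (2 * pi))) - t / (2 * pi)\<bar> \<le> 1 / 2" by (rule of_int_round_abs_le)
  then have A: "2 * pi * \<bar>of_int (round (t / (2 * pi))) - t / (2 * pi)\<bar> \<le> 2 * pi * (1 / 2)"
    by (intro mult_left_mono) auto
  have B: "2 * pi * \<bar>of_int (round (t / (2 * pi))) - t / (2 * pi)\<bar> =
      \<bar>2 * pi * (of_int (round (t / (2 * pi))) - t / (2 * pi))\<bar>" by (simp add: abs_mult)
  have C: "2 * pi * (of_int (round (t / (2 * pi))) - t / (2 * pi)) = 2 * pi * of_int (round (t / (2 * pi))) - t"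
    by (simp add: right_diff_distrib)
  show ?thesis using A unfolding B C by (simp add: abs_minus_commute)
qed

text \<open>\<open>round\<close> jumps only where the coordinate is near an odd multiple of
  \<open>pi\<close>, and there both candidate translates vanish. So near every point the periodized
  function is a single translate of \<open>f\<close> and inherits its regularity.\<close>

lemma periodize_locally_shift:
  fixes f :: "real^'d \<Rightarrow> 'b::zero"
  assumes "slab_supported {j} f"
  shows "\<forall>\<^sub>F y in nhds x. periodize j f y = f (y - (2 * pi * of_int (round (x $ j / (2 * pi)))) *\<^sub>R axis j 1)"
proof -
  have "\<forall>\<^sub>F y in nhds x. y \<in> {y. \<bar>y $ j - x $ j\<bar> < 1/2}"
    by (rule eventually_nhds_in_open) (auto intro!: open_Collect_less continuous_intros)
  then show ?thesis
  proof (rule eventually_mono)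
    fix y assume "y \<in> {y. \<bar>y $ j - x $ j\<bar> < 1/2}"
    then have y: "\<bar>y $ j - x $ j\<bar> < 1/2" by simp
    define z where "z = round (x $ j / (2 * pi))"
    define w where "w = round (y $ j / (2 * pi))"
    have z: "\<bar>x $ j - 2 * pi * of_int z\<bar> \<le> pi" and w: "\<bar>y $ j - 2 * pi * of_int w\<bar> \<le> pi"
      unfolding z_def w_def by (rule round_period)+
    show "periodize j f y = f (y - (2 * pi * of_int (round (x $ j / (2 * pi)))) *\<^sub>R axis j 1)"
    proof (cases "w = z")
      case True
      then show ?thesis by (simp add: periodize_def z_def w_def)
    next
      case False
      then have "1 \<le> \<bar>w - z\<bar>" by linarith
      then have "1 \<le> \<bar>of_int w - of_int z :: real\<bar>" by linarith
      then have "2 * pi * 1 \<le> 2 * pi * \<bar>of_int w - of_int z :: real\<bar>" by (intro mult_left_mono) auto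
      also have "\<dots> = \<bar>2 * pi * of_int w - 2 * pi * of_int z\<bar>"
        by (simp add: abs_mult flip: right_diff_distrib)
      finally have g: "2 * pi \<le> \<bar>2 * pi * of_int w - 2 * pi * of_int z\<bar>" by simp
      \<comment> \<open>The two distances add up to at least \<open>2 * pi\<close>, and neither
        exceeds \<open>pi + 1/2\<close>, as \<open>y $ j\<close> is within 1/2 of
        \<open>x $ j\<close>. Both are therefore at least \<open>pi - 1/2\<close>.\<close>
      have "2 < \<bar>y $ j - 2 * pi * of_int w\<bar>" "2 < \<bar>y $ j - 2 * pi * of_int z\<bar>"
        using g z w y pi_gt3 by linarith+
      then have "f (y - (2 * pi * of_int w) *\<^sub>R axis j 1) = 0" "f (y - (2 * pi * of_int z) *\<^sub>R axis j 1) = 0"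
        using assms unfolding slab_supported_def by auto
      then show ?thesis by (simp add: periodize_def z_def w_def)
    qed
  qed
qed

lemma partial_deriv_periodize:
  fixes f :: "real^'d \<Rightarrow> 'b::real_normed_vector"
  assumes "slab_supported {j} f"
  shows "partial_deriv i (periodize j f) = periodize j (partial_deriv i f)"
proof
  fix x
  show "partial_deriv i (periodize j f) x = periodize j (partial_deriv i f) x"
    unfolding partial_deriv_cong_eventually[OF periodize_locally_shift[OF assms, of x]] partial_deriv_shift
    by (simp add: periodize_def)
qed

lemma Ck_bounded_periodize:
  fixes f :: "real^'d \<Rightarrow> 'b::real_normed_vector"
  shows "Ck_bounded M n f \<Longrightarrow> slab_supported {j} f \<Longrightarrow> Ck_bounded M n (periodize j f)"
proof (induction n arbitrary: f)
  case 0
  have "isCont (periodize j f) x" for x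
  proof -
    let ?c = "(2 * pi * of_int (round (x $ j / (2 * pi)))) *\<^sub>R axis j 1 :: real^'d"
    have "isCont (\<lambda>y. f (y - ?c)) x"
      using Ck_bounded_shift[OF 0(1)] by (auto simp: continuous_on_eq_continuous_at)
    then show ?thesis
      using isCont_cong[OF periodize_locally_shift[OF 0(2)]] by blast
  qed
  then have "continuous_on UNIV (periodize j f)" by (simp add: continuous_on_eq_continuous_at)
  then show ?case using 0 by (auto simp: periodize_def)
next
  case (Suc n)
  have "periodize j f differentiable (at x)" for x
  proof -
    have "(\<lambda>y. f (y - c)) differentiable (at x)" for c
      using Ck_bounded_shift[OF Suc.prems(1)] by (auto simp: differentiable_on_UNIV_iff)
    then show ?thesis using differentiable_cong_eventually[OF periodize_locally_shift[OF Suc.prems(2)]] by blast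
  qed
  moreover have "norm (periodize j f x) \<le> M" for x
    using Suc.prems(1) by (simp add: periodize_def)
  ultimately show ?case
    using Suc slab_supported_partial_deriv[OF Suc.prems(2)]
    by (simp add: differentiable_on_UNIV_iff partial_deriv_periodize)
qed

text \<open>The representative of \<open>t\<close> modulo \<open>2 * pi\<close> of least absolute
  value.\<close>

definition reduced :: "real \<Rightarrow> real" where
  "reduced t = t - 2 * pi * of_int (round (t / (2 * pi)))"

lemma reduced_int_shift: "reduced (t + 2 * pi * of_int z) = reduced t"
proof -
  have "(t + 2 * pi * of_int z) / (2 * pi) = t / (2 * pi) + of_int z" by (simp add: add_divide_distrib)
  moreover have "round (t / (2 * pi) + of_int z) = round (t / (2 * pi)) + z"
    unfolding round_def by (metis (no_types, opaque_lifting) add.assoc add.commute floor_add_int)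
  ultimately show ?thesis by (simp add: reduced_def algebra_simps)
qed

lemma reduced_eq: "\<bar>t\<bar> < pi \<Longrightarrow> reduced t = t"
proof -
  assume "\<bar>t\<bar> < pi"
  then have "\<bar>t / (2 * pi) - of_int 0\<bar> < 1 / 2" by (simp add: abs_divide divide_less_eq)
  from round_unique'[OF this] show ?thesis by (simp add: reduced_def)
qed

lemma periodize_eq: "periodize j f x = f (x + (reduced (x $ j) - x $ j) *\<^sub>R axis j 1)"
  by (simp add: periodize_def reduced_def)

lemma periodize_periodic:
  fixes f :: "real^'d \<Rightarrow> 'b"
  assumes "i = j \<or> (\<forall>x. f (x + (2 * pi) *\<^sub>R axis i 1) = f x)"
  shows "periodize j f (x + (2 * pi) *\<^sub>R axis i 1) = periodize j f x"
proof (cases "i = j")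
  case True
  then show ?thesis
    using reduced_int_shift[of "x $ j" 1] by (simp add: periodize_eq algebra_simps)
next
  case False
  then have "axis i 1 $ j = (0::real)" by (simp add: axis_def)
  moreover have "f (x + (reduced (x $ j) - x $ j) *\<^sub>R axis j 1 + (2 * pi) *\<^sub>R axis i 1)
      = f (x + (reduced (x $ j) - x $ j) *\<^sub>R axis j 1)"
    using assms False by blast
  ultimately show ?thesis by (simp add: periodize_eq algebra_simps)
qed

section \<open>Integration by parts on the torus\<close>

text \<open>The fundamental cube with its \<open>i\<close>-th side replaced by the interval from
  \<open>a\<close> to \<open>b\<close>, so that a translation in direction \<open>i\<close> can be
  undone by cutting and pasting.\<close>

definition torus_slab :: "'d \<Rightarrow> real \<Rightarrow> real \<Rightarrow> (real^'d) set" where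
  "torus_slab i a b = cbox (\<chi> k. if k = i then a else 0) (\<chi> k. if k = i then b else 2 * pi)"

lemma mem_torus_slab:
  "x \<in> torus_slab i a b \<longleftrightarrow> a \<le> x $ i \<and> x $ i \<le> b \<and> (\<forall>k. k \<noteq> i \<longrightarrow> 0 \<le> x $ k \<and> x $ k \<le> 2 * pi)"
  by (auto simp: torus_slab_def mem_box_cart split: if_splits)

lemma torus_integral_eq_slab:
  fixes f :: "real^'d \<Rightarrow> real"
  shows "torus_integral f = integral (torus_slab i 0 (2 * pi)) f"
proof -
  have "(\<chi> k. if k = i then 0 else 0) = (0 :: real^'d)" "(\<chi> k. if k = i then 2 * pi else 2 * pi) = ((\<chi> k. 2 * pi) :: real^'d)"
    by (simp_all add: vec_eq_iff)
  then show ?thesis by (simp add: torus_integral_def torus_slab_def)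
qed

lemma integral_torus_slab_split:
  fixes f :: "real^'d \<Rightarrow> real"
  assumes f: "continuous_on UNIV f" and "a \<le> c" "c \<le> b"
  shows "integral (torus_slab i a b) f = integral (torus_slab i a c) f + integral (torus_slab i c b) f"
proof -
  have "f integrable_on torus_slab i a b"
    unfolding torus_slab_def by (rule integrable_continuous) (rule continuous_on_subset[OF f], simp)
  then have "integral (torus_slab i a b) f =
      integral (torus_slab i a b \<inter> {x. x \<bullet> axis i 1 \<le> c}) f + integral (torus_slab i a b \<inter> {x. x \<bullet> axis i 1 \<ge> c}) f"
    unfolding torus_slab_def by (rule integral_split) (auto simp: axis_in_Basis_iff)
  moreover have "torus_slab i a b \<inter> {x. x \<bullet> axis i 1 \<le> c} = torus_slab i a c"
    "torus_slab i a b \<inter> {x. x \<bullet> axis i 1 \<ge> c} = torus_slab i c b"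
    using assms by (auto simp: mem_torus_slab inner_axis)
  ultimately show ?thesis by simp
qed

lemma integral_torus_slab_shift:
  fixes f :: "real^'d \<Rightarrow> real"
  shows "integral (torus_slab i a b) (\<lambda>x. f (x + h *\<^sub>R axis i 1)) = integral (torus_slab i (a + h) (b + h)) f"
proof -
  have "(\<chi> k. if k = i then c + h else e) - h *\<^sub>R axis i 1 = (\<chi> k. if k = i then c else e)" for c e
    by (simp add: vec_eq_iff axis_def)
  then show ?thesis
    using integral_shift_cbox[of "\<chi> k. if k = i then a + h else 0" "h *\<^sub>R axis i 1" "\<chi> k. if k = i then b + h else 2 * pi" f]
    by (simp add: torus_slab_def)
qed

text \<open>The part of the translated cube that sticks out is moved back by one period and fills
  the gap at the other end.\<close>

lemma torus_integral_shift:
  fixes f :: "real^'d \<Rightarrow> real"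
  assumes f: "continuous_on UNIV f" and t: "torus_fun f" and h: "0 \<le> h" "h \<le> 2 * pi"
  shows "torus_integral (\<lambda>x. f (x + h *\<^sub>R axis i 1)) = torus_integral f"
proof -
  have per: "(\<lambda>x. f (x + (2 * pi) *\<^sub>R axis i 1)) = f" using t by (auto simp: torus_fun_def)
  have "torus_integral (\<lambda>x. f (x + h *\<^sub>R axis i 1)) = integral (torus_slab i h (2 * pi + h)) f"
    unfolding torus_integral_eq_slab[of _ i] integral_torus_slab_shift by simp
  also have "\<dots> = integral (torus_slab i h (2 * pi)) f + integral (torus_slab i (2 * pi) (2 * pi + h)) f"
    by (rule integral_torus_slab_split[OF f]) (use h in auto)
  also have "integral (torus_slab i (2 * pi) (2 * pi + h)) f = integral (torus_slab i 0 h) f"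
    using integral_torus_slab_shift[of i 0 h f "2 * pi"] by (simp add: per add.commute)
  also have "integral (torus_slab i h (2 * pi)) f + integral (torus_slab i 0 h) f = torus_integral f"
    unfolding torus_integral_eq_slab[of _ i] using integral_torus_slab_split[OF f, of 0 h "2 * pi" i] h by simp
  finally show ?thesis .
qed

lemma continuous_imp_torus_integrable:
  fixes f :: "real^'d \<Rightarrow> real"
  shows "continuous_on UNIV f \<Longrightarrow> f integrable_on cbox 0 (\<chi> i. 2 * pi)"
  by (rule integrable_continuous) (rule continuous_on_subset, auto)

text \<open>By translation invariance every difference quotient has integral 0, and dominated
  convergence carries this over to the derivative. Iterated integrals do not occur.\<close>

lemma torus_integral_partial_deriv:
  fixes f :: "real^'d \<Rightarrow> real"
  assumes f: "Ck (Suc 0) f" and t: "torus_fun f"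
  shows "torus_integral (partial_deriv i f) = 0"
proof -
  have df: "f differentiable_on UNIV" and cp: "continuous_on UNIV (partial_deriv i f)" using f by auto
  have cf: "continuous_on UNIV f" using df differentiable_imp_continuous_on by blast
  \<comment> \<open>The larger cube \<open>?Q'\<close> contains the intermediate points of the mean
    value theorem, since the increments \<open>h n\<close> are at most 1; the derivative is bounded
    there.\<close>
  let ?Q = "cbox 0 (\<chi> i. 2 * pi) :: (real^'d) set" and ?Q' = "cbox 0 (\<chi> i. 2 * pi + 1) :: (real^'d) set"
  define h where "h n = inverse (real (Suc n))" for n
  have h: "0 < h n" "h n \<le> 1" for n by (auto simp: h_def inverse_le_1_iff)
  have csh: "continuous_on UNIV (\<lambda>x. f (x + c))" for c
    by (rule continuous_on_compose2[OF cf]) (auto intro!: continuous_intros)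
  define g where "g n x = (f (x + h n *\<^sub>R axis i 1) - f x) / h n" for n x
  have cg: "continuous_on UNIV (g n)" for n
    unfolding g_def using h[of n] by (auto intro!: continuous_intros csh cf)
  have ig: "integral ?Q (g n) = 0" for n
  proof -
    have "h n \<le> 2 * pi" using h(2)[of n] pi_gt3 by linarith
    then have "torus_integral (\<lambda>x. f (x + h n *\<^sub>R axis i 1)) = torus_integral f"
      using torus_integral_shift[OF cf t] h(1)[of n] by simp
    then show ?thesis
      unfolding g_def torus_integral_def
      by (simp add: integral_diff[OF continuous_imp_torus_integrable[OF csh] continuous_imp_torus_integrable[OF cf]])
  qed
  have "compact (partial_deriv i f ` ?Q')"
    by (intro compact_continuous_image continuous_on_subset[OF cp]) auto
  then obtain M where M: "\<And>y. y \<in> ?Q' \<Longrightarrow> norm (partial_deriv i f y) \<le> M"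
    using compact_imp_bounded bounded_iff by (metis imageI)
  have "(\<lambda>n. integral ?Q (g n)) \<longlonglongrightarrow> integral ?Q (partial_deriv i f)"
  proof (rule dominated_convergence(2)[where h="\<lambda>_. M"])
    show "g n integrable_on ?Q" for n by (rule continuous_imp_torus_integrable[OF cg])
    show "norm (g n x) \<le> M" if x: "x \<in> ?Q" for n x
    proof -
      have "\<exists>z>0. z < h n \<and> f (x + h n *\<^sub>R axis i 1) - f (x + 0 *\<^sub>R axis i 1) = (h n - 0) * partial_deriv i f (x + z *\<^sub>R axis i 1)"
        by (rule MVT2[OF h(1), of n "\<lambda>s. f (x + s *\<^sub>R axis i 1)"])
           (use has_vector_derivative_along_axis[OF df] in \<open>simp add: has_real_derivative_iff_has_vector_derivative\<close>)
      then obtain z where z: "0 < z" "z < h n" "f (x + h n *\<^sub>R axis i 1) - f x = h n * partial_deriv i f (x + z *\<^sub>R axis i 1)"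
        by auto
      have "x + z *\<^sub>R axis i 1 \<in> ?Q'"
        unfolding mem_box_cart
      proof (intro allI)
        fix k
        have "0 \<le> x $ k" "x $ k \<le> 2 * pi" using x by (auto simp: mem_box_cart)
        then show "0 $ k \<le> (x + z *\<^sub>R axis i 1) $ k \<and> (x + z *\<^sub>R axis i 1) $ k \<le> (\<chi> i. 2 * pi + 1) $ k"
          using z h(2)[of n] by (auto simp: axis_def)
      qed
      then show ?thesis using M z(3) h(1)[of n] by (simp add: g_def)
    qed
    show "(\<lambda>n. g n x) \<longlonglongrightarrow> partial_deriv i f x" for x
    proof -
      have "((\<lambda>s. f (x + s *\<^sub>R axis i 1)) has_real_derivative partial_deriv i f x) (at 0)"
        using has_vector_derivative_along_axis[OF df, of x i 0] by (simp add: has_real_derivative_iff_has_vector_derivative)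
      then have "((\<lambda>s. (f (x + s *\<^sub>R axis i 1) - f x) / s) \<longlongrightarrow> partial_deriv i f x) (at 0)"
        by (simp add: DERIV_def)
      moreover have "filterlim h (at 0) sequentially"
        unfolding filterlim_at h_def using LIMSEQ_inverse_real_of_nat by auto
      ultimately show ?thesis unfolding g_def by (rule filterlim_compose)
    qed
  qed auto
  then show ?thesis unfolding ig torus_integral_def by (simp add: LIMSEQ_const_iff)
qed

lemma torus_fun_mult: "torus_fun f \<Longrightarrow> torus_fun g \<Longrightarrow> torus_fun (\<lambda>x. f x * g x)"
  by (simp add: torus_fun_def)

lemma torus_fun_partial_deriv:
  fixes f :: "real^'d \<Rightarrow> 'b::real_normed_vector"
  assumes "torus_fun f"
  shows "torus_fun (partial_deriv i f)"
  unfolding torus_fun_def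
proof (intro allI)
  fix x j
  have "(\<lambda>y. f (y - (- ((2 * pi) *\<^sub>R axis j 1)))) = f" using assms by (simp add: torus_fun_def)
  then show "partial_deriv i f (x + (2 * pi) *\<^sub>R axis j 1) = partial_deriv i f x"
    using partial_deriv_shift[of i f "- ((2 * pi) *\<^sub>R axis j 1)" x] by simp
qed

lemma torus_integral_by_parts:
  fixes f g :: "real^'d \<Rightarrow> real"
  assumes f: "Ck (Suc 0) f" "torus_fun f" and g: "Ck (Suc 0) g" "torus_fun g"
  shows "torus_integral (\<lambda>x. f x * partial_deriv i g x) = - torus_integral (\<lambda>x. partial_deriv i f x * g x)"
proof -
  have d: "f differentiable_on UNIV" "g differentiable_on UNIV"
    and c: "continuous_on UNIV (partial_deriv i f)" "continuous_on UNIV (partial_deriv i g)"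
    using f g by auto
  have cf: "continuous_on UNIV f" "continuous_on UNIV g" using d differentiable_imp_continuous_on by blast+
  have "torus_integral (partial_deriv i (\<lambda>x. f x * g x)) = 0"
    by (intro torus_integral_partial_deriv Ck_mult torus_fun_mult f g)
  then have "torus_integral (\<lambda>x. f x * partial_deriv i g x + partial_deriv i f x * g x) = 0"
    by (simp add: partial_deriv_mult[OF d])
  moreover have "torus_integral (\<lambda>x. f x * partial_deriv i g x + partial_deriv i f x * g x)
      = torus_integral (\<lambda>x. f x * partial_deriv i g x) + torus_integral (\<lambda>x. partial_deriv i f x * g x)"
    unfolding torus_integral_def
    by (intro integral_add continuous_imp_torus_integrable continuous_on_mult c cf)
  ultimately show ?thesis by linarith
qed

lemma torus_integral_sum:
  fixes f :: "'a \<Rightarrow> real^'d \<Rightarrow> real"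
  assumes "finite I" "\<And>i. i \<in> I \<Longrightarrow> continuous_on UNIV (f i)"
  shows "torus_integral (\<lambda>x. \<Sum>i\<in>I. f i x) = (\<Sum>i\<in>I. torus_integral (f i))"
  unfolding torus_integral_def by (intro integral_sum continuous_imp_torus_integrable assms)

lemma inner_eq_sum_components: "x \<bullet> y = (\<Sum>i\<in>UNIV. x $ i * y $ i)" for x y :: "real^'d"
  by (simp add: inner_vec_def)

lemma Ck_vec_nth: "Ck n f \<Longrightarrow> Ck n (\<lambda>x. f x $ i)" for f :: "real^'d \<Rightarrow> real^'e"
  by (rule Ck_bounded_linear[OF bounded_linear_vec_nth])

lemma torus_integral_inner_gradient:
  fixes W :: "real^'d \<Rightarrow> real^'d"
  assumes W: "Ck (Suc 0) W" "torus_fun W" and g: "Ck (Suc 0) g" "torus_fun g"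
  shows "torus_integral (\<lambda>x. W x \<bullet> gradient g x) = - torus_integral (\<lambda>x. divergence W x * g x)"
proof -
  have dW: "W differentiable_on UNIV" using W by simp
  have Wi: "Ck (Suc 0) (\<lambda>x. W x $ i)" "torus_fun (\<lambda>x. W x $ i)" for i
    using W by (auto intro: Ck_vec_nth simp: torus_fun_def simp del: Ck.simps)
  have c: "continuous_on UNIV (\<lambda>x. W x $ i)" "continuous_on UNIV g"
      "continuous_on UNIV (\<lambda>x. partial_deriv i W x $ i)" "continuous_on UNIV (partial_deriv i g)" for i
    using Ck_imp_continuous[OF Wi(1)] Ck_imp_continuous[OF g(1)] g W
    by (auto intro: continuous_on_component)
  have "torus_integral (\<lambda>x. W x \<bullet> gradient g x) = (\<Sum>i\<in>UNIV. torus_integral (\<lambda>x. W x $ i * partial_deriv i g x))"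
    unfolding inner_eq_sum_components gradient_def vec_lambda_beta
    by (intro torus_integral_sum continuous_on_mult c) auto
  also have "\<dots> = (\<Sum>i\<in>UNIV. - torus_integral (\<lambda>x. partial_deriv i W x $ i * g x))"
    using torus_integral_by_parts[OF Wi g] by (simp add: partial_deriv_component[OF dW])
  also have "\<dots> = - torus_integral (\<lambda>x. \<Sum>i\<in>UNIV. partial_deriv i W x $ i * g x)"
    by (subst torus_integral_sum) (auto intro!: continuous_on_mult c simp: sum_negf)
  finally show ?thesis by (simp add: divergence_def sum_distrib_right)
qed

text \<open>Both derivatives of the Laplacian fall on \<phi>, so one derivative of \<open>p\<close>
  is enough, as the case \<open>S = 1\<close> requires.\<close>

lemma torus_integral_inner_gradients:
  fixes p \<phi> :: "real^'d \<Rightarrow> real"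
  assumes p: "Ck (Suc 0) p" "torus_fun p" and \<phi>: "Ck (Suc (Suc 0)) \<phi>" "torus_fun \<phi>"
  shows "torus_integral (\<lambda>x. gradient p x \<bullet> gradient \<phi> x) = torus_integral (\<lambda>x. p x * (- laplacian \<phi> x))"
proof -
  have \<phi>i: "Ck (Suc 0) (partial_deriv i \<phi>)" "torus_fun (partial_deriv i \<phi>)" for i
    using \<phi> torus_fun_partial_deriv by auto
  have c: "continuous_on UNIV p" "continuous_on UNIV (partial_deriv i p)"
      "continuous_on UNIV (partial_deriv i \<phi>)" "continuous_on UNIV (partial_deriv i (partial_deriv i \<phi>))" for i
    using Ck_imp_continuous[OF p(1)] Ck_imp_continuous[OF \<phi>i(1)] p \<phi>i[of i] by auto
  have "torus_integral (\<lambda>x. gradient p x \<bullet> gradient \<phi> x) = (\<Sum>i\<in>UNIV. torus_integral (\<lambda>x. partial_deriv i p x * partial_deriv i \<phi> x))"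
    unfolding inner_eq_sum_components gradient_def vec_lambda_beta
    by (intro torus_integral_sum continuous_on_mult c) auto
  also have "\<dots> = (\<Sum>i\<in>UNIV. - torus_integral (\<lambda>x. p x * partial_deriv i (partial_deriv i \<phi>) x))"
    using torus_integral_by_parts[OF p \<phi>i] by simp
  also have "\<dots> = - torus_integral (\<lambda>x. \<Sum>i\<in>UNIV. p x * partial_deriv i (partial_deriv i \<phi>) x)"
    by (subst torus_integral_sum) (auto intro!: continuous_on_mult c simp: sum_negf)
  also have "\<dots> = torus_integral (\<lambda>x. p x * (- laplacian \<phi> x))"
    by (simp add: torus_integral_def laplacian_def sum_distrib_left)
  finally show ?thesis .
qed

lemma torus_integral_minus_mean:
  fixes f :: "real^'d \<Rightarrow> real"
  assumes "continuous_on UNIV f"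
  shows "torus_integral (\<lambda>x. f x - torus_integral f / (2 * pi) ^ CARD('d)) = 0"
proof -
  let ?Q = "cbox 0 (\<chi> i. 2 * pi) :: (real^'d) set"
  have "0 \<in> ?Q" by (simp add: mem_box_cart)
  then have "?Q \<noteq> {}" by blast
  then have "measure lborel ?Q = (2 * pi) ^ CARD('d)" by (simp add: content_cbox_cart)
  then show ?thesis
    unfolding torus_integral_def
    by (subst integral_diff[OF continuous_imp_torus_integrable[OF assms]]) auto
qed

section \<open>Fields with traveling localized parts\<close>

lemma suminf_single:
  fixes f :: "nat \<Rightarrow> 'a::{comm_monoid_add,t2_space}"
  assumes "\<And>m. m \<noteq> n \<Longrightarrow> f m = 0"
  shows "(\<Sum>m. f m) = f n"
  using suminf_finite[of "{n}" f] assms by simp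

lemma torus_fun_int_shift:
  fixes f :: "real^'d \<Rightarrow> 'b"
  assumes "torus_fun f"
  shows "f (x + (2 * pi * of_int z) *\<^sub>R axis i 1) = f x"
proof -
  have nat: "f (x + (2 * pi * of_nat k) *\<^sub>R axis i 1) = f x" for k x
  proof (induction k)
    case (Suc k)
    have "f (x + (2 * pi * of_nat (Suc k)) *\<^sub>R axis i 1) = f ((x + (2 * pi * of_nat k) *\<^sub>R axis i 1) + (2 * pi) *\<^sub>R axis i 1)"
      by (simp add: algebra_simps)
    then show ?case using Suc assms by (simp add: torus_fun_def)
  qed simp
  show ?thesis
  proof (cases "z \<ge> 0")
    case True
    then show ?thesis using nat[of x "nat z"] by simp
  next
    case False
    then show ?thesis
      using nat[of "x + (2 * pi * of_int z) *\<^sub>R axis i 1" "nat (- z)"] by simp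
  qed
qed

lemma partial_deriv_sum:
  fixes f :: "'i \<Rightarrow> real^'d \<Rightarrow> 'b::real_normed_vector"
  assumes "finite I" "\<And>k. k \<in> I \<Longrightarrow> f k differentiable_on UNIV"
  shows "partial_deriv i (\<lambda>x. \<Sum>k\<in>I. f k x) = (\<lambda>x. \<Sum>k\<in>I. partial_deriv i (f k) x)"
proof
  fix x
  have "((\<lambda>x. \<Sum>k\<in>I. f k x) has_derivative (\<lambda>h. \<Sum>k\<in>I. frechet_derivative (f k) (at x) h)) (at x)"
    by (rule has_derivative_sum) (use assms frechet_derivative_works differentiable_on_UNIV_iff in blast)
  from partial_deriv_eq[OF this]
  show "partial_deriv i (\<lambda>x. \<Sum>k\<in>I. f k x) x = (\<Sum>k\<in>I. partial_deriv i (f k) x)"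
    by (simp add: partial_deriv_def)
qed

text \<open>By symmetry of second derivatives. It makes the phase derivatives of a divergence-free
  vortex divergence free again.\<close>

lemma divergence_partial_deriv:
  fixes f :: "real^'d \<Rightarrow> real^'d"
  assumes f: "Ck (Suc (Suc 0)) f"
  shows "divergence (partial_deriv b f) = partial_deriv b (divergence f)"
proof -
  have d: "partial_deriv j f differentiable_on UNIV" for j using f by simp
  have c: "(\<lambda>x. partial_deriv j f x $ j) differentiable_on UNIV" for j
    using d bounded_linear.has_derivative[OF bounded_linear_vec_nth]
    unfolding differentiable_on_UNIV_iff differentiable_def by blast
  have "partial_deriv b (divergence f) = (\<lambda>x. \<Sum>j\<in>UNIV. partial_deriv b (\<lambda>x. partial_deriv j f x $ j) x)"
    unfolding divergence_def[abs_def] by (rule partial_deriv_sum) (use c in auto)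
  also have "\<dots> = divergence (partial_deriv b f)"
    unfolding partial_deriv_component[OF d] divergence_def[abs_def] partial_deriv_commute[OF f, of b] ..
  finally show ?thesis ..
qed

lemma divergence_series:
  fixes f :: "nat \<Rightarrow> real^'d \<Rightarrow> real^'d"
  assumes f: "\<And>n. Ck_bounded (M n) (Suc 0) (f n)" and M: "summable M"
    and z: "\<And>n x. divergence (f n) x = 0"
  shows "divergence (\<lambda>x. \<Sum>n. f n x) x = 0"
proof -
  have s: "summable (\<lambda>n. partial_deriv j (f n) x)" for j
    by (rule norm_suminf_le(1)[OF _ M]) (use f in auto)
  have "divergence (\<lambda>x. \<Sum>n. f n x) x = (\<Sum>j\<in>UNIV. (\<Sum>n. partial_deriv j (f n) x $ j))"
    unfolding divergence_def partial_deriv_series[OF f M]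
    by (simp add: bounded_linear.suminf[OF bounded_linear_vec_nth s])
  also have "\<dots> = (\<Sum>n. divergence (f n) x)"
    unfolding divergence_def
    by (rule suminf_sum[symmetric]) (rule bounded_linear.summable[OF bounded_linear_vec_nth s])
  finally show ?thesis by (simp add: z)
qed

lemma divergence_shift: "divergence (\<lambda>y. f (y - c)) x = divergence f (x - c)"
  by (simp add: divergence_def partial_deriv_shift)

lemma torus_fun_shift: "torus_fun f \<Longrightarrow> torus_fun (\<lambda>y. f (y - c))"
proof -
  assume t: "torus_fun f"
  have "f (x + (2 * pi) *\<^sub>R axis i 1 - c) = f (x - c)" for x i
    using t[unfolded torus_fun_def, rule_format, of "x - c" i] by (simp add: algebra_simps)
  then show ?thesis by (simp add: torus_fun_def)
qed

lemma torus_fun_scaleR: "torus_fun f \<Longrightarrow> torus_fun (\<lambda>x. a *\<^sub>R f x)"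
  by (simp add: torus_fun_def)

lemma torus_fun_series: "(\<And>n. torus_fun (f n)) \<Longrightarrow> torus_fun (\<lambda>x. \<Sum>n. f n x)"
  by (simp add: torus_fun_def)

text \<open>The entries of a sequence are enumerated linearly, the \<open>k\<close>-th block occupying the indices
  from \<open>k M\<close> to \<open>k M + M - 1\<close>.\<close>

definition entry :: "nat \<Rightarrow> (nat \<Rightarrow> nat \<Rightarrow> 'a) \<Rightarrow> nat \<Rightarrow> 'a" where
  "entry M \<theta> n = \<theta> (n div M) (n mod M)"

lemma entry_seq_add: "entry M (seq_add \<theta> h) n = entry M \<theta> n + entry M h n"
  by (simp add: entry_def seq_add_def)

lemma entry_seq_scale: "entry M (seq_scale a h) n = a * entry M h n"
  by (simp add: entry_def seq_scale_def)

lemma abs_le_block_norm: "i < N k \<Longrightarrow> \<bar>\<theta> k i\<bar> \<le> block_norm N \<theta> k"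
  using member_le_L2_set[of "{..<N k}" i "\<lambda>i. \<bar>\<theta> k i\<bar>"]
  by (simp add: block_norm_def L2_set_def)

lemma block_norm_nonneg: "0 \<le> block_norm N \<theta> k"
  by (simp add: block_norm_def)

lemma
  assumes "\<theta> \<in> bdd_seqs N"
  shows seq_norm_nonneg: "0 \<le> seq_norm N \<theta>"
    and abs_entry_le: "\<bar>entry M \<theta> n\<bar> \<le> seq_norm N \<theta>"
proof -
  have b: "bdd_above (block_norm N \<theta> ` {1..})" and s: "seq_support N \<theta>"
    using assms by (auto simp: bdd_seqs_def)
  have le: "block_norm N \<theta> k \<le> seq_norm N \<theta>" if "1 \<le> k" for k
    unfolding seq_norm_def by (rule cSUP_upper[OF _ b]) (use that in simp)
  show nn: "0 \<le> seq_norm N \<theta>" using block_norm_nonneg[of N \<theta> 1] le[of 1] by simp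
  show "\<bar>entry M \<theta> n\<bar> \<le> seq_norm N \<theta>"
  proof (cases "n div M = 0 \<or> N (n div M) \<le> n mod M")
    case True
    then have "entry M \<theta> n = 0" using s unfolding seq_support_def entry_def by blast
    then show ?thesis using nn by simp
  next
    case False
    then show ?thesis
      using abs_le_block_norm[of "n mod M" N "n div M" \<theta>] le[of "n div M"] by (simp add: entry_def)
  qed
qed

text \<open>Isolates what is used of the concrete fields. \<open>A n\<close> is the shear flow of
  strip \<open>n\<close>, \<open>B n\<close> its vortex at phase 0 and \<open>p n\<close> the
  pressure of that vortex. Only the index \<open>active x\<close> can contribute at
  \<open>x\<close>, and shifts along \<open>dir\<close> do not change this. In
  \<open>conv_AB\<close> and \<open>conv_BA\<close> the field \<open>A n\<close> is evaluated at
  \<open>x\<close> and \<open>B n\<close> at a shifted point, since only the vortices move. The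
  assumptions from \<open>dir_neq\<close> on serve injectivity and asymmetry: \<open>Y n\<close> is
  a height at which the phase of vortex \<open>n\<close> can be read off from the component along
  \<open>y0\<close>, with profile \<open>g n\<close>. Indices \<open>n\<close> that belong to no
  entry of a phase carry a vortex as well; its phase and speed are 0.\<close>

locale traveling_blobs =
  fixes S M :: nat and N :: "nat \<Rightarrow> nat" and \<nu> :: "nat \<Rightarrow> nat \<Rightarrow> real"
    and dir :: "nat \<Rightarrow> 'd::finite" and active :: "real^'d \<Rightarrow> nat"
    and A B :: "nat \<Rightarrow> real^'d \<Rightarrow> real^'d" and p :: "nat \<Rightarrow> real^'d \<Rightarrow> real"
    and MA MB MP :: "nat \<Rightarrow> real"
    and y0 :: 'd and Y :: "nat \<Rightarrow> real" and g :: "nat \<Rightarrow> real \<Rightarrow> real"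
  assumes S: "1 \<le> S" and N_le: "\<And>k. N k \<le> M" and \<nu>: "\<nu> \<in> bdd_seqs N"
    and A_bounded: "\<And>n. Ck_bounded (MA n) S (A n)" and MA: "summable MA"
    and B_bounded: "\<And>n. Ck_bounded (MB n) (Suc (Suc S)) (B n)" and MB: "summable MB"
    and p_bounded: "\<And>n. Ck_bounded (MP n) S (p n)" and MP: "summable MP"
    and A_torus: "\<And>n. torus_fun (A n)" and B_torus: "\<And>n. torus_fun (B n)" and p_torus: "\<And>n. torus_fun (p n)"
    and A_inactive: "\<And>m x j. m \<noteq> active x \<Longrightarrow> A m x = 0 \<and> partial_deriv j (A m) x = 0"
    and B_inactive: "\<And>m x j c. m \<noteq> active x \<Longrightarrow>
      B m (x - c *\<^sub>R axis (dir m) 1) = 0 \<and> partial_deriv j (B m) (x - c *\<^sub>R axis (dir m) 1) = 0"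
    and p_inactive: "\<And>m x j c. m \<noteq> active x \<Longrightarrow> partial_deriv j (p m) (x - c *\<^sub>R axis (dir m) 1) = 0"
    and A_div: "\<And>n x. divergence (A n) x = 0" and B_div: "\<And>n x. divergence (B n) x = 0"
    and conv_AA: "\<And>n x. convection (A n) x = 0"
    and conv_AB: "\<And>n x c. (\<Sum>j\<in>UNIV. A n x $ j *\<^sub>R partial_deriv j (B n) (x - c *\<^sub>R axis (dir n) 1))
      = entry M \<nu> n *\<^sub>R partial_deriv (dir n) (B n) (x - c *\<^sub>R axis (dir n) 1)"
    and conv_BA: "\<And>n x c. (\<Sum>j\<in>UNIV. B n (x - c *\<^sub>R axis (dir n) 1) $ j *\<^sub>R partial_deriv j (A n) x) = 0"
    and conv_BB: "\<And>n x. convection (B n) x + gradient (p n) x = 0"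
    and dir_neq: "\<And>n. dir n \<noteq> y0" and dir_surj: "\<And>b. b \<noteq> y0 \<Longrightarrow> \<exists>n. dir n = b"
    and vanish: "\<And>n x. x $ y0 = 0 \<Longrightarrow> A n x = 0 \<and> B n x = 0"
    and A_y0: "\<And>n x. A n x $ y0 = 0"
    and active_Y: "\<And>n x. x $ y0 = Y n \<Longrightarrow> active x = n"
    and B_profile: "\<And>n x. x $ y0 = Y n \<Longrightarrow> B n x $ y0 = g n (x $ dir n)"
    and g_periods: "\<And>n \<delta>. (\<And>t. g n (t + \<delta>) = g n t) \<Longrightarrow> \<exists>z::int. \<delta> = 2 * pi * of_int z"
begin

abbreviation e :: "nat \<Rightarrow> real^'d" where "e n \<equiv> axis (dir n) 1"

definition moved :: "(nat \<Rightarrow> nat \<Rightarrow> real) \<Rightarrow> nat \<Rightarrow> real^'d \<Rightarrow> real^'d" where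
  "moved \<theta> n x = B n (x - entry M \<theta> n *\<^sub>R e n)"

definition U :: "(nat \<Rightarrow> nat \<Rightarrow> real) \<Rightarrow> real^'d \<Rightarrow> real^'d" where
  "U \<theta> x = (\<Sum>n. A n x) + (\<Sum>n. moved \<theta> n x)"

text \<open>Each entry of the phase acts by translating one vortex, so the chain rule gives minus
  the derivative of that vortex along its direction.\<close>

definition D :: "(nat \<Rightarrow> nat \<Rightarrow> real) \<Rightarrow> (nat \<Rightarrow> nat \<Rightarrow> real) \<Rightarrow> real^'d \<Rightarrow> real^'d" where
  "D \<theta> h x = (\<Sum>n. (- entry M h n) *\<^sub>R partial_deriv (dir n) (moved \<theta> n) x)"

definition P\<^sub>0 :: "(nat \<Rightarrow> nat \<Rightarrow> real) \<Rightarrow> real^'d \<Rightarrow> real" where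
  "P\<^sub>0 \<theta> x = (\<Sum>n. p n (x - entry M \<theta> n *\<^sub>R e n))"

text \<open>\<open>is_inv_neg_laplacian\<close> selects the solution of zero average, hence the
  subtracted mean.\<close>

definition P :: "(nat \<Rightarrow> nat \<Rightarrow> real) \<Rightarrow> real^'d \<Rightarrow> real" where
  "P \<theta> x = P\<^sub>0 \<theta> x - torus_integral (P\<^sub>0 \<theta>) / (2 * pi) ^ CARD('d)"

definition K where "K = (\<Sum>n. MB n)"

lemma MB_nonneg: "0 \<le> MB n"
  using B_bounded Ck_bounded_nonneg by blast

lemma K_nonneg: "0 \<le> K"
  unfolding K_def using MB MB_nonneg by (simp add: suminf_nonneg)

lemma moved_bounded: "Ck_bounded (MB n) (Suc (Suc S)) (moved \<theta> n)"
  unfolding moved_def[abs_def] by (rule Ck_bounded_shift[OF B_bounded])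

lemma moved_partial: "partial_deriv j (moved \<theta> n) x = partial_deriv j (B n) (x - entry M \<theta> n *\<^sub>R e n)"
  unfolding moved_def[abs_def] partial_deriv_shift ..

lemma moved_partial_bounded: "Ck_bounded (MB n) (Suc S) (partial_deriv j (moved \<theta> n))"
  using moved_bounded by simp

lemma moved_div: "divergence (moved \<theta> n) x = 0"
  unfolding moved_def[abs_def] divergence_shift B_div ..

lemma moved_torus: "torus_fun (moved \<theta> n)"
  unfolding moved_def[abs_def] by (rule torus_fun_shift[OF B_torus])

lemma A_bounded_1: "Ck_bounded (MA n) (Suc 0) (A n)"
  by (rule Ck_bounded_le[OF A_bounded]) (use S in simp)

lemma moved_bounded_1: "Ck_bounded (MB n) (Suc 0) (moved \<theta> n)"
  by (rule Ck_bounded_le[OF moved_bounded]) simp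

lemma moved_bounded_S: "Ck_bounded (MB n) S (moved \<theta> n)"
  using Ck_bounded_le[OF moved_bounded] by simp

lemma U_bounded: "Ck_bounded ((\<Sum>n. MA n) + K) S (U \<theta>)"
  unfolding U_def[abs_def] K_def
  by (intro Ck_bounded_add Ck_bounded_series A_bounded MA MB moved_bounded_S)

lemma U_partial: "partial_deriv j (U \<theta>) x = (\<Sum>n. partial_deriv j (A n) x) + (\<Sum>n. partial_deriv j (moved \<theta> n) x)"
  unfolding U_def[abs_def]
  by (subst partial_deriv_add[OF differentiable_on_series[OF A_bounded_1 MA] differentiable_on_series[OF moved_bounded_1 MB]])
     (simp add: partial_deriv_series[OF A_bounded_1 MA] partial_deriv_series[OF moved_bounded_1 MB])

lemma U_div: "divergence (U \<theta>) x = 0"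
proof -
  have "divergence (U \<theta>) x = divergence (\<lambda>x. \<Sum>n. A n x) x + divergence (\<lambda>x. \<Sum>n. moved \<theta> n x) x"
    unfolding divergence_def U_partial
    by (simp add: sum.distrib partial_deriv_series[OF A_bounded_1 MA] partial_deriv_series[OF moved_bounded_1 MB])
  then show ?thesis
    by (simp add: divergence_series[OF A_bounded_1 MA A_div] divergence_series[OF moved_bounded_1 MB moved_div])
qed

lemma U_torus: "torus_fun (U \<theta>)"
  using torus_fun_series[OF A_torus] torus_fun_series[OF moved_torus[of \<theta>]]
  unfolding U_def torus_fun_def by simp

lemma U_in_Cs_div: "U \<theta> \<in> Cs_div S"
  using U_bounded Ck_bounded_imp_Ck U_torus U_div unfolding Cs_div_def by blast

lemma D_term_bounded:
  assumes "\<And>n. \<bar>entry M h n\<bar> \<le> r"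
  shows "Ck_bounded (r * MB n) (Suc S) (\<lambda>x. (- entry M h n) *\<^sub>R partial_deriv (dir n) (moved \<theta> n) x)"
proof (rule Ck_bounded_mono[OF Ck_bounded_scaleR[OF moved_partial_bounded]])
  show "\<bar>- entry M h n\<bar> * MB n \<le> r * MB n"
    using assms[of n] MB_nonneg by (simp add: mult_right_mono)
qed

lemma D_bounded:
  assumes "\<And>n. \<bar>entry M h n\<bar> \<le> r"
  shows "Ck_bounded (r * K) (Suc S) (D \<theta> h)"
  unfolding D_def[abs_def] K_def suminf_mult[OF MB, symmetric]
  by (intro Ck_bounded_series D_term_bounded assms summable_mult MB)

lemma summable_D:
  assumes h: "h \<in> bdd_seqs N"
  shows "summable (\<lambda>n. (- entry M h n) *\<^sub>R partial_deriv (dir n) (moved \<theta> n) x)"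
  by (rule norm_suminf_le(1)[OF Ck_bounded_norm[OF D_term_bounded[OF abs_entry_le[OF h]]]])
     (intro summable_mult MB)

lemma D_div:
  assumes h: "h \<in> bdd_seqs N"
  shows "divergence (D \<theta> h) x = 0"
  unfolding D_def[abs_def]
proof (rule divergence_series)
  show "Ck_bounded (seq_norm N h * MB n) (Suc 0) (\<lambda>x. (- entry M h n) *\<^sub>R partial_deriv (dir n) (moved \<theta> n) x)" for n
    by (rule Ck_bounded_le[OF D_term_bounded[OF abs_entry_le[OF h]]]) simp
  show "summable (\<lambda>n. seq_norm N h * MB n)" by (intro summable_mult MB)
  show "divergence (\<lambda>x. (- entry M h n) *\<^sub>R partial_deriv (dir n) (moved \<theta> n) x) x = 0" for n x
  proof -
    have C2: "Ck (Suc (Suc 0)) (moved \<theta> n)"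
      by (rule Ck_mono[OF Ck_bounded_imp_Ck[OF moved_bounded]]) simp
    then have d: "partial_deriv (dir n) (moved \<theta> n) differentiable_on UNIV" by simp
    have "divergence (\<lambda>x. (- entry M h n) *\<^sub>R partial_deriv (dir n) (moved \<theta> n) x) x
      = (- entry M h n) * divergence (partial_deriv (dir n) (moved \<theta> n)) x"
      unfolding divergence_def partial_deriv_bounded_linear[OF d bounded_linear_scaleR_right]
      by (simp add: sum_distrib_left)
    moreover have "divergence (moved \<theta> n) = (\<lambda>x. 0)" using moved_div by blast
    ultimately show ?thesis by (simp add: divergence_partial_deriv[OF C2])
  qed
qed

lemma D_torus: "torus_fun (D \<theta> h)"
  unfolding D_def[abs_def] by (intro torus_fun_series torus_fun_scaleR torus_fun_partial_deriv moved_torus)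

lemma D_in_Cs_div: "h \<in> bdd_seqs N \<Longrightarrow> D \<theta> h \<in> Cs_div S"
  using Ck_bounded_imp_Ck[OF Ck_bounded_Suc[OF D_bounded[OF abs_entry_le]]] D_torus D_div
  unfolding Cs_div_def by blast

lemma D_add:
  assumes "g' \<in> bdd_seqs N" "h \<in> bdd_seqs N"
  shows "D \<theta> (seq_add g' h) x = D \<theta> g' x + D \<theta> h x"
  unfolding D_def suminf_add[OF summable_D[OF assms(1)] summable_D[OF assms(2)]]
  by (simp add: entry_seq_add algebra_simps)

lemma D_scale:
  assumes "h \<in> bdd_seqs N"
  shows "D \<theta> (seq_scale a h) x = a *\<^sub>R D \<theta> h x"
proof -
  have "a *\<^sub>R D \<theta> h x = (\<Sum>n. a *\<^sub>R ((- entry M h n) *\<^sub>R partial_deriv (dir n) (moved \<theta> n) x))"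
    unfolding D_def by (rule bounded_linear.suminf[OF bounded_linear_scaleR_right summable_D[OF assms]])
  then show ?thesis by (simp add: D_def entry_seq_scale)
qed

lemma moved_seq_add: "moved (seq_add \<theta> h) n x = moved \<theta> n (x - entry M h n *\<^sub>R e n)"
  by (simp add: moved_def entry_seq_add algebra_simps)

lemma partial_moved_seq_add:
  "partial_deriv j (moved (seq_add \<theta> h) n) x = partial_deriv j (moved \<theta> n) (x - entry M h n *\<^sub>R e n)"
  by (simp add: moved_partial entry_seq_add algebra_simps)

lemma summable_moved: "summable (\<lambda>n. moved \<theta> n x)"
  by (rule norm_suminf_le(1)[OF Ck_bounded_norm[OF moved_bounded] MB])

text \<open>The shear parts cancel, and the Taylor remainders of the vortices are summed with the
  majorant \<open>MB\<close>. A bound on the entries suffices as hypothesis, so the estimate serves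
  both the Frechet derivative, with \<open>r\<close> the norm of \<open>h\<close>, and the time
  derivative, with \<open>r\<close> proportional to the time step.\<close>

lemma U_taylor:
  assumes h: "\<And>n. \<bar>entry M h n\<bar> \<le> r" 
  shows "Ck_bounded (r\<^sup>2 * K) S (\<lambda>x. U (seq_add \<theta> h) x - U \<theta> x - D \<theta> h x)"
proof -
  define T where "T n x = moved \<theta> n (x - entry M h n *\<^sub>R e n) - moved \<theta> n x
    + entry M h n *\<^sub>R partial_deriv (dir n) (moved \<theta> n) x" for n x
  have r: "0 \<le> r" using h[of 0] by simp
  have "Ck_bounded (r\<^sup>2 * MB n) S (T n)" for n
    unfolding T_def
  proof (rule Ck_bounded_mono[OF Ck_bounded_taylor[OF moved_bounded]])
    have "(entry M h n)\<^sup>2 \<le> r\<^sup>2" using h[of n] r by (simp add: abs_le_square_iff[symmetric])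
    then show "MB n * (entry M h n)\<^sup>2 \<le> r\<^sup>2 * MB n"
      using MB_nonneg[of n] by (simp add: mult.commute mult_left_mono)
  qed
  then have "Ck_bounded (\<Sum>n. r\<^sup>2 * MB n) S (\<lambda>x. \<Sum>n. T n x)"
    by (rule Ck_bounded_series) (intro summable_mult MB)
  moreover have "U (seq_add \<theta> h) x - U \<theta> x - D \<theta> h x = (\<Sum>n. T n x)" for x
  proof -
    have sD: "summable (\<lambda>n. (- entry M h n) *\<^sub>R partial_deriv (dir n) (moved \<theta> n) x)"
      by (rule norm_suminf_le(1)[OF Ck_bounded_norm[OF D_term_bounded[OF h]]]) (intro summable_mult MB)
    have "U (seq_add \<theta> h) x - U \<theta> x - D \<theta> h x
      = (\<Sum>n. moved (seq_add \<theta> h) n x) - (\<Sum>n. moved \<theta> n x) - D \<theta> h x"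
      by (simp add: U_def)
    also have "\<dots> = (\<Sum>n. moved (seq_add \<theta> h) n x - moved \<theta> n x - (- entry M h n) *\<^sub>R partial_deriv (dir n) (moved \<theta> n) x)"
      unfolding D_def
      by (simp only: suminf_diff[OF summable_moved summable_moved] suminf_diff[OF summable_diff[OF summable_moved summable_moved] sD])
    finally show ?thesis by (simp add: T_def moved_seq_add)
  qed
  ultimately show ?thesis by (simp add: K_def suminf_mult[OF MB])
qed

lemma D_continuous:
  assumes g': "\<And>n. \<bar>entry M g' n\<bar> \<le> r'" and h: "\<And>n. \<bar>entry M h n\<bar> \<le> r"
  shows "Ck_bounded (r * r' * K) S (\<lambda>x. D (seq_add \<theta> g') h x - D \<theta> h x)"
proof -
  define T where "T n x = (- entry M h n) *\<^sub>R (partial_deriv (dir n) (moved \<theta> n) (x - entry M g' n *\<^sub>R e n)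
    - partial_deriv (dir n) (moved \<theta> n) x)" for n x
  have "Ck_bounded (r * r' * MB n) S (T n)" for n
    unfolding T_def
  proof (rule Ck_bounded_mono[OF Ck_bounded_scaleR[OF Ck_bounded_difference[OF moved_partial_bounded]]])
    have "\<bar>entry M h n\<bar> * \<bar>entry M g' n\<bar> \<le> r * r'"
      using h[of n] g'[of n] by (intro mult_mono) auto
    from mult_right_mono[OF this MB_nonneg[of n]]
    show "\<bar>- entry M h n\<bar> * (MB n * \<bar>entry M g' n\<bar>) \<le> r * r' * MB n" by (simp add: mult_ac)
  qed
  then have "Ck_bounded (\<Sum>n. r * r' * MB n) S (\<lambda>x. \<Sum>n. T n x)"
    by (rule Ck_bounded_series) (intro summable_mult MB)
  moreover have "D (seq_add \<theta> g') h x - D \<theta> h x = (\<Sum>n. T n x)" for x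
  proof -
    have sD: "summable (\<lambda>n. (- entry M h n) *\<^sub>R partial_deriv (dir n) (moved \<theta>' n) x)" for \<theta>'
      by (rule norm_suminf_le(1)[OF Ck_bounded_norm[OF D_term_bounded[OF h]]]) (intro summable_mult MB)
    show ?thesis
      unfolding D_def suminf_diff[OF sD sD] T_def
      by (simp add: partial_moved_seq_add scaleR_diff_right)
  qed
  ultimately show ?thesis by (simp add: K_def suminf_mult[OF MB])
qed

lemma moved_torus_eq:
  assumes "torus_eq \<theta> \<phi>" "torus_fun f"
  shows "f (x - entry M \<theta> n *\<^sub>R e n) = f (x - entry M \<phi> n *\<^sub>R e n)"
proof -
  obtain z :: int where "entry M \<theta> n - entry M \<phi> n = 2 * pi * of_int z"
    using assms(1) unfolding torus_eq_def entry_def by blast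
  then have z: "entry M \<phi> n = entry M \<theta> n - 2 * pi * of_int z" by simp
  show ?thesis
    using torus_fun_int_shift[OF assms(2), of "x - entry M \<theta> n *\<^sub>R e n" z "dir n"]
    by (simp add: z algebra_simps)
qed

lemma inf_torus_map_U: "inf_torus_map N U"
  unfolding inf_torus_map_def U_def[abs_def] moved_def
  using moved_torus_eq[OF _ B_torus] by simp

lemma inf_torus_map_P: "inf_torus_map N P"
  unfolding inf_torus_map_def P_def[abs_def] P\<^sub>0_def[abs_def]
  using moved_torus_eq[OF _ p_torus] by simp

lemma has_frechet_deriv_U: "has_frechet_deriv N S U (D \<theta>) \<theta>"
  unfolding has_frechet_deriv_def
proof (intro conjI ballI allI impI)
  fix n assume n: "n \<le> S"
  show "\<exists>C. \<forall>h\<in>bdd_seqs N. seminorm_inf n (D \<theta> h) \<le> C * seq_norm N h"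
    using seminorm_inf_le[OF Ck_bounded_Suc[OF D_bounded[OF abs_entry_le]] n]
    by (intro exI[of _ K]) (simp add: mult.commute)
  fix e :: real assume e: "0 < e"
  show "\<exists>\<delta>>0. \<forall>h\<in>bdd_seqs N. seq_norm N h < \<delta> \<longrightarrow>
      seminorm_inf n (\<lambda>x. U (seq_add \<theta> h) x - U \<theta> x - D \<theta> h x) \<le> e * seq_norm N h"
  proof (intro exI conjI ballI impI)
    \<comment> \<open>The remainder is at most \<open>K\<close> times the square of the norm; the
      summand 1 covers the case \<open>K = 0\<close>.\<close>
    show "0 < e / (K + 1)" using e K_nonneg by simp
    fix h assume h: "h \<in> bdd_seqs N" and s: "seq_norm N h < e / (K + 1)"
    have "seq_norm N h * K \<le> seq_norm N h * (K + 1)"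
      using seq_norm_nonneg[OF h] by (intro mult_left_mono) auto
    also have "\<dots> \<le> e" using s K_nonneg by (simp add: pos_less_divide_eq)
    finally have "seq_norm N h * K * seq_norm N h \<le> e * seq_norm N h"
      using seq_norm_nonneg[OF h] by (rule mult_right_mono)
    moreover have "seminorm_inf n (\<lambda>x. U (seq_add \<theta> h) x - U \<theta> x - D \<theta> h x) \<le> (seq_norm N h)\<^sup>2 * K"
      by (rule seminorm_inf_le[OF U_taylor[OF abs_entry_le[OF h]] n])
    ultimately show "seminorm_inf n (\<lambda>x. U (seq_add \<theta> h) x - U \<theta> x - D \<theta> h x) \<le> e * seq_norm N h"
      by (simp add: power2_eq_square mult_ac)
  qed
qed (simp_all add: D_in_Cs_div D_add D_scale)

lemma C1_with_deriv_U: "C1_with_deriv N S U D"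
  unfolding C1_with_deriv_def
proof (intro conjI ballI allI impI)
  fix \<theta> n and e :: real assume n: "n \<le> S" and e: "0 < e"
  show "\<exists>\<delta>>0. \<forall>g\<in>bdd_seqs N. seq_norm N g < \<delta> \<longrightarrow>
        (\<forall>h\<in>bdd_seqs N. seminorm_inf n (\<lambda>x. D (seq_add \<theta> g) h x - D \<theta> h x) \<le> e * seq_norm N h)"
  proof (intro exI conjI ballI impI)
    show "0 < e / (K + 1)" using e K_nonneg by simp
    fix g h assume g: "g \<in> bdd_seqs N" and s: "seq_norm N g < e / (K + 1)" and h: "h \<in> bdd_seqs N"
    have "seq_norm N g * K \<le> seq_norm N g * (K + 1)"
      using seq_norm_nonneg[OF g] by (intro mult_left_mono) auto
    also have "\<dots> \<le> e" using s K_nonneg by (simp add: pos_less_divide_eq)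
    finally have "seq_norm N g * K * seq_norm N h \<le> e * seq_norm N h"
      using seq_norm_nonneg[OF h] by (rule mult_right_mono)
    moreover have "seminorm_inf n (\<lambda>x. D (seq_add \<theta> g) h x - D \<theta> h x) \<le> seq_norm N h * seq_norm N g * K"
      by (rule seminorm_inf_le[OF D_continuous[OF abs_entry_le[OF g] abs_entry_le[OF h]] n])
    ultimately show "seminorm_inf n (\<lambda>x. D (seq_add \<theta> g) h x - D \<theta> h x) \<le> e * seq_norm N h"
      by (simp add: mult_ac)
  qed
qed (simp_all add: inf_torus_map_U U_in_Cs_div has_frechet_deriv_U)

lemma C1b_map_U: "C1b_map N S U"
  unfolding C1b_map_def
proof (intro exI[of _ D] conjI allI impI C1_with_deriv_U)
  fix n assume n: "n \<le> S"
  define C where "C = (\<Sum>n. MA n) + K + 1"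
  have "0 \<le> (\<Sum>n. MA n)" using MA Ck_bounded_nonneg[OF A_bounded] by (simp add: suminf_nonneg)
  then have C: "(\<Sum>n. MA n) + K \<le> C" "K \<le> C" "0 < C" using K_nonneg by (auto simp: C_def)
  show "\<exists>C>0. (\<forall>\<theta>\<in>bdd_seqs N. seminorm_inf n (U \<theta>) \<le> C) \<and>
        (\<forall>\<theta>\<in>bdd_seqs N. \<forall>h\<in>bdd_seqs N. seminorm_inf n (D \<theta> h) \<le> C * seq_norm N h)"
  proof (intro exI[of _ C] conjI ballI C)
    show "seminorm_inf n (U \<theta>) \<le> C" for \<theta>
      by (rule seminorm_inf_le[OF Ck_bounded_mono[OF U_bounded C(1)] n])
    show "seminorm_inf n (D \<theta> h) \<le> C * seq_norm N h" if h: "h \<in> bdd_seqs N" for \<theta> h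
    proof (rule seminorm_inf_le[OF Ck_bounded_mono[OF Ck_bounded_Suc[OF D_bounded[OF abs_entry_le[OF h]]]] n])
      show "seq_norm N h * K \<le> C * seq_norm N h"
        using mult_right_mono[OF C(2) seq_norm_nonneg[OF h]] by (simp add: mult.commute)
    qed
  qed
qed

section \<open>The Euler equations, one strip at a time\<close>

lemma U_active:
  "U \<theta> x = A (active x) x + moved \<theta> (active x) x"
  unfolding U_def
  using A_inactive B_inactive suminf_single[of "active x" "\<lambda>n. A n x"] suminf_single[of "active x" "\<lambda>n. moved \<theta> n x"]
  by (simp add: moved_def)

text \<open>Not a differentiation of \<open>U_active\<close>, where the index varies with
  \<open>x\<close>: the series is differentiated termwise and the inactive terms of the result are
  dropped.\<close>

lemma U_partial_active:
  "partial_deriv j (U \<theta>) x = partial_deriv j (A (active x)) x + partial_deriv j (moved \<theta> (active x)) x"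
  unfolding U_partial
  using A_inactive B_inactive suminf_single[of "active x" "\<lambda>n. partial_deriv j (A n) x"]
    suminf_single[of "active x" "\<lambda>n. partial_deriv j (moved \<theta> n) x"]
  by (simp add: moved_partial)

lemma P\<^sub>0_bounded: "Ck_bounded (\<Sum>n. MP n) S (P\<^sub>0 \<theta>)"
  unfolding P\<^sub>0_def[abs_def] by (intro Ck_bounded_series Ck_bounded_shift p_bounded MP)

lemma P\<^sub>0_gradient: "gradient (P\<^sub>0 \<theta>) x = gradient (p (active x)) (x - entry M \<theta> (active x) *\<^sub>R e (active x))"
proof -
  have "Ck_bounded (MP n) (Suc 0) (\<lambda>x. p n (x - entry M \<theta> n *\<^sub>R e n))" for n
    by (rule Ck_bounded_le[OF Ck_bounded_shift[OF p_bounded]]) (use S in simp)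
  from partial_deriv_series[OF this MP]
  have "partial_deriv j (P\<^sub>0 \<theta>) x = (\<Sum>n. partial_deriv j (p n) (x - entry M \<theta> n *\<^sub>R e n))" for j
    unfolding P\<^sub>0_def[abs_def] by (simp add: partial_deriv_shift)
  then show ?thesis
    using suminf_single[of "active x" "\<lambda>n. partial_deriv j (p n) (x - entry M \<theta> n *\<^sub>R e n)" for j] p_inactive
    by (simp add: gradient_def)
qed

lemma P_Ck: "Ck S (P \<theta>)"
  unfolding P_def[abs_def] by (intro Ck_diff Ck_const Ck_bounded_imp_Ck[OF P\<^sub>0_bounded])

lemma P_gradient: "gradient (P \<theta>) x = gradient (P\<^sub>0 \<theta>) x"
proof -
  have "P\<^sub>0 \<theta> differentiable_on UNIV"
    using Ck_bounded_le[OF P\<^sub>0_bounded S] by simp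
  then show ?thesis
    unfolding gradient_def P_def[abs_def] by (simp add: partial_deriv_diff)
qed

lemma P_torus: "torus_fun (P \<theta>)"
proof -
  have "torus_fun (P\<^sub>0 \<theta>)"
    unfolding P\<^sub>0_def[abs_def] by (intro torus_fun_series torus_fun_shift p_torus)
  then show ?thesis by (simp add: P_def torus_fun_def)
qed

lemma D_active:
  "D \<theta> h x = (- entry M h (active x)) *\<^sub>R partial_deriv (dir (active x)) (moved \<theta> (active x)) x"
  unfolding D_def
  by (rule suminf_single) (use B_inactive in \<open>simp add: moved_partial\<close>)

text \<open>\<open>D\<close> contributes minus \<open>entry M \<nu> n\<close> times the derivative
  of the vortex along \<open>dir n\<close>, and transport by the shear contributes the same with a
  plus sign. What remains is the stationary equation of the vortex at the shifted point. The
  identity holds for every phase, not just along one trajectory.\<close>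

lemma euler_U: "D \<theta> \<nu> x + convection (U \<theta>) x + gradient (P \<theta>) x = 0"
proof -
  define n where "n = active x"
  define x' where "x' = x - entry M \<theta> n *\<^sub>R e n"
  have "convection (U \<theta>) x = (\<Sum>j\<in>UNIV. (A n x $ j + B n x' $ j) *\<^sub>R (partial_deriv j (A n) x + partial_deriv j (B n) x'))"
    unfolding convection_def U_active U_partial_active
    by (simp add: n_def x'_def moved_partial moved_def)
  also have "\<dots> = convection (A n) x + (\<Sum>j\<in>UNIV. A n x $ j *\<^sub>R partial_deriv j (B n) x')
      + (\<Sum>j\<in>UNIV. B n x' $ j *\<^sub>R partial_deriv j (A n) x) + convection (B n) x'"
    by (simp add: convection_def scaleR_add_left scaleR_add_right sum.distrib)
  also have "\<dots> = entry M \<nu> n *\<^sub>R partial_deriv (dir n) (B n) x' + convection (B n) x'"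
    unfolding conv_AA x'_def conv_AB conv_BA by simp
  finally have "D \<theta> \<nu> x + convection (U \<theta>) x + gradient (P \<theta>) x = convection (B n) x' + gradient (p n) x'"
    unfolding P_gradient P\<^sub>0_gradient D_active by (simp add: n_def x'_def moved_partial)
  then show ?thesis using conv_BB by simp
qed

text \<open>By \<open>euler_U\<close> the convection is minus the sum of the field
  \<open>D \<theta> \<nu>\<close> and the gradient of the pressure. Against the gradient of a test
  function the first part integrates to 0, being divergence free, and the second gives the weak
  Laplacian.\<close>

lemma is_inv_neg_laplacian_P: "is_inv_neg_laplacian (distr_divergence (convection (U \<theta>))) (P \<theta>)"
  unfolding is_inv_neg_laplacian_def
proof (intro conjI ballI P_torus)
  show cP: "continuous_on UNIV (P \<theta>)" using P_Ck Ck_imp_continuous by blast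
  show "torus_integral (P \<theta>) = 0"
    unfolding P_def by (intro torus_integral_minus_mean Ck_imp_continuous[OF Ck_bounded_imp_Ck[OF P\<^sub>0_bounded]])
  fix \<phi> :: "real^'d \<Rightarrow> real" assume "\<phi> \<in> test_functions"
  then have \<phi>: "Ck n \<phi>" "torus_fun \<phi>" for n by (auto simp: test_functions_def)
  let ?W = "D \<theta> \<nu>"
  have W: "Ck (Suc 0) ?W" by (rule Ck_mono[OF Ck_bounded_imp_Ck[OF D_bounded[OF abs_entry_le[OF \<nu>]]]]) simp
  have P1: "Ck (Suc 0) (P \<theta>)" by (rule Ck_mono[OF P_Ck]) (use S in simp)
  have cg: "continuous_on UNIV (gradient f)" if "Ck (Suc 0) f" for f :: "real^'d \<Rightarrow> real"
    unfolding gradient_def[abs_def] using that by (auto intro!: continuous_on_vec_lambda)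
  have c: "continuous_on UNIV ?W" "continuous_on UNIV (gradient \<phi>)" "continuous_on UNIV (gradient (P \<theta>))"
    by (rule Ck_imp_continuous[OF W], rule cg[OF \<phi>(1)], rule cg[OF P1])
  have conv: "convection (U \<theta>) x \<bullet> gradient \<phi> x = - (?W x \<bullet> gradient \<phi> x + gradient (P \<theta>) x \<bullet> gradient \<phi> x)" for x
  proof -
    have "convection (U \<theta>) x = - (?W x + gradient (P \<theta>) x)"
      using euler_U[of \<theta> x] by (simp add: add_eq_0_iff algebra_simps)
    then show ?thesis by (simp add: inner_diff_left)
  qed
  have "distr_divergence (convection (U \<theta>)) \<phi>
      = torus_integral (\<lambda>x. ?W x \<bullet> gradient \<phi> x + gradient (P \<theta>) x \<bullet> gradient \<phi> x)"
    unfolding distr_divergence_def conv torus_integral_def by (simp only: integral_neg minus_minus)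
  also have "\<dots> = torus_integral (\<lambda>x. ?W x \<bullet> gradient \<phi> x) + torus_integral (\<lambda>x. gradient (P \<theta>) x \<bullet> gradient \<phi> x)"
    unfolding torus_integral_def
    by (intro integral_add continuous_imp_torus_integrable continuous_on_inner c)
  also have "torus_integral (\<lambda>x. ?W x \<bullet> gradient \<phi> x) = 0"
    using torus_integral_inner_gradient[OF W D_torus \<phi>(1) \<phi>(2)] D_div[OF \<nu>] by (simp add: torus_integral_def)
  also have "torus_integral (\<lambda>x. gradient (P \<theta>) x \<bullet> gradient \<phi> x) = torus_integral (\<lambda>x. P \<theta> x * (- laplacian \<phi> x))"
    by (rule torus_integral_inner_gradients[OF P1 P_torus \<phi>(1) \<phi>(2)])
  finally show "torus_integral (\<lambda>x. P \<theta> x * (- laplacian \<phi> x)) = distr_divergence (convection (U \<theta>)) \<phi>"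
    by simp
qed

text \<open>\<open>U_taylor\<close> with the increment \<open>seq_scale s \<nu>\<close> leaves a
  remainder quadratic in \<open>s\<close>.\<close>

lemma U_time_derivative:
  "((\<lambda>\<tau>. U (seq_add \<theta> (seq_scale \<tau> \<nu>)) x) has_vector_derivative D (seq_add \<theta> (seq_scale t \<nu>)) \<nu> x) (at t)"
proof -
  let ?u = "\<lambda>\<tau>. U (seq_add \<theta> (seq_scale \<tau> \<nu>)) x" and ?D = "D (seq_add \<theta> (seq_scale t \<nu>)) \<nu> x"
  define C where "C = (seq_norm N \<nu>)\<^sup>2 * K"
  have C: "0 \<le> C" using K_nonneg by (simp add: C_def)
  have est: "norm (?u (t + s) - ?u t - s *\<^sub>R ?D) \<le> s\<^sup>2 * C" for s
  proof -
    have "\<bar>entry M (seq_scale s \<nu>) n\<bar> \<le> \<bar>s\<bar> * seq_norm N \<nu>" for n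
      using abs_entry_le[OF \<nu>, of M n] by (simp add: entry_seq_scale abs_mult mult_left_mono)
    from Ck_bounded_norm[OF U_taylor[OF this], of "seq_add \<theta> (seq_scale t \<nu>)" x]
    have "norm (U (seq_add (seq_add \<theta> (seq_scale t \<nu>)) (seq_scale s \<nu>)) x - ?u t - s *\<^sub>R ?D) \<le> s\<^sup>2 * C"
      by (simp add: D_scale[OF \<nu>] C_def power_mult_distrib mult.assoc)
    moreover have "seq_add (seq_add \<theta> (seq_scale t \<nu>)) (seq_scale s \<nu>) = seq_add \<theta> (seq_scale (t + s) \<nu>)"
      by (simp add: seq_add_def seq_scale_def fun_eq_iff algebra_simps)
    ultimately show ?thesis by simp
  qed
  have "((\<lambda>s. norm (?u (t + s) - ?u t - s *\<^sub>R ?D) / norm s) \<longlongrightarrow> 0) (at 0)"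
  proof (rule Lim_null_comparison)
    have "((\<lambda>s::real. \<bar>s\<bar> * C) \<longlongrightarrow> \<bar>0\<bar> * C) (at 0)" by (intro tendsto_intros)
    then show "((\<lambda>s::real. \<bar>s\<bar> * C) \<longlongrightarrow> 0) (at 0)" by simp
    show "\<forall>\<^sub>F s in at 0. norm (norm (?u (t + s) - ?u t - s *\<^sub>R ?D) / norm s) \<le> \<bar>s\<bar> * C"
    proof (rule always_eventually, rule allI)
      fix s :: real
      have "norm (?u (t + s) - ?u t - s *\<^sub>R ?D) \<le> \<bar>s\<bar> * C * \<bar>s\<bar>"
      proof -
        have "\<bar>s\<bar> * C * \<bar>s\<bar> = s\<^sup>2 * C" by (cases "0 \<le> s") (auto simp: power2_eq_square)
        then show ?thesis using est[of s] by (simp only:)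
      qed
      then show "norm (norm (?u (t + s) - ?u t - s *\<^sub>R ?D) / norm s) \<le> \<bar>s\<bar> * C"
        using C by (cases "s = 0") (auto simp: pos_divide_le_eq)
    qed
  qed
  then show ?thesis
    unfolding has_vector_derivative_def has_derivative_at by (simp add: bounded_linear_scaleR_left)
qed

lemma euler_solution_U:
  "euler_solution (\<lambda>t. U (seq_add \<theta> (seq_scale t \<nu>))) (\<lambda>t. P (seq_add \<theta> (seq_scale t \<nu>)))"
  unfolding euler_solution_def
proof (intro conjI allI U_torus P_torus)
  show "U \<theta>' differentiable_on UNIV" "P \<theta>' differentiable_on UNIV" for \<theta>'
    using Ck_bounded_le[OF U_bounded S] Ck_mono[OF P_Ck S] by simp_all
  show "\<exists>ut. ((\<lambda>\<tau>. U (seq_add \<theta> (seq_scale \<tau> \<nu>)) x) has_vector_derivative ut) (at t) \<and>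
        ut + convection (U (seq_add \<theta> (seq_scale t \<nu>))) x + gradient (P (seq_add \<theta> (seq_scale t \<nu>))) x = 0 \<and>
        divergence (U (seq_add \<theta> (seq_scale t \<nu>))) x = 0" for t x
    using U_time_derivative euler_U U_div by blast
qed

section \<open>Injectivity and absence of translation symmetries\<close>

lemma U_profile:
  assumes "x $ y0 = Y n"
  shows "U \<theta> x $ y0 = g n (x $ dir n - entry M \<theta> n)"
proof -
  have "(x - entry M \<theta> n *\<^sub>R e n) $ y0 = Y n" using assms dir_neq[of n] by (simp add: axis_def)
  from B_profile[OF this] show ?thesis
    by (simp add: U_active active_Y[OF assms] A_y0 moved_def)
qed

text \<open>A constant profile would have the period 1, which is not an integer multiple of
  \<open>2 * pi\<close>.\<close>

lemma g_nonconst: "\<not> (\<forall>s t. g n s = g n t)"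
proof
  assume "\<forall>s t. g n s = g n t"
  then obtain z :: int where z: "1 = 2 * pi * of_int z" using g_periods[of n 1] by blast
  have "0 < 2 * pi * (of_int z :: real)" by (simp flip: z)
  then have "0 < (of_int z :: real)" by (simp only: zero_less_mult_iff) (use pi_gt_zero in linarith)
  then have "0 < z" by simp
  then have "1 \<le> (of_int z :: real)" by simp
  then have "2 * pi * 1 \<le> 2 * pi * of_int z" by (intro mult_left_mono) auto
  then show False using z pi_gt3 by linarith
qed

text \<open>At height \<open>Y n\<close> the component along \<open>y0\<close> is \<open>g n\<close>
  translated by the \<open>n\<close>-th phase. Equal fields make the difference of two phases a
  period of \<open>g n\<close>.\<close>

lemma inf_torus_inj_U: "inf_torus_inj N U"
  unfolding inf_torus_inj_def torus_eq_def
proof (intro ballI impI allI)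
  fix \<theta> \<phi> k i assume \<theta>: "\<theta> \<in> bdd_seqs N" and \<phi>: "\<phi> \<in> bdd_seqs N" and eq: "U \<theta> = U \<phi>"
  show "\<exists>z::int. \<theta> k i - \<phi> k i = 2 * pi * of_int z"
  proof (cases "k = 0 \<or> N k \<le> i")
    case True
    then have "\<theta> k i = 0" "\<phi> k i = 0" using \<theta> \<phi> unfolding bdd_seqs_def seq_support_def by blast+
    then show ?thesis by (intro exI[of _ 0]) simp
  next
    case False
    then have i: "i < M" using N_le[of k] by simp
    define n where "n = k * M + i"
    have n: "n div M = k" "n mod M = i" using i by (auto simp: n_def)
    have "g n (t + (\<theta> k i - \<phi> k i)) = g n t" for t
    proof -
      define x :: "real^'d" where "x = (\<chi> j. if j = y0 then Y n else t + \<theta> k i)"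
      have "x $ y0 = Y n" "x $ dir n = t + \<theta> k i" using dir_neq[of n] by (auto simp: x_def)
      then show ?thesis
        using U_profile[of x n \<theta>] U_profile[of x n \<phi>] eq by (simp add: entry_def n algebra_simps)
    qed
    then show ?thesis by (rule g_periods)
  qed
qed

lemma non_symmetric_U: "non_symmetric N U"
  unfolding non_symmetric_def
proof (intro ballI notI, elim exE conjE)
  fix \<theta> a assume a: "a \<noteq> 0" and inv: "\<forall>s x. U \<theta> (x + s *\<^sub>R a) = U \<theta> x"
  \<comment> \<open>A translation direction with a component along \<open>y0\<close> joins every
    point to the hyperplane \<open>y0 = 0\<close>, where all fields vanish; the whole field would be
    0.\<close>
  have a_y0: "a $ y0 = 0"
  proof (rule ccontr)
    assume ne: "a $ y0 \<noteq> 0"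
    have U0: "U \<theta> x = 0" for x
    proof -
      let ?x = "x + (- x $ y0 / a $ y0) *\<^sub>R a"
      have "?x $ y0 = 0" using ne by simp
      moreover then have "(?x - entry M \<theta> n *\<^sub>R e n) $ y0 = 0" for n
        using dir_neq[of n] by (simp add: axis_def)
      ultimately have "U \<theta> ?x = 0" using vanish by (simp add: U_active moved_def)
      moreover have "U \<theta> ?x = U \<theta> x" using inv by blast
      ultimately show ?thesis by simp
    qed
    have "g 0 s = 0" for s
    proof -
      define x :: "real^'d" where "x = (\<chi> j. if j = y0 then Y 0 else s + entry M \<theta> 0)"
      have "x $ y0 = Y 0" "x $ dir 0 = s + entry M \<theta> 0" using dir_neq[of 0] by (auto simp: x_def)
      then show ?thesis using U_profile[of x 0 \<theta>] U0 by simp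
    qed
    then show False using g_nonconst[of 0] by simp
  qed
  obtain b where b: "a $ b \<noteq> 0" using a by (auto simp: vec_eq_iff)
  then have "b \<noteq> y0" using a_y0 by auto
  \<comment> \<open>In a strip with shear direction \<open>b\<close>, moving along \<open>a\<close>
    keeps the height and runs through all values of the \<open>b\<close> coordinate, so invariance
    would force \<open>g n\<close> to be constant.\<close>
  then obtain n where n: "dir n = b" using dir_surj by blast
  have "g n s = g n t" for s t
  proof -
    define x :: "real^'d" where "x = (\<chi> j. if j = y0 then Y n else t + entry M \<theta> n)"
    let ?x = "x + ((s - t) / a $ b) *\<^sub>R a"
    have x: "x $ y0 = Y n" "x $ dir n = t + entry M \<theta> n" using dir_neq[of n] by (auto simp: x_def)
    then have x': "?x $ y0 = Y n" "?x $ dir n = s + entry M \<theta> n" using a_y0 b n by auto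
    show ?thesis using U_profile[OF x(1), of \<theta>] U_profile[OF x'(1), of \<theta>] inv x(2) x'(2) by simp
  qed
  then show False using g_nonconst[of n] by blast
qed

lemma embedding_solves_euler:
  "C1b_embedding N S U \<and> non_symmetric N U \<and>
   inf_torus_map N U \<and> (\<forall>\<theta>\<in>bdd_seqs N. U \<theta> \<in> Cs_div S) \<and>
   inf_torus_map N P \<and>
   (\<forall>\<theta>\<in>bdd_seqs N. P \<theta> \<in> Cs_torus S \<and>
      is_inv_neg_laplacian (distr_divergence (convection (U \<theta>))) (P \<theta>)) \<and>
   (\<forall>\<theta>\<in>bdd_seqs N.
      let u = (\<lambda>t. U (seq_add \<theta> (seq_scale t \<nu>)));
          p = (\<lambda>t. P (seq_add \<theta> (seq_scale t \<nu>)))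
      in u 0 = U \<theta> \<and> euler_solution u p \<and>
         (non_resonant \<eta> N \<nu> \<longrightarrow> time_almost_periodic \<eta> N S u))"
proof -
  have "seq_add \<theta> (seq_scale 0 \<nu>) = \<theta>" for \<theta> by (simp add: seq_add_def seq_scale_def)
  moreover have "time_almost_periodic \<eta> N S (\<lambda>t. U (seq_add \<theta> (seq_scale t \<nu>)))"
    if "non_resonant \<eta> N \<nu>" "\<theta> \<in> bdd_seqs N" for \<theta>
    unfolding time_almost_periodic_def C1_embedding_def
    using that \<nu> C1_with_deriv_U inf_torus_inj_U by blast
  moreover have "P \<theta> \<in> Cs_torus S" for \<theta> using P_torus P_Ck by (simp add: Cs_torus_def)
  ultimately show ?thesis
    by (simp add: C1b_embedding_def C1b_map_U inf_torus_inj_U non_symmetric_U inf_torus_map_U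
        U_in_Cs_div inf_torus_map_P is_inv_neg_laplacian_P euler_solution_U Let_def)
qed

end

section \<open>Vortices in disjoint strips\<close>

text \<open>The dyadic strip in which \<open>y\<close> lies between 2^(-n) and 2 * 2^(-n) is mapped
  onto the slab of points of absolute height below 2, which explains the numbers 4 and 6.\<close>

definition zoom :: "'d \<Rightarrow> nat \<Rightarrow> (real^'d \<Rightarrow> 'b) \<Rightarrow> real^'d \<Rightarrow> 'b" where
  "zoom y n f x = f ((4 * 2 ^ n) *\<^sub>R x - 6 *\<^sub>R axis y 1)"

lemma zoom_slab_supported:
  fixes f :: "real^'d \<Rightarrow> 'b::zero"
  assumes "slab_supported K f"
  shows "slab_supported K (zoom y n f)"
  unfolding slab_supported_def
proof (intro allI ballI impI)
  fix x :: "real^'d" and k assume k: "k \<in> K" and x: "2 < \<bar>x $ k\<bar>"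
  have "4 * 2 < 4 * 2 ^ n * \<bar>x $ k\<bar>"
  proof -
    have "4 * 1 * \<bar>x $ k\<bar> \<le> 4 * 2 ^ n * \<bar>x $ k\<bar>" by (intro mult_right_mono mult_left_mono) auto
    then show ?thesis using x by linarith
  qed
  then have "8 < \<bar>(4 * 2 ^ n) * x $ k\<bar>" by (simp add: abs_mult)
  then have "2 < \<bar>((4 * 2 ^ n) *\<^sub>R x - 6 *\<^sub>R axis y 1) $ k\<bar>" by (auto simp: axis_def)
  then show "zoom y n f x = 0" using assms k unfolding slab_supported_def zoom_def by blast
qed

lemma zoom_partial_deriv:
  "f differentiable_on UNIV \<Longrightarrow> partial_deriv j (zoom y n f) = (\<lambda>x. (4 * 2 ^ n) *\<^sub>R zoom y n (partial_deriv j f) x)"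
  unfolding zoom_def[abs_def] by (rule partial_deriv_affine)

lemma zoom_bounded:
  "Ck_bounded K s f \<Longrightarrow> Ck_bounded ((4 * 2 ^ n) ^ s * K) s (zoom y n f)"
  unfolding zoom_def[abs_def] by (rule Ck_bounded_affine) (simp add: order_trans[of 1 "4 * 1"])

lemma slab_supported_subset: "slab_supported K f \<Longrightarrow> L \<subseteq> K \<Longrightarrow> slab_supported L f"
  unfolding slab_supported_def by blast

lemma slab_supported_periodize:
  "slab_supported {b} f \<Longrightarrow> b \<noteq> y \<Longrightarrow> slab_supported {b} (periodize y f)"
  unfolding slab_supported_def periodize_def by (simp add: axis_def)

definition in_strip :: "nat \<Rightarrow> real \<Rightarrow> bool" where
  "in_strip n s \<longleftrightarrow> \<bar>4 * 2 ^ n * reduced s - 6\<bar> < 2"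

text \<open>Inside its own strip the scaled coordinate lies between 4 and 8, and passing to a larger
  index at least doubles it.\<close>

lemma in_strip_unique: "in_strip m s \<Longrightarrow> in_strip n s \<Longrightarrow> m = n"
proof -
  have *: "\<not> (in_strip m s \<and> in_strip n s)" if "m < n" for m n
  proof
    assume h: "in_strip m s \<and> in_strip n s"
    then have "4 < 4 * 2 ^ m * reduced s" unfolding in_strip_def by linarith
    then have "0 < 4 * 2 ^ m * reduced s" by linarith
    then have r: "0 < reduced s" by (simp add: zero_less_mult_iff)
    have "(2::real) ^ Suc m \<le> 2 ^ n" using that by (intro power_increasing) auto
    then have "4 * 2 ^ Suc m * reduced s \<le> 4 * 2 ^ n * reduced s" using r by (intro mult_right_mono) auto
    moreover have "4 * 2 ^ Suc m * reduced s = 2 * (4 * 2 ^ m * reduced s)" by simp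
    ultimately show False using h unfolding in_strip_def by linarith
  qed
  assume "in_strip m s" "in_strip n s"
  then show ?thesis using *[of m n] *[of n m] by (metis nat_neq_iff)
qed

context
  fixes y0 :: "'d::finite"
begin

text \<open>Outside all strips the value is arbitrary; the profiles used later all vanish
  there.\<close>

definition active_strip :: "real^'d \<Rightarrow> nat" where
  "active_strip x = (SOME n. in_strip n (x $ y0))"

lemma not_in_strip: "m \<noteq> active_strip x \<Longrightarrow> \<not> in_strip m (x $ y0)"
  unfolding active_strip_def using in_strip_unique someI by metis

lemma active_strip_eq: "in_strip n (x $ y0) \<Longrightarrow> active_strip x = n"
  using not_in_strip[of n x] by blast

definition strip_copy :: "nat \<Rightarrow> (real^'d \<Rightarrow> 'b) \<Rightarrow> real^'d \<Rightarrow> 'b" where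
  "strip_copy n f = periodize y0 (zoom y0 n f)"

definition strip_arg :: "nat \<Rightarrow> real^'d \<Rightarrow> real^'d" where
  "strip_arg n x = (4 * 2 ^ n) *\<^sub>R (x + (reduced (x $ y0) - x $ y0) *\<^sub>R axis y0 1) - 6 *\<^sub>R axis y0 1"

lemma strip_copy_eq: "strip_copy n f x = f (strip_arg n x)"
  by (simp add: strip_copy_def periodize_eq zoom_def strip_arg_def)

lemma strip_arg_y0: "strip_arg n x $ y0 = 4 * 2 ^ n * reduced (x $ y0) - 6"
  by (simp add: strip_arg_def)

lemma strip_copy_partial_deriv:
  fixes f :: "real^'d \<Rightarrow> 'b::real_normed_vector"
  assumes "f differentiable_on UNIV" "slab_supported {y0} f"
  shows "partial_deriv j (strip_copy n f) x = (4 * 2 ^ n) *\<^sub>R partial_deriv j f (strip_arg n x)"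
  unfolding strip_copy_def partial_deriv_periodize[OF zoom_slab_supported[OF assms(2)]] zoom_partial_deriv[OF assms(1)]
  by (simp add: periodize_eq zoom_def strip_arg_def)

lemma strip_copy_bounded:
  fixes f :: "real^'d \<Rightarrow> 'b::real_normed_vector"
  assumes "Ck_bounded K s f" "slab_supported {y0} f"
  shows "Ck_bounded ((4 * 2 ^ n) ^ s * K) s (strip_copy n f)"
  unfolding strip_copy_def
  by (rule Ck_bounded_periodize[OF zoom_bounded[OF assms(1)] zoom_slab_supported[OF assms(2)]])

text \<open>Periodized first in \<open>y0\<close>, then in \<open>b\<close>; confinement in
  direction \<open>b\<close> survives the first periodization and so permits the second.\<close>

definition blob_copy :: "nat \<Rightarrow> 'd \<Rightarrow> (real^'d \<Rightarrow> 'b) \<Rightarrow> real^'d \<Rightarrow> 'b" where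
  "blob_copy n b f = periodize b (strip_copy n f)"

definition blob_arg :: "nat \<Rightarrow> 'd \<Rightarrow> real^'d \<Rightarrow> real^'d" where
  "blob_arg n b x = strip_arg n (x + (reduced (x $ b) - x $ b) *\<^sub>R axis b 1)"

lemma blob_copy_eq: "blob_copy n b f x = f (blob_arg n b x)"
  by (simp add: blob_copy_def periodize_eq strip_copy_eq blob_arg_def)

lemma
  assumes "b \<noteq> y0"
  shows blob_arg_y0: "blob_arg n b x $ y0 = 4 * 2 ^ n * reduced (x $ y0) - 6"
    and blob_arg_b: "blob_arg n b x $ b = 4 * 2 ^ n * reduced (x $ b)"
  using assms by (simp_all add: blob_arg_def strip_arg_def axis_def)

lemma blob_copy_partial_deriv:
  fixes f :: "real^'d \<Rightarrow> 'b::real_normed_vector"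
  assumes "f differentiable_on UNIV" "slab_supported {b, y0} f" "b \<noteq> y0"
  shows "partial_deriv j (blob_copy n b f) x = (4 * 2 ^ n) *\<^sub>R partial_deriv j f (blob_arg n b x)"
proof -
  have y: "slab_supported {y0} f" and b: "slab_supported {b} f"
    using slab_supported_subset[OF assms(2)] by auto
  have "slab_supported {b} (strip_copy n f)"
    unfolding strip_copy_def by (rule slab_supported_periodize[OF zoom_slab_supported[OF b] assms(3)])
  from partial_deriv_periodize[OF this, of j] show ?thesis
    by (simp add: blob_copy_def periodize_eq strip_copy_partial_deriv[OF assms(1) y] blob_arg_def)
qed

lemma blob_copy_bounded:
  fixes f :: "real^'d \<Rightarrow> 'b::real_normed_vector"
  assumes "Ck_bounded K s f" "slab_supported {b, y0} f" "b \<noteq> y0"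
  shows "Ck_bounded ((4 * 2 ^ n) ^ s * K) s (blob_copy n b f)"
proof -
  have y: "slab_supported {y0} f" and b: "slab_supported {b} f"
    using slab_supported_subset[OF assms(2)] by auto
  show ?thesis unfolding blob_copy_def
  proof (rule Ck_bounded_periodize[OF strip_copy_bounded[OF assms(1) y]])
    show "slab_supported {b} (strip_copy n f)"
      unfolding strip_copy_def by (rule slab_supported_periodize[OF zoom_slab_supported[OF b] assms(3)])
  qed
qed

lemma zoom_periodic:
  fixes f :: "real^'d \<Rightarrow> 'b"
  assumes "depends_on K f" "i \<notin> K"
  shows "zoom y0 n f (x + (2 * pi) *\<^sub>R axis i 1) = zoom y0 n f x"
  unfolding zoom_def
  by (rule assms(1)[unfolded depends_on_def, rule_format]) (use assms(2) in \<open>auto simp: axis_def\<close>)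

lemma strip_copy_periodic:
  fixes f :: "real^'d \<Rightarrow> 'b"
  assumes "depends_on K f" "i = y0 \<or> i \<notin> K"
  shows "strip_copy n f (x + (2 * pi) *\<^sub>R axis i 1) = strip_copy n f x"
  unfolding strip_copy_def
  by (rule periodize_periodic) (use assms zoom_periodic in blast)

lemma strip_copy_torus: "depends_on {y0} f \<Longrightarrow> torus_fun (strip_copy n f)"
  unfolding torus_fun_def using strip_copy_periodic[of "{y0}" f] by blast

lemma blob_copy_torus:
  assumes "depends_on {b, y0} f"
  shows "torus_fun (blob_copy n b f)"
  unfolding torus_fun_def blob_copy_def
  by (intro allI periodize_periodic) (use strip_copy_periodic[OF assms] in blast)

text \<open>The inner truncated power vanishes up to height 1 and is at least 1 from height sqrt 2
  on. The outer one turns it into a cutoff of class \<open>C^S\<close>, as both exponents exceed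
  \<open>S\<close>.\<close>

definition plateau :: "nat \<Rightarrow> real^'d \<Rightarrow> real" where
  "plateau S x = max 0 (1 - max 0 ((x $ y0)\<^sup>2 - 1) ^ Suc S) ^ Suc S"

lemma plateau_Ck: "Ck S (plateau S)"
  unfolding plateau_def[abs_def] power2_eq_square
  by (intro Ck_pospower Ck_diff Ck_const Ck_mult Ck_component) auto

lemma plateau_eq_1: "\<bar>x $ y0\<bar> \<le> 1 \<Longrightarrow> plateau S x = 1"
  using power_le_one[of "\<bar>x $ y0\<bar>" 2] by (simp add: plateau_def)

lemma plateau_eq_0: "3 / 2 < \<bar>x $ y0\<bar> \<Longrightarrow> plateau S x = 0"
proof -
  assume "3 / 2 < \<bar>x $ y0\<bar>"
  then have "(3 / 2)\<^sup>2 \<le> \<bar>x $ y0\<bar>\<^sup>2" by (intro power_mono) auto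
  then have "1 \<le> (x $ y0)\<^sup>2 - 1" by (simp add: power2_eq_square)
  then have "1 ^ Suc S \<le> max 0 ((x $ y0)\<^sup>2 - 1) ^ Suc S" by (intro power_mono) auto
  then show ?thesis by (simp add: plateau_def)
qed

lemma plateau_depends: "depends_on {y0} (plateau S)"
  by (simp add: depends_on_def plateau_def)

lemma plateau_supported: "slab_supported {y0} (plateau S)"
  using plateau_eq_0 by (force simp: slab_supported_def)

lemma plateau_bounded: "\<exists>K. Ck_bounded K S (plateau S)"
  by (rule Ck_bounded_exists[OF plateau_Ck plateau_depends plateau_supported])

lemma open_coordinate_gt: "open {z :: real^'d. c < \<bar>z $ k\<bar>}"
  by (intro open_Collect_less continuous_intros)

lemma open_coordinate_lt: "open {z :: real^'d. \<bar>z $ k\<bar> < c}"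
  by (intro open_Collect_less continuous_intros)

lemma plateau_partial_deriv_off: "3 / 2 < \<bar>x $ y0\<bar> \<Longrightarrow> partial_deriv j (plateau S) x = 0"
  by (rule partial_deriv_vanish[OF open_coordinate_gt[of "3/2" y0]]) (use plateau_eq_0 in auto)

lemma plateau_partial_deriv_on: "\<bar>x $ y0\<bar> < 1 \<Longrightarrow> partial_deriv j (plateau S) x = 0"
proof -
  assume x: "\<bar>x $ y0\<bar> < 1"
  have "\<forall>\<^sub>F z in nhds x. plateau S z = 1"
    by (rule eventually_mono[OF eventually_nhds_in_open[OF open_coordinate_lt[of y0 1]]])
       (use x plateau_eq_1 in auto)
  from partial_deriv_cong_eventually[OF this] show ?thesis by simp
qed

lemma partial_deriv_independent:
  fixes f :: "real^'d \<Rightarrow> 'b::real_normed_vector"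
  assumes "depends_on K f" "j \<notin> K" "f differentiable_on UNIV"
  shows "partial_deriv j f x = 0"
proof -
  have "f (x + s *\<^sub>R axis j 1) = f x" for s
    by (rule assms(1)[unfolded depends_on_def, rule_format]) (use assms(2) in \<open>auto simp: axis_def\<close>)
  then have "((\<lambda>s. f x) has_vector_derivative partial_deriv j f (x + 0 *\<^sub>R axis j 1)) (at 0)"
    using has_vector_derivative_along_axis[OF assms(3), of x j 0] by simp
  then show ?thesis
    using vector_derivative_unique_at[OF _ has_vector_derivative_const] by fastforce
qed

text \<open>A radial vortex in the plane of the coordinates \<open>b\<close> and \<open>y0\<close>. Its convection is the
  centripetal acceleration, hence a gradient.\<close>

definition cap :: "'d \<Rightarrow> real^'d \<Rightarrow> real" where
  "cap b x = 1 - x $ b * x $ b - x $ y0 * x $ y0"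

definition vortex :: "nat \<Rightarrow> 'd \<Rightarrow> real^'d \<Rightarrow> real^'d" where
  "vortex q b x = (- (max 0 (cap b x) ^ Suc (Suc q) * x $ y0)) *\<^sub>R axis b 1
     + (max 0 (cap b x) ^ Suc (Suc q) * x $ b) *\<^sub>R axis y0 1"

text \<open>With angular velocity \<open>h\<close>, the acceleration of the vortex is half of the
  square of \<open>h\<close> times the gradient of \<open>cap\<close>. As that square is the power
  \<open>2 * q + 4\<close> of the truncated \<open>cap\<close>, minus half of its primitive is the
  pressure.\<close>

definition vortex_pressure :: "nat \<Rightarrow> 'd \<Rightarrow> real^'d \<Rightarrow> real" where
  "vortex_pressure q b x = (- 1 / (2 * real (2 * q + 5))) * max 0 (cap b x) ^ (2 * q + 5)"

lemma cap_nonpos: "1 \<le> \<bar>x $ b\<bar> \<or> 1 \<le> \<bar>x $ y0\<bar> \<Longrightarrow> cap b x \<le> 0"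
proof -
  have "1 \<le> t * t" if "1 \<le> \<bar>t\<bar>" for t :: real
    using power_mono[OF that, of 2] by (simp add: power2_eq_square)
  then show "1 \<le> \<bar>x $ b\<bar> \<or> 1 \<le> \<bar>x $ y0\<bar> \<Longrightarrow> cap b x \<le> 0"
    unfolding cap_def by (smt (verit) zero_le_square)
qed

lemma vortex_eq_0: "1 \<le> \<bar>x $ b\<bar> \<or> 1 \<le> \<bar>x $ y0\<bar> \<Longrightarrow> vortex q b x = 0"
  using cap_nonpos[of x b] by (simp add: vortex_def max_absorb1)

lemma vortex_pressure_eq_0: "1 \<le> \<bar>x $ b\<bar> \<or> 1 \<le> \<bar>x $ y0\<bar> \<Longrightarrow> vortex_pressure q b x = 0"
  using cap_nonpos[of x b] by (simp add: vortex_pressure_def max_absorb1)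

lemma vortex_partial_deriv_off: "1 < \<bar>x $ y0\<bar> \<Longrightarrow> partial_deriv j (vortex q b) x = 0"
  by (rule partial_deriv_vanish[OF open_coordinate_gt[of 1 y0]]) (use vortex_eq_0 in auto)

lemma vortex_pressure_partial_deriv_off: "1 < \<bar>x $ y0\<bar> \<Longrightarrow> partial_deriv j (vortex_pressure q b) x = 0"
  by (rule partial_deriv_vanish[OF open_coordinate_gt[of 1 y0]]) (use vortex_pressure_eq_0 in auto)

lemma cap_Ck: "Ck n (cap b)"
  unfolding cap_def[abs_def] by (intro Ck_diff Ck_const Ck_mult Ck_component)

lemma vortex_Ck: "n < Suc (Suc q) \<Longrightarrow> Ck n (vortex q b)"
  unfolding vortex_def[abs_def]
  by (intro Ck_add Ck_scaleR_const Ck_mult Ck_pospower cap_Ck Ck_component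
      Ck_bounded_linear[OF bounded_linear_minus[OF bounded_linear_ident]])

lemma vortex_pressure_Ck: "n < 2 * q + 5 \<Longrightarrow> Ck n (vortex_pressure q b)"
  unfolding vortex_pressure_def[abs_def] by (intro Ck_cmult Ck_pospower cap_Ck)

lemma
  shows vortex_depends: "depends_on {b, y0} (vortex q b)"
    and vortex_pressure_depends: "depends_on {b, y0} (vortex_pressure q b)"
  by (simp_all add: depends_on_def vortex_def vortex_pressure_def cap_def)

lemma
  shows vortex_supported: "slab_supported {b, y0} (vortex q b)"
    and vortex_pressure_supported: "slab_supported {b, y0} (vortex_pressure q b)"
  using vortex_eq_0[of _ b q] vortex_pressure_eq_0[of _ b q] by (force simp: slab_supported_def)+

lemma partial_deriv_coordinate: "partial_deriv j (\<lambda>x :: real^'d. x $ k) = (\<lambda>x. axis j 1 $ k)"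
  using partial_deriv_eq[OF bounded_linear_imp_has_derivative[OF bounded_linear_vec_nth]] by blast

lemma coordinate_differentiable: "(\<lambda>x :: real^'d. x $ k) differentiable_on UNIV"
  by (rule bounded_linear_imp_differentiable_on[OF bounded_linear_vec_nth])

lemma cap_differentiable: "cap b differentiable_on UNIV"
  using cap_Ck[of 1 b] by simp

lemma cap_partial_deriv:
  "partial_deriv j (cap b) x = - 2 * x $ b * axis j 1 $ b - 2 * x $ y0 * axis j 1 $ y0"
proof -
  note c = coordinate_differentiable
  note cc = differentiable_on_mult[OF c c]
  have d: "(\<lambda>x :: real^'d. 1 - x $ b * x $ b) differentiable_on UNIV"
    by (intro differentiable_on_diff differentiable_on_const cc)
  show ?thesis
    unfolding cap_def[abs_def] partial_deriv_diff[OF d cc] partial_deriv_diff[OF differentiable_on_const cc]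
      partial_deriv_mult[OF c c] partial_deriv_coordinate partial_deriv_const
    by (simp add: algebra_simps)
qed

lemma vortex_partial_deriv:
  "partial_deriv j (vortex q b) x =
    (let h = max 0 (cap b x) ^ Suc (Suc q);
         h' = real (Suc (Suc q)) * max 0 (cap b x) ^ Suc q * partial_deriv j (cap b) x
     in (- (h * axis j 1 $ y0 + h' * x $ y0)) *\<^sub>R axis b 1 + (h * axis j 1 $ b + h' * x $ b) *\<^sub>R axis y0 1)"
proof -
  let ?h = "\<lambda>x. max 0 (cap b x) ^ Suc (Suc q)"
  have h: "?h differentiable_on UNIV" by (rule partial_deriv_pospower(1)[OF cap_differentiable])
  have hc: "(\<lambda>x. ?h x * x $ k) differentiable_on UNIV" for k
    by (rule differentiable_on_mult[OF h coordinate_differentiable])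
  have T: "bounded_linear (\<lambda>t. (- t) *\<^sub>R axis b 1 :: real^'d)" "bounded_linear (\<lambda>t. t *\<^sub>R axis y0 1 :: real^'d)"
    by (simp_all add: bounded_linear_minus[OF bounded_linear_scaleR_left] bounded_linear_scaleR_left)
  have d: "(\<lambda>x. (- (?h x * x $ y0)) *\<^sub>R axis b 1 :: real^'d) differentiable_on UNIV"
    "(\<lambda>x. (?h x * x $ b) *\<^sub>R axis y0 1 :: real^'d) differentiable_on UNIV"
    using hc by (intro differentiable_on_scaleR differentiable_on_minus differentiable_on_const; simp)+
  show ?thesis
    unfolding vortex_def[abs_def] partial_deriv_add[OF d] partial_deriv_bounded_linear[OF hc T(1)]
      partial_deriv_bounded_linear[OF hc T(2)] partial_deriv_mult[OF h coordinate_differentiable]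
      partial_deriv_coordinate partial_deriv_pospower(2)[OF cap_differentiable]
    by (simp add: Let_def)
qed

lemma vortex_pressure_partial_deriv:
  "partial_deriv j (vortex_pressure q b) x =
    - (1 / 2) * (max 0 (cap b x) ^ Suc (Suc q))\<^sup>2 * partial_deriv j (cap b) x"
proof -
  have e: "2 * q + 5 = Suc (Suc (2 * q + 3))" by simp
  have m: "max 0 (cap b x) ^ Suc (2 * q + 3) = (max 0 (cap b x) ^ Suc (Suc q))\<^sup>2"
  proof -
    have "Suc (2 * q + 3) = Suc (Suc q) * 2" by simp
    then show ?thesis by (simp only: power_mult)
  qed
  have d: "(\<lambda>x. max 0 (cap b x) ^ (2 * q + 5)) differentiable_on UNIV"
    unfolding e by (rule partial_deriv_pospower(1)[OF cap_differentiable])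
  have "partial_deriv j (vortex_pressure q b) x
      = (- 1 / (2 * real (2 * q + 5))) * (real (2 * q + 5) * max 0 (cap b x) ^ Suc (2 * q + 3) * partial_deriv j (cap b) x)"
    unfolding vortex_pressure_def[abs_def] partial_deriv_bounded_linear[OF d bounded_linear_mult_right]
    unfolding e partial_deriv_pospower(2)[OF cap_differentiable] by simp
  also have "\<dots> = - (1 / 2) * (max 0 (cap b x) ^ Suc (Suc q))\<^sup>2 * partial_deriv j (cap b) x"
    unfolding m by (simp add: field_simps)
  finally show ?thesis .
qed

lemma sum_two: "(\<Sum>j\<in>UNIV. f j) = f b + f y0" if "b \<noteq> y0" "\<And>j. j \<noteq> b \<Longrightarrow> j \<noteq> y0 \<Longrightarrow> f j = 0"
  for f :: "'d \<Rightarrow> 'a::comm_monoid_add"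
proof -
  have "(\<Sum>j\<in>UNIV. f j) = (\<Sum>j\<in>{b, y0}. f j)"
    by (rule sum.mono_neutral_right) (use that in auto)
  then show ?thesis using that(1) by simp
qed

text \<open>The velocity is tangent to the level sets of \<open>cap\<close>, so the derivative of
  the amplitude along it is 0, and a rigid rotation is divergence free.\<close>

lemma vortex_div: "b \<noteq> y0 \<Longrightarrow> divergence (vortex q b) x = 0"
  unfolding divergence_def
  by (subst sum_two) (auto simp: vortex_partial_deriv Let_def cap_partial_deriv axis_def algebra_simps)

text \<open>By the same orthogonality the terms with \<open>k\<close>, the derivative of the
  amplitude, cancel. The remaining centripetal terms are balanced by the pressure gradient
  \<open>dp\<close>.\<close>

lemma vortex_stationary:
  assumes b: "b \<noteq> y0"
  shows "convection (vortex q b) x + gradient (vortex_pressure q b) x = 0"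
proof -
  define h where "h = max 0 (cap b x) ^ Suc (Suc q)"
  define k where "k = real (Suc (Suc q)) * max 0 (cap b x) ^ Suc q"
  have v: "vortex q b x $ b = - (h * x $ y0)" "vortex q b x $ y0 = h * x $ b"
    "\<And>j. j \<noteq> b \<Longrightarrow> j \<noteq> y0 \<Longrightarrow> vortex q b x $ j = 0"
    using b by (auto simp: vortex_def h_def axis_def)
  have dv: "partial_deriv j (vortex q b) x =
      (- (h * axis j 1 $ y0 + k * partial_deriv j (cap b) x * x $ y0)) *\<^sub>R axis b 1
      + (h * axis j 1 $ b + k * partial_deriv j (cap b) x * x $ b) *\<^sub>R axis y0 1" for j
    by (simp add: vortex_partial_deriv Let_def h_def k_def)
  have dp: "partial_deriv j (vortex_pressure q b) x = - (1 / 2) * h\<^sup>2 * partial_deriv j (cap b) x" for j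
    by (simp only: vortex_pressure_partial_deriv h_def)
  have "convection (vortex q b) x $ i + gradient (vortex_pressure q b) x $ i = 0" for i
    unfolding convection_def
    by (subst sum_two[OF b])
       (use b in \<open>auto simp: v dv dp gradient_def cap_partial_deriv axis_def power2_eq_square algebra_simps\<close>)
  then show ?thesis by (simp add: vec_eq_iff)
qed

end

section \<open>Choice of the profiles\<close>

text \<open>There are only finitely many shear directions, so the unscaled vortices have a common
  bound independent of the strip.\<close>

lemma Ck_bounded_uniform:
  fixes f :: "'a::finite \<Rightarrow> real^'d \<Rightarrow> 'b::real_normed_vector"
  assumes "\<And>b. b \<in> I \<Longrightarrow> \<exists>K. Ck_bounded K s (f b)"
  shows "\<exists>K. \<forall>b\<in>I. Ck_bounded K s (f b)"
proof -
  obtain k where k: "\<And>b. b \<in> I \<Longrightarrow> Ck_bounded (k b) s (f b)" using assms by metis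
  have "Ck_bounded (\<Sum>a\<in>I. k a) s (f b)" if "b \<in> I" for b
  proof (rule Ck_bounded_mono[OF k[OF that]])
    show "k b \<le> (\<Sum>a\<in>I. k a)"
      by (rule member_le_sum[OF that]) (use k Ck_bounded_nonneg in auto)
  qed
  then show ?thesis by blast
qed

lemma sum_scaled_axis: "(\<Sum>j\<in>UNIV. (a *\<^sub>R axis b 1 :: real^'d) $ j *\<^sub>R f j) = a *\<^sub>R f b"
  for f :: "'d::finite \<Rightarrow> 'v::real_vector"
proof -
  have "(\<Sum>j\<in>UNIV. (a *\<^sub>R axis b 1 :: real^'d) $ j *\<^sub>R f j) = (\<Sum>j\<in>UNIV. if j = b then a *\<^sub>R f b else 0)"
    by (intro sum.cong) (auto simp: axis_def)
  then show ?thesis by simp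
qed

text \<open>The profile is odd, nonnegative to the right of 0 and positive just right of 0. If the
  reduced period \<open>d\<close> were nonzero, a shift by \<open>d\<close> would carry a point
  close to 0 across 0, to where the sign is wrong.\<close>

lemma bump_profile_periods:
  fixes l c :: real
  assumes l: "0 < l" and c: "0 < c"
    and per: "\<And>t. c * (max 0 (1 - (l * reduced (t + \<delta>)) * (l * reduced (t + \<delta>))) ^ q * (l * reduced (t + \<delta>)))
      = c * (max 0 (1 - (l * reduced t) * (l * reduced t)) ^ q * (l * reduced t))"
  shows "\<exists>z::int. \<delta> = 2 * pi * of_int z"
proof -
  define \<beta> where "\<beta> s = max 0 (1 - (l * s) * (l * s)) ^ q * (l * s)" for s
  define d where "d = reduced \<delta>"
  have d: "\<bar>d\<bar> \<le> pi" unfolding d_def reduced_def by (rule round_period)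
  have \<beta>_per: "\<beta> (reduced (t + d)) = \<beta> (reduced t)" for t
  proof -
    have "t + \<delta> = t + d + 2 * pi * of_int (round (\<delta> / (2 * pi)))" by (simp add: d_def reduced_def)
    then have "reduced (t + \<delta>) = reduced (t + d)" by (simp only: reduced_int_shift)
    then show ?thesis using per[of t] c by (simp add: \<beta>_def)
  qed
  have pos: "0 \<le> \<beta> s" if "0 \<le> s" for s using l that by (simp add: \<beta>_def)
  have odd: "\<beta> (- s) = - \<beta> s" for s by (simp add: \<beta>_def)
  have strict: "0 < \<beta> s" if "0 < s" "s < 1 / l" for s
  proof -
    have "0 < l * s" "l * s < 1" using l that by (auto simp: field_simps)
    then have "(l * s) * (l * s) < 1 * 1" by (intro mult_strict_mono) auto
    then show ?thesis using \<open>0 < l * s\<close> by (simp add: \<beta>_def)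
  qed
  have "d = 0"
  proof (rule ccontr)
    assume "d \<noteq> 0"
    \<comment> \<open>Small enough to lie where the profile is positive and not to be carried beyond
      0 by less than \<open>d\<close>; the sign of the test point is chosen opposite to that of
      \<open>d\<close>.\<close>
    define \<eta> where "\<eta> = min (\<bar>d\<bar> / 2) (1 / (2 * l))"
    have \<eta>: "0 < \<eta>" "\<eta> < 1 / l" "\<eta> < \<bar>d\<bar>" "\<eta> < pi"
      using \<open>d \<noteq> 0\<close> l d pi_gt_zero by (auto simp: \<eta>_def min_less_iff_disj field_simps)
    show False
    proof (cases "0 < d")
      case True
      have "reduced (- \<eta> + d) = - \<eta> + d" "reduced (- \<eta>) = - \<eta>"
        using \<eta> d True by (auto intro!: reduced_eq)
      then have "\<beta> (- \<eta> + d) = - \<beta> \<eta>" using \<beta>_per[of "- \<eta>"] odd by simp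
      then show False using pos[of "- \<eta> + d"] strict[OF \<eta>(1,2)] \<eta>(3) True by simp
    next
      case False
      have "reduced (\<eta> + d) = \<eta> + d" "reduced \<eta> = \<eta>"
        using \<eta> d False by (auto intro!: reduced_eq)
      then have "\<beta> (\<eta> + d) = \<beta> \<eta>" using \<beta>_per[of \<eta>] by simp
      then show False using pos[of "- (\<eta> + d)"] odd[of "\<eta> + d"] strict[OF \<eta>(1,2)] \<eta>(3) False by simp
    qed
  qed
  then have "\<delta> = 2 * pi * of_int (round (\<delta> / (2 * pi)))" by (simp add: d_def reduced_def)
  then show ?thesis by blast
qed

lemma traveling_blobs_exist:
  fixes y0 :: "'d::finite" and \<nu> :: "nat \<Rightarrow> nat \<Rightarrow> real"
  assumes card: "2 \<le> CARD('d)" and S: "1 \<le> S" and N: "\<And>k. N k \<le> M" and \<nu>: "\<nu> \<in> bdd_seqs N"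
    and decay: "\<And>n. (4 * 2 ^ n) ^ S * \<bar>entry M \<nu> n\<bar> \<le> C * (1 / 2) ^ n"
  obtains dir active and A B :: "nat \<Rightarrow> real^'d \<Rightarrow> real^'d" and p MA MB MP Y g
  where "traveling_blobs S M N \<nu> dir active A B p MA MB MP y0 Y g"
proof -
  define l where "l n = (4 * 2 ^ n :: real)" for n :: nat
  have l: "0 < l n" "1 \<le> l n" for n
  proof -
    have "1 \<le> (2::real) ^ n" by simp
    then show "0 < l n" "1 \<le> l n" by (simp, unfold l_def, linarith+)
  qed
  \<comment> \<open>The enumeration of a finite nonempty set by all natural numbers has the whole
    set as its range, so every direction other than \<open>y0\<close> occurs.\<close>
  define dir where "dir = from_nat_into (UNIV - {y0})"
  have "UNIV - {y0} \<noteq> {}"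
  proof
    assume "UNIV - {y0} = {}"
    then have "(UNIV :: 'd set) = {y0}" by blast
    then have "CARD('d) = card {y0}" by (rule arg_cong)
    then show False using card by simp
  qed
  then have range: "range dir = UNIV - {y0}"
    unfolding dir_def by (intro range_from_nat_into countable_finite) auto
  have dir: "dir n \<noteq> y0" for n using range by blast
  obtain KA where KA: "Ck_bounded KA S (plateau y0 S)" using plateau_bounded by blast
  \<comment> \<open>The parameter \<open>Suc S\<close> gives the truncated power the exponent
    \<open>S + 3\<close>, hence class \<open>C^(S+2)\<close>.\<close>
  have "\<exists>K. \<forall>b\<in>UNIV - {y0}. Ck_bounded K (Suc (Suc S)) (vortex y0 (Suc S) b)"
    by (rule Ck_bounded_uniform) (rule Ck_bounded_exists[OF vortex_Ck vortex_depends vortex_supported], simp)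
  then obtain KB where KB: "Ck_bounded KB (Suc (Suc S)) (vortex y0 (Suc S) (dir n))" for n
    using dir by blast
  have "\<exists>K. \<forall>b\<in>UNIV - {y0}. Ck_bounded K S (vortex_pressure y0 (Suc S) b)"
    by (rule Ck_bounded_uniform)
       (rule Ck_bounded_exists[OF vortex_pressure_Ck vortex_pressure_depends vortex_pressure_supported], simp)
  then obtain KP where KP: "Ck_bounded KP S (vortex_pressure y0 (Suc S) (dir n))" for n
    using dir by blast
  \<comment> \<open>The denominator cancels the growth of the derivatives up to order
    \<open>S + 2\<close> under compression; the numerator provides summability.\<close>
  define c where "c n = (1 / 2) ^ n / l n ^ Suc (Suc S)" for n
  have c: "0 < c n" for n using l(1)[of n] by (simp add: c_def)
  define fA where "fA n z = (entry M \<nu> n * plateau y0 S z) *\<^sub>R (axis (dir n) 1 :: real^'d)" for n z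
  define fB where "fB n z = c n *\<^sub>R vortex y0 (Suc S) (dir n) z" for n z
  \<comment> \<open>The pressure is quadratic in the velocity, hence the square of the
    amplitude.\<close>
  define fp where "fp n z = (c n)\<^sup>2 *\<^sub>R vortex_pressure y0 (Suc S) (dir n) z" for n z
  define A where "A n = strip_copy y0 n (fA n)" for n
  define B where "B n = blob_copy y0 n (dir n) (fB n)" for n
  define p where "p n = blob_copy y0 n (dir n) (fp n)" for n
  define MA where "MA n = l n ^ S * (\<bar>entry M \<nu> n\<bar> * KA)" for n
  define MB where "MB n = l n ^ Suc (Suc S) * (\<bar>c n\<bar> * KB)" for n
  define MP where "MP n = l n ^ S * (\<bar>(c n)\<^sup>2\<bar> * KP)" for n
  \<comment> \<open>The height at which the scaled coordinate is 6, that is, the centre line of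
    strip \<open>n\<close>.\<close>
  define Y where "Y n = (3 / 2 / 2 ^ n :: real)" for n :: nat
  define g where "g n t = c n * (max 0 (1 - (l n * reduced t) * (l n * reduced t)) ^ Suc (Suc (Suc S)) * (l n * reduced t))" for n t

  have C1: "Ck 1 (plateau y0 S)" by (rule Ck_mono[OF plateau_Ck S])
  have diffs: "plateau y0 S differentiable_on UNIV" "vortex y0 (Suc S) b differentiable_on UNIV"
      "vortex_pressure y0 (Suc S) b differentiable_on UNIV" for b
    using C1 vortex_Ck[of 1 "Suc S" y0 b] vortex_pressure_Ck[of 1 "Suc S" y0 b] by simp_all
  have TA: "bounded_linear (\<lambda>t. (entry M \<nu> n * t) *\<^sub>R (axis (dir n) 1 :: real^'d))" for n
    by (intro bounded_linear_scaleR_left[THEN bounded_linear_compose] bounded_linear_mult_right)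
  have supp: "slab_supported {y0} (fA n)" "slab_supported {dir n, y0} (fB n)" "slab_supported {dir n, y0} (fp n)" for n
    using plateau_supported[of y0 S] vortex_supported[of "dir n" y0 "Suc S"] vortex_pressure_supported[of "dir n" y0 "Suc S"]
    by (auto simp: slab_supported_def fA_def fB_def fp_def)
  have deps: "depends_on {y0} (fA n)" "depends_on {dir n, y0} (fB n)" "depends_on {dir n, y0} (fp n)" for n
    using plateau_depends[of y0 S] vortex_depends[of "dir n" y0 "Suc S"] vortex_pressure_depends[of "dir n" y0 "Suc S"]
    unfolding depends_on_def fA_def fB_def fp_def by metis+
  have bA: "Ck_bounded (\<bar>entry M \<nu> n\<bar> * KA) S (fA n)" for n
    unfolding fA_def[abs_def] by (rule Ck_bounded_bounded_linear[OF TA _ _ KA]) (auto simp: abs_mult)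
  have bB: "Ck_bounded (\<bar>c n\<bar> * KB) (Suc (Suc S)) (fB n)" for n
    unfolding fB_def[abs_def] by (rule Ck_bounded_scaleR[OF KB])
  have bp: "Ck_bounded (\<bar>(c n)\<^sup>2\<bar> * KP) S (fp n)" for n
    unfolding fp_def[abs_def] by (rule Ck_bounded_scaleR[OF KP])
  have df: "fA n differentiable_on UNIV" "fB n differentiable_on UNIV" "fp n differentiable_on UNIV" for n
    using Ck_mono[OF Ck_bounded_imp_Ck[OF bA] S] Ck_bounded_imp_Ck[OF bB] Ck_mono[OF Ck_bounded_imp_Ck[OF bp] S] by simp_all
  let ?sa = "strip_arg y0" and ?ba = "\<lambda>n. blob_arg y0 n (dir n)"
  have A_eq: "A n x = (entry M \<nu> n * plateau y0 S (?sa n x)) *\<^sub>R axis (dir n) 1" for n x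
    by (simp add: A_def strip_copy_eq fA_def)
  have B_eq: "B n x = c n *\<^sub>R vortex y0 (Suc S) (dir n) (?ba n x)" for n x
    by (simp add: B_def blob_copy_eq fB_def)
  have pA: "partial_deriv j (A n) x = (l n * entry M \<nu> n * partial_deriv j (plateau y0 S) (?sa n x)) *\<^sub>R axis (dir n) 1" for j n x
    unfolding A_def strip_copy_partial_deriv[OF df(1) supp(1)]
    unfolding fA_def[abs_def] partial_deriv_bounded_linear[OF diffs(1) TA] by (simp add: l_def)
  have pB: "partial_deriv j (B n) x = (l n * c n) *\<^sub>R partial_deriv j (vortex y0 (Suc S) (dir n)) (?ba n x)" for j n x
    unfolding B_def blob_copy_partial_deriv[OF df(2) supp(2) dir]
    unfolding fB_def[abs_def] partial_deriv_bounded_linear[OF diffs(2) bounded_linear_scaleR_right] by (simp add: l_def)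
  have pp: "partial_deriv j (p n) x = (l n * (c n)\<^sup>2) * partial_deriv j (vortex_pressure y0 (Suc S) (dir n)) (?ba n x)" for j n x
    unfolding p_def blob_copy_partial_deriv[OF df(3) supp(3) dir]
    unfolding fp_def[abs_def] partial_deriv_bounded_linear[OF diffs(3) bounded_linear_scaleR_right] by (simp add: l_def)
  have sa: "?sa n x $ y0 = l n * reduced (x $ y0) - 6" for n x by (simp add: strip_arg_y0 l_def)
  have ba: "?ba n x $ y0 = l n * reduced (x $ y0) - 6" "?ba n x $ dir n = l n * reduced (x $ dir n)" for n x
    using dir by (simp_all add: blob_arg_y0 blob_arg_b l_def)
  have sh: "axis (dir n) (1::real) $ y0 = 0" for n
    using dir[of n] by (simp add: axis_def)
  have off: "2 \<le> \<bar>l m * reduced (x $ y0) - 6\<bar>" if "m \<noteq> active_strip y0 x" for m x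
    using not_in_strip[OF that] by (simp add: in_strip_def l_def)
  have plateau_indep: "partial_deriv j (plateau y0 S) z = 0" if "j \<noteq> y0" for j z
    by (rule partial_deriv_independent[OF plateau_depends _ diffs(1)]) (use that in simp)

  have "traveling_blobs S M N \<nu> dir (active_strip y0) A B p MA MB MP y0 Y g"
  proof (rule traveling_blobs.intro)
    show "1 \<le> S" "N k \<le> M" "\<nu> \<in> bdd_seqs N" for k by fact+
    show "Ck_bounded (MA n) S (A n)" for n
      unfolding MA_def A_def l_def by (rule strip_copy_bounded[OF bA supp(1)])
    show "Ck_bounded (MB n) (Suc (Suc S)) (B n)" for n
      unfolding MB_def B_def l_def by (rule blob_copy_bounded[OF bB supp(2) dir])
    show "Ck_bounded (MP n) S (p n)" for n
      unfolding MP_def p_def l_def by (rule blob_copy_bounded[OF bp supp(3) dir])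
    have geo: "summable (\<lambda>n. K * (1 / 2) ^ n)" for K :: real
      by (intro summable_mult summable_geometric) simp
    have nn: "0 \<le> KA" "0 \<le> KP" using Ck_bounded_nonneg KA KP by blast+
    \<comment> \<open>The place where the decay of \<nu> enters: \<open>MA n\<close> measures the
      compressed shear flow, whose speed cannot be reduced.\<close>
    show "summable MA"
    proof (rule summable_comparison_test'[OF geo[of "C * KA"], of 0])
      show "norm (MA n) \<le> C * KA * (1 / 2) ^ n" for n
        using mult_right_mono[OF decay[of n] nn(1)] l(1)[of n] nn(1)
        by (simp add: MA_def l_def abs_mult mult_ac)
    qed
    show "summable MB"
    proof -
      have "MB n = KB * (1 / 2) ^ n" for n
        using l(1)[of n] c[of n] by (simp add: MB_def c_def)
      then have "MB = (\<lambda>n. KB * (1 / 2) ^ n)" by blast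
      then show ?thesis using geo[of KB] by simp
    qed
    show "summable MP"
    proof (rule summable_comparison_test'[OF geo[of KP], of 0])
      fix n
      \<comment> \<open>Of the two factors \<open>c n\<close>, one absorbs the compression and the
        other is merely bounded by 1.\<close>
      have "l n ^ S \<le> l n ^ Suc (Suc S)" by (rule power_increasing) (use l in auto)
      then have "l n ^ S * c n \<le> l n ^ Suc (Suc S) * c n" using c[of n] by (intro mult_right_mono) auto
      also have "\<dots> = (1 / 2) ^ n" using l(1)[of n] by (simp add: c_def)
      finally have 1: "l n ^ S * c n \<le> (1 / 2) ^ n" .
      have "(1::real) ^ Suc (Suc S) \<le> l n ^ Suc (Suc S)" by (rule power_mono) (use l in auto)
      moreover have "(1 / 2 :: real) ^ n \<le> 1" by (rule power_le_one) auto
      ultimately have "c n \<le> 1" using l(1)[of n] by (simp add: c_def divide_le_eq del: power_Suc)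
      then have "(l n ^ S * c n) * c n \<le> (1 / 2) ^ n * 1" using 1 c[of n] l(1)[of n] by (intro mult_mono) auto
      from mult_right_mono[OF this nn(2)]
      show "norm (MP n) \<le> KP * (1 / 2) ^ n"
        using l(1)[of n] nn(2) by (simp add: MP_def abs_mult power2_eq_square mult_ac)
    qed
    show "torus_fun (A n)" "torus_fun (B n)" "torus_fun (p n)" for n
      unfolding A_def B_def p_def by (intro strip_copy_torus blob_copy_torus deps)+
    show "A m x = 0 \<and> partial_deriv j (A m) x = 0" if "m \<noteq> active_strip y0 x" for m x j
    proof -
      \<comment> \<open>The gap between 3/2 and the half width 2 of the slab makes the derivatives
        vanish on the boundary of the strip too.\<close>
      have "3 / 2 < \<bar>?sa m x $ y0\<bar>" using off[OF that] by (simp add: sa)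
      then show ?thesis by (simp add: A_eq pA plateau_eq_0 plateau_partial_deriv_off)
    qed
    show "B m (x - t *\<^sub>R axis (dir m) 1) = 0 \<and> partial_deriv j (B m) (x - t *\<^sub>R axis (dir m) 1) = 0"
      if "m \<noteq> active_strip y0 x" for m x j t
    proof -
      have "1 < \<bar>?ba m (x - t *\<^sub>R axis (dir m) 1) $ y0\<bar>" using off[OF that] by (simp add: ba sh)
      then show ?thesis by (simp add: B_eq pB vortex_eq_0 vortex_partial_deriv_off)
    qed
    show "partial_deriv j (p m) (x - t *\<^sub>R axis (dir m) 1) = 0" if "m \<noteq> active_strip y0 x" for m x j t
    proof -
      have "1 < \<bar>?ba m (x - t *\<^sub>R axis (dir m) 1) $ y0\<bar>" using off[OF that] by (simp add: ba sh)
      then show ?thesis by (simp add: pp vortex_pressure_partial_deriv_off)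
    qed
    show "divergence (A n) x = 0" for n x
      unfolding divergence_def pA
      by (rule sum.neutral) (use plateau_indep dir[of n] in \<open>auto simp: axis_def\<close>)
    show "divergence (B n) x = 0" for n x
      using vortex_div[OF dir[of n], of "Suc S" "?ba n x"]
      by (simp add: divergence_def pB flip: sum_distrib_left)
    show "convection (A n) x = 0" for n x
      unfolding convection_def A_eq sum_scaled_axis pA plateau_indep[OF dir] by simp
    show "(\<Sum>j\<in>UNIV. A n x $ j *\<^sub>R partial_deriv j (B n) (x - t *\<^sub>R axis (dir n) 1))
      = entry M \<nu> n *\<^sub>R partial_deriv (dir n) (B n) (x - t *\<^sub>R axis (dir n) 1)" for n x t
    proof -
      let ?x = "x - t *\<^sub>R axis (dir n) 1"
      \<comment> \<open>The plateau is 1 on the closed unit interval, and outside it the derivatives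
        of the vortex are 0. Below, for the opposite product, the open interval is used: there the
        plateau has derivative 0, and the vortex itself vanishes on the complement.\<close>
      have "plateau y0 S (?sa n x) *\<^sub>R partial_deriv (dir n) (B n) ?x = partial_deriv (dir n) (B n) ?x"
      proof (cases "\<bar>?sa n x $ y0\<bar> \<le> 1")
        case True
        then show ?thesis by (simp add: plateau_eq_1)
      next
        case False
        then have "1 < \<bar>?ba n ?x $ y0\<bar>" by (simp add: ba sh sa)
        then show ?thesis by (simp add: pB vortex_partial_deriv_off)
      qed
      then show ?thesis unfolding A_eq sum_scaled_axis by (simp flip: scaleR_scaleR)
    qed
    show "(\<Sum>j\<in>UNIV. B n (x - t *\<^sub>R axis (dir n) 1) $ j *\<^sub>R partial_deriv j (A n) x) = 0" for n x t
    proof (rule sum.neutral, intro ballI)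
      fix j
      let ?x = "x - t *\<^sub>R axis (dir n) 1"
      show "B n ?x $ j *\<^sub>R partial_deriv j (A n) x = 0"
      proof (cases "\<bar>?sa n x $ y0\<bar> < 1")
        case True
        then show ?thesis by (simp add: pA plateau_partial_deriv_on)
      next
        case False
        then have "1 \<le> \<bar>?ba n ?x $ y0\<bar>" by (simp add: ba sh sa)
        then show ?thesis by (simp add: B_eq vortex_eq_0)
      qed
    qed
    show "convection (B n) x + gradient (p n) x = 0" for n x
    proof -
      have "convection (B n) x = (l n * (c n)\<^sup>2) *\<^sub>R convection (vortex y0 (Suc S) (dir n)) (?ba n x)"
        by (simp add: convection_def B_eq pB scaleR_sum_right power2_eq_square mult_ac)
      moreover have "gradient (p n) x = (l n * (c n)\<^sup>2) *\<^sub>R gradient (vortex_pressure y0 (Suc S) (dir n)) (?ba n x)"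
        by (simp add: gradient_def pp vec_eq_iff)
      ultimately show ?thesis
        using vortex_stationary[OF dir[of n], of "Suc S" "?ba n x"] by (simp flip: scaleR_add_right)
    qed
    show "dir n \<noteq> y0" for n by (rule dir)
    show "\<exists>n. dir n = b" if "b \<noteq> y0" for b using range that by (metis DiffI UNIV_I image_iff singletonD)
    show "A n x = 0 \<and> B n x = 0" if "x $ y0 = 0" for n x
    proof -
      \<comment> \<open>At height 0 every strip sees the scaled coordinate -6, outside the support
        of all profiles.\<close>
      have "reduced 0 = 0" by (rule reduced_eq) simp
      then have "?sa n x $ y0 = - 6" "?ba n x $ y0 = - 6" using that by (simp_all add: sa ba)
      then show ?thesis by (simp add: A_eq B_eq plateau_eq_0 vortex_eq_0)
    qed
    show "A n x $ y0 = 0" for n x using dir[of n] by (simp add: A_eq axis_def)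
    have Y: "l n * reduced (Y n) = 6" for n
    proof -
      have "\<bar>Y n\<bar> \<le> 3 / 2" using one_le_power[of "2::real" n] by (simp add: Y_def divide_le_eq)
      then have "reduced (Y n) = Y n" using pi_gt3 by (intro reduced_eq) linarith
      then show ?thesis by (simp add: Y_def l_def)
    qed
    show "active_strip y0 x = n" if "x $ y0 = Y n" for x n
      by (rule active_strip_eq) (use Y[of n] that in \<open>simp add: in_strip_def l_def\<close>)
    show "B n x $ y0 = g n (x $ dir n)" if "x $ y0 = Y n" for x n
    proof -
      have "?ba n x $ y0 = 0" using that Y[of n] by (simp add: ba)
      then show ?thesis
        using dir[of n] by (simp add: B_eq vortex_def cap_def g_def ba axis_def)
    qed
    show "\<exists>z::int. \<delta> = 2 * pi * of_int z" if "\<And>t. g n (t + \<delta>) = g n t" for n \<delta>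
      using that unfolding g_def by (rule bump_profile_periods[OF l(1) c])
  qed
  then show thesis by (rule that)
qed

text \<open>The block of entry \<open>n\<close> has number \<open>n div M\<close>. A decay of
  \<epsilon>^(S+1) per block, with \<epsilon> < 2^(-M), amounts to at least a factor 2^(-(S+1)) per
  entry, up to a constant for the position inside the block.\<close>

lemma entry_decay:
  fixes \<nu> :: "nat \<Rightarrow> nat \<Rightarrow> real" and \<epsilon> :: real
  assumes \<epsilon>: "0 < \<epsilon>" "\<epsilon> < (1 / 2) ^ M" and M: "0 < M" and \<nu>: "\<nu> \<in> bdd_seqs N"
    and bdd: "bdd_above ((\<lambda>k. \<epsilon> powi (- int ((S + 1) * (k - 1))) * block_norm N \<nu> k) ` {1..})"
  shows "\<exists>C. \<forall>n. (4 * 2 ^ n) ^ S * \<bar>entry M \<nu> n\<bar> \<le> C * (1 / 2) ^ n"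
proof -
  obtain C where C: "\<And>k. 1 \<le> k \<Longrightarrow> \<epsilon> powi (- int ((S + 1) * (k - 1))) * block_norm N \<nu> k \<le> C"
    using bdd unfolding bdd_above_def by auto
  have C0: "0 \<le> C" using C[of 1] block_norm_nonneg[of N \<nu> 1] by simp
  have "(4 * 2 ^ n) ^ S * \<bar>entry M \<nu> n\<bar> \<le> (4 ^ S * C * 2 ^ (2 * M * (S + 1))) * (1 / 2) ^ n" for n
  proof (cases "n div M = 0 \<or> N (n div M) \<le> n mod M")
    case True
    then have "entry M \<nu> n = 0" using \<nu> unfolding bdd_seqs_def seq_support_def entry_def by blast
    then show ?thesis using C0 by simp
  next
    case False
    \<comment> \<open>The hypothesis has the exponent \<open>k - 1\<close> in block
      \<open>k\<close>; counting blocks from 0 removes the truncated subtraction.\<close>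
    define k where "k = n div M - 1"
    have k: "n div M = Suc k" using False by (simp add: k_def)
    have "n = n div M * M + n mod M" by simp
    then have nM: "n \<le> M * k + 2 * M" using mod_less_divisor[OF M, of n] k by (simp add: mult.commute)
    have "\<epsilon> powi (- int ((S + 1) * k)) * block_norm N \<nu> (Suc k) \<le> C" using C[of "Suc k"] by simp
    then have "block_norm N \<nu> (Suc k) \<le> C * \<epsilon> ^ ((S + 1) * k)"
      unfolding power_int_minus power_int_of_nat using zero_less_power[OF \<epsilon>(1), of "(S + 1) * k"]
      by (simp add: divide_le_eq mult.commute[of _ "block_norm N \<nu> (Suc k)"] flip: divide_inverse)
    moreover have "\<bar>entry M \<nu> n\<bar> \<le> block_norm N \<nu> (Suc k)"
      using abs_le_block_norm[of "n mod M" N "n div M" \<nu>] False k by (simp add: entry_def)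
    moreover have "\<epsilon> ^ ((S + 1) * k) \<le> ((1 / 2) ^ M) ^ ((S + 1) * k)"
      using \<epsilon> by (intro power_mono) auto
    ultimately have "\<bar>entry M \<nu> n\<bar> \<le> C * ((1 / 2) ^ M) ^ ((S + 1) * k)"
      using mult_left_mono[OF _ C0] by (meson order_trans)
    \<comment> \<open>The exponent is raised until it dominates \<open>(S + 1) * n\<close>, by
      \<open>n \<le> M * k + 2 * M\<close>; a constant factor compensates.\<close>
    also have "((1 / 2) ^ M) ^ ((S + 1) * k) = (1 / 2 :: real) ^ ((S + 1) * (M * k + 2 * M)) * 2 ^ (2 * M * (S + 1))"
    proof -
      have "(S + 1) * (M * k + 2 * M) = M * ((S + 1) * k) + 2 * M * (S + 1)" by (simp add: algebra_simps)
      then have "(1 / 2 :: real) ^ ((S + 1) * (M * k + 2 * M)) * 2 ^ (2 * M * (S + 1))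
        = (1 / 2) ^ (M * ((S + 1) * k)) * ((1 / 2) ^ (2 * M * (S + 1)) * 2 ^ (2 * M * (S + 1)))"
        by (simp only: power_add mult.assoc)
      also have "(1 / 2 :: real) ^ (2 * M * (S + 1)) * 2 ^ (2 * M * (S + 1)) = 1"
        by (simp only: power_mult_distrib[symmetric]) simp
      finally show ?thesis by (simp only: power_mult mult_1_right)
    qed
    also have "(1 / 2 :: real) ^ ((S + 1) * (M * k + 2 * M)) \<le> (1 / 2) ^ ((S + 1) * n)"
      using nM by (intro power_decreasing mult_le_mono2) auto
    finally have "\<bar>entry M \<nu> n\<bar> \<le> C * ((1 / 2) ^ ((S + 1) * n) * 2 ^ (2 * M * (S + 1)))"
      using C0 by (simp add: mult_left_mono mult_right_mono)
    then have "(4 * 2 ^ n) ^ S * \<bar>entry M \<nu> n\<bar>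
        \<le> (4 * 2 ^ n) ^ S * (C * ((1 / 2) ^ ((S + 1) * n) * 2 ^ (2 * M * (S + 1))))"
      by (intro mult_left_mono) auto
    also have "\<dots> = (4 ^ S * C * 2 ^ (2 * M * (S + 1))) * ((2 ^ n) ^ S * (1 / 2) ^ ((S + 1) * n))"
      by (simp add: power_mult_distrib mult_ac)
    \<comment> \<open>Compression uses up \<open>S\<close> of the \<open>S + 1\<close> powers of
      2^(-n); the last one survives.\<close>
    also have "(2 ^ n) ^ S * (1 / 2) ^ ((S + 1) * n) = (1 / 2 :: real) ^ n"
    proof -
      have "(1 / 2 :: real) ^ ((S + 1) * n) = (1 / 2) ^ (n * S) * (1 / 2) ^ n"
        by (simp add: algebra_simps flip: power_add)
      moreover have "(2::real) ^ (n * S) * (1 / 2) ^ (n * S) = 1"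
        by (simp only: power_mult_distrib[symmetric]) simp
      ultimately show ?thesis by (simp add: power_mult[symmetric] mult.assoc[symmetric])
    qed
    finally show ?thesis .
  qed
  then show ?thesis by blast
qed

theorem theorem1p3:
  fixes m S :: nat and J N :: "nat \<Rightarrow> nat" and \<eta> :: real
  assumes d: "CARD('d::finite) = 3 \<or> even CARD('d)"
    and m: "m \<in> {1..CARD('d) - 1}"
    and J_pos: "\<forall>k\<ge>1. 1 \<le> J k"
    and J_bdd: "bdd_above (J ` {1..})"
    and N: "N = (\<lambda>k. (CARD('d) - m) * J k)"
    and S: "1 \<le> S"
    and \<eta>: "0 < \<eta>"
  shows "\<exists>\<epsilon>\<^sub>0::real. 0 < \<epsilon>\<^sub>0 \<and> \<epsilon>\<^sub>0 < 1 \<and>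
    (\<forall>\<epsilon>. 0 < \<epsilon> \<and> \<epsilon> < \<epsilon>\<^sub>0 \<longrightarrow>
      (\<forall>\<nu>\<in>bdd_seqs N. \<nu> \<noteq> (\<lambda>k i. 0) \<and>
         bdd_above ((\<lambda>k. \<epsilon> powi (- int ((S + 1) * (k - 1))) * block_norm N \<nu> k) ` {1..}) \<longrightarrow>
        (\<exists>(U :: (nat \<Rightarrow> nat \<Rightarrow> real) \<Rightarrow> real^'d \<Rightarrow> real^'d)
            (u\<^sub>0 :: (nat \<Rightarrow> nat \<Rightarrow> real) \<Rightarrow> real^'d \<Rightarrow> real^'d)
            (P :: (nat \<Rightarrow> nat \<Rightarrow> real) \<Rightarrow> real^'d \<Rightarrow> real).
          C1b_embedding N S U \<and> non_symmetric N U \<and>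
          inf_torus_map N u\<^sub>0 \<and> (\<forall>\<theta>\<in>bdd_seqs N. u\<^sub>0 \<theta> \<in> Cs_div S) \<and>
          inf_torus_map N P \<and>
          (\<forall>\<theta>\<in>bdd_seqs N. P \<theta> \<in> Cs_torus S \<and>
             is_inv_neg_laplacian (distr_divergence (convection (U \<theta>))) (P \<theta>)) \<and>
          (\<forall>\<theta>\<in>bdd_seqs N.
             let u = (\<lambda>t. U (seq_add \<theta> (seq_scale t \<nu>)));
                 p = (\<lambda>t. P (seq_add \<theta> (seq_scale t \<nu>)))
             in u 0 = u\<^sub>0 \<theta> \<and> euler_solution u p \<and>
                (non_resonant \<eta> N \<nu> \<longrightarrow> time_almost_periodic \<eta> N S u)))))"
proof -
  \<comment> \<open>The range of \<open>m\<close> is nonempty only if there are two coordinates,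
    hence a shear direction besides \<open>y0\<close>.\<close>
  have card: "2 \<le> CARD('d)" using m by auto
  obtain Jmax where Jmax: "\<And>k. 1 \<le> k \<Longrightarrow> J k \<le> Jmax" using J_bdd unfolding bdd_above_def by auto
  \<comment> \<open>\<open>J 0\<close> is included because the linear enumeration bounds
    \<open>N k\<close> for \<open>k = 0\<close> too; the successor makes \<open>M\<close> positive,
    so that division by \<open>M\<close> enumerates and the power of 1/2 is below 1.\<close>
  define M where "M = Suc (CARD('d) * (J 0 + Jmax))"
  have NM: "N k \<le> M" for k
  proof -
    have "J k \<le> J 0 + Jmax" using Jmax[of k] by (cases k) auto
    then have "(CARD('d) - m) * J k \<le> CARD('d) * (J 0 + Jmax)" by (intro mult_le_mono) auto
    then show ?thesis by (simp add: N M_def)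
  qed
  have M: "0 < M" by (simp add: M_def)
  show ?thesis
  proof (intro exI[of _ "(1 / 2) ^ M"] conjI allI impI ballI; (elim conjE)?)
    show "(0::real) < (1 / 2) ^ M" by simp
    show "(1 / 2 :: real) ^ M < 1" unfolding M_def by (rule power_Suc_less_one) auto
    fix \<epsilon> :: real and \<nu>
    assume "0 < \<epsilon>" "\<epsilon> < (1 / 2) ^ M" and \<nu>: "\<nu> \<in> bdd_seqs N"
      and "bdd_above ((\<lambda>k. \<epsilon> powi (- int ((S + 1) * (k - 1))) * block_norm N \<nu> k) ` {1..})"
    then obtain C where C: "\<And>n. (4 * 2 ^ n) ^ S * \<bar>entry M \<nu> n\<bar> \<le> C * (1 / 2) ^ n"
      using entry_decay[OF _ _ M] by blast
    \<comment> \<open>No coordinate is preferred, so \<open>y0\<close> is the arbitrary element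
      \<open>undefined\<close> of the index type.\<close>
    obtain dir active p MA MB MP Y g and A B :: "nat \<Rightarrow> real^'d \<Rightarrow> real^'d" 
      where tb: "traveling_blobs S M N \<nu> dir active A B p MA MB MP undefined Y g"
      using traveling_blobs_exist[OF card S NM \<nu> C] .
    show "\<exists>(U :: (nat \<Rightarrow> nat \<Rightarrow> real) \<Rightarrow> real^'d \<Rightarrow> real^'d) (u\<^sub>0 :: (nat \<Rightarrow> nat \<Rightarrow> real) \<Rightarrow> real^'d \<Rightarrow> real^'d)
            (P :: (nat \<Rightarrow> nat \<Rightarrow> real) \<Rightarrow> real^'d \<Rightarrow> real).
          C1b_embedding N S U \<and> non_symmetric N U \<and>
          inf_torus_map N u\<^sub>0 \<and> (\<forall>\<theta>\<in>bdd_seqs N. u\<^sub>0 \<theta> \<in> Cs_div S) \<and>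
          inf_torus_map N P \<and>
          (\<forall>\<theta>\<in>bdd_seqs N. P \<theta> \<in> Cs_torus S \<and>
             is_inv_neg_laplacian (distr_divergence (convection (U \<theta>))) (P \<theta>)) \<and>
          (\<forall>\<theta>\<in>bdd_seqs N.
             let u = (\<lambda>t. U (seq_add \<theta> (seq_scale t \<nu>)));
                 p = (\<lambda>t. P (seq_add \<theta> (seq_scale t \<nu>)))
             in u 0 = u\<^sub>0 \<theta> \<and> euler_solution u p \<and>
                (non_resonant \<eta> N \<nu> \<longrightarrow> time_almost_periodic \<eta> N S u))"
      \<comment> \<open>Unification takes the embedding itself for the initial data, as
        \<open>u 0\<close> is its value at the initial phase.\<close>
      by (intro exI) (rule traveling_blobs.embedding_solves_euler[OF tb])
  qed
qed

end
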